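(* Let $A$ and $B$ be groups, let $X$ be a $B$-set, and let $G = A\wr_X B$ be the permutational wreath product. Assume that $A\neq\{1\}$, that $X\neq\emptyset$, and that $X$ has finitely many $B$-orbits, each of which contains more than one element. Then the following are equivalent: (i) $G$ has Property (FA); (ii) $B$ has Property (FA), and $A$ is a group with finite abelianisation which cannot be expressed as the union of a properly increasing sequence of subgroups.
   Context: A group $G$ has Property (FA) if every isometric action of $G$ on a (nonempty) simplicial tree has a fixed point (in the geometric realization); equivalently, every action of $G$ by automorphisms without inversions on a simplicial tree fixes a vertex. Given groups $A$, $B$ and a $B$-set $X$, the permutational wreath product is $A\wr_X B := A^{(X)}\rtimes B$, where $A^{(X)}=\bigoplus_{x\in X}A_x$ is the direct sum (finitely supported functions) of copies $A_x$ of $A$ indexed by $X$, and $B$ acts on $A^{(X)}$ by permuting the copies according to its action on $X$, so that $bA_xb^{-1}=A_{b.x}$. The abelianisation of $A$ is $A/[A,A]$. A group is the union of a properly increasing sequence of subgroups if it equals $\bigcup_{n\in\mathbf{N}}A_n$ for some subgroups $A_0\subsetneq A_1\subsetneq A_2\subsetneq\cdots$. No countability or finite generation of $A$ or $B$ is assumed. *)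

theory Defs
  imports "HOL-Algebra.Group_Action" "HOL-Algebra.Product_Groups" "HOL-Algebra.Generated_Groups"
begin

section \<open>Simplicial trees and Property (FA)\<close>

definition edge_rel :: "'v set set \<Rightarrow> ('v \<times> 'v) set" where
  "edge_rel E = {(u, v). {u, v} \<in> E}"

definition is_cycle :: "'v set set \<Rightarrow> 'v list \<Rightarrow> bool" where
  "is_cycle E p \<longleftrightarrow> 3 \<le> length p \<and> distinct p \<and>
     (\<forall>i < length p. {p ! i, p ! (Suc i mod length p)} \<in> E)"

definition simplicial_tree :: "'v set \<Rightarrow> 'v set set \<Rightarrow> bool" where
  "simplicial_tree V E \<longleftrightarrow>
     V \<noteq> {} \<and>
     (\<forall>e \<in> E. e \<subseteq> V \<and> card e = 2) \<and>
     (\<forall>u \<in> V. \<forall>v \<in> V. (u, v) \<in> (edge_rel E)\<^sup>*) \<and>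
     (\<nexists>p. is_cycle E p)"

definition tree_action ::
    "('g, 'm) monoid_scheme \<Rightarrow> 'v set \<Rightarrow> 'v set set \<Rightarrow> ('g \<Rightarrow> 'v \<Rightarrow> 'v) \<Rightarrow> bool" where
  "tree_action G V E \<phi> \<longleftrightarrow>
     group_action G V \<phi> \<and> (\<forall>g \<in> carrier G. (\<lambda>e. \<phi> g ` e) ` E = E)"

definition without_inversions ::
    "('g, 'm) monoid_scheme \<Rightarrow> 'v set set \<Rightarrow> ('g \<Rightarrow> 'v \<Rightarrow> 'v) \<Rightarrow> bool" where
  "without_inversions G E \<phi> \<longleftrightarrow>
     \<not> (\<exists>g \<in> carrier G. \<exists>u v. {u, v} \<in> E \<and> \<phi> g u = v \<and> \<phi> g v = u)"

text \<open>
  HOL cannot quantify over the type of vertices inside a definition, so trees are taken on subsets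
  of the type of lists over the underlying type of the group.  This loses nothing: the fact
  \<open>property_FA_fixes_vertex\<close> below gives a fixed vertex for trees over an arbitrary type.
\<close>

definition property_FA :: "('g, 'm) monoid_scheme \<Rightarrow> bool" where
  "property_FA G \<longleftrightarrow>
     (\<forall>(V :: 'g list set) E \<phi>.
        simplicial_tree V E \<and> tree_action G V E \<phi> \<and> without_inversions G E \<phi> \<longrightarrow>
        (\<exists>v \<in> V. \<forall>g \<in> carrier G. \<phi> g v = v))"

text \<open>
  The orbit of a vertex, together with all translates of walks joining it to its images, spans an
  invariant subtree, which is small enough to be copied to the type of lists.
\<close>

lemma invariant_subtree:
  fixes V :: "'v set" and G :: "('g, 'm) monoid_scheme"
  assumes T: "simplicial_tree V E" and A: "tree_action G V E \<phi>"
  shows "\<exists>W (c :: 'v \<Rightarrow> 'g list). W \<subseteq> V \<and> W \<noteq> {} \<and> inj_on c W \<and>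
           (\<forall>g \<in> carrier G. \<phi> g ` W \<subseteq> W) \<and> simplicial_tree W {e \<in> E. e \<subseteq> W}"
proof -
  interpret group_action G V \<phi> using A by (simp add: tree_action_def)
  interpret group G using group_hom group_hom.axioms(1) by auto
  have E: "\<phi> g ` e \<in> E" if "g \<in> carrier G" "e \<in> E" for g e
    using A that unfolding tree_action_def by blast
  obtain v0 where v0: "v0 \<in> V" using T by (auto simp: simplicial_tree_def)
  have "\<exists>f n. f 0 = v0 \<and> f n = \<phi> g v0 \<and> (\<forall>i<n. {f i, f (Suc i)} \<in> E)"
    if "g \<in> carrier G" for g
  proof -
    have "\<phi> g v0 \<in> V" using that v0 element_image by blast
    then have "(v0, \<phi> g v0) \<in> (edge_rel E)\<^sup>*"
      using T v0 unfolding simplicial_tree_def by blast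
    then obtain n where "(v0, \<phi> g v0) \<in> edge_rel E ^^ n"
      using rtrancl_imp_relpow by blast
    then show ?thesis unfolding relpow_fun_conv edge_rel_def by auto
  qed
  then obtain f :: "'g \<Rightarrow> nat \<Rightarrow> 'v" and n :: "'g \<Rightarrow> nat" where
    f: "\<And>g. g \<in> carrier G \<Longrightarrow>
          f g 0 = v0 \<and> f g (n g) = \<phi> g v0 \<and> (\<forall>i<n g. {f g i, f g (Suc i)} \<in> E)"
    by metis
  have fV: "f g i \<in> V" if "g \<in> carrier G" "i \<le> n g" for g i
  proof (cases i)
    case 0 then show ?thesis using f that v0 by auto
  next
    case (Suc j)
    then have "{f g j, f g (Suc j)} \<in> E" using f that by auto
    then show ?thesis using T Suc unfolding simplicial_tree_def by blast
  qed
  define W where "W = {\<phi> h (f g i) | h g i. h \<in> carrier G \<and> g \<in> carrier G \<and> i \<le> n g}"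
  have WV: "W \<subseteq> V" unfolding W_def using fV element_image by blast
  have W0: "\<phi> h v0 \<in> W" if "h \<in> carrier G" for h
  proof -
    have "\<phi> h v0 = \<phi> h (f \<one>\<^bsub>G\<^esub> 0)" using f[OF one_closed] by simp
    then show ?thesis unfolding W_def using that one_closed by blast
  qed
  have Winv: "\<phi> g ` W \<subseteq> W" if g: "g \<in> carrier G" for g
  proof
    fix w assume "w \<in> \<phi> g ` W"
    then obtain h k i where w: "w = \<phi> g (\<phi> h (f k i))" "h \<in> carrier G" "k \<in> carrier G" "i \<le> n k"
      unfolding W_def by auto
    then have "w = \<phi> (g \<otimes>\<^bsub>G\<^esub> h) (f k i)" using composition_rule g fV by simp
    then show "w \<in> W" unfolding W_def using w g by blast
  qed
  define F where "F = {e \<in> E. e \<subseteq> W}"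
  have step: "(\<phi> h (f g i), \<phi> h (f g (Suc i))) \<in> edge_rel F"
    if "h \<in> carrier G" "g \<in> carrier G" "i < n g" for h g i
  proof -
    have "\<phi> h ` {f g i, f g (Suc i)} \<in> E" using E f that by blast
    moreover have "\<phi> h (f g i) \<in> W" "\<phi> h (f g (Suc i)) \<in> W"
      unfolding W_def using that less_imp_le Suc_leI by blast+
    ultimately show ?thesis unfolding edge_rel_def F_def by simp
  qed
  have walk: "(\<phi> h v0, \<phi> h (f g i)) \<in> (edge_rel F)\<^sup>*"
    if "h \<in> carrier G" "g \<in> carrier G" "i \<le> n g" for h g i
    using that(3)
  proof (induction i)
    case 0 then show ?case using f that by simp
  next
    case (Suc i)
    then show ?case using step[OF that(1,2), of i] by (simp add: rtrancl.rtrancl_into_rtrancl)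
  qed
  have one: "\<phi> \<one>\<^bsub>G\<^esub> x = x" if "x \<in> V" for x
    using that by (metis id_eq_one restrict_apply')
  have fromv0: "(v0, w) \<in> (edge_rel F)\<^sup>*" if wW: "w \<in> W" for w
  proof -
    obtain h g i where w: "w = \<phi> h (f g i)" "h \<in> carrier G" "g \<in> carrier G" "i \<le> n g"
      using wW unfolding W_def by auto
    have "(\<phi> \<one>\<^bsub>G\<^esub> v0, \<phi> \<one>\<^bsub>G\<^esub> (f h (n h))) \<in> (edge_rel F)\<^sup>*" using walk w by simp
    then have "(v0, \<phi> h v0) \<in> (edge_rel F)\<^sup>*" using one v0 f w fV by (metis le_refl)
    with walk w show ?thesis by (metis rtrancl_trans)
  qed
  have "sym (edge_rel F)" unfolding sym_def edge_rel_def by (simp add: insert_commute)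
  then have "sym ((edge_rel F)\<^sup>*)" by (rule sym_rtrancl)
  then have conn: "(u, w) \<in> (edge_rel F)\<^sup>*" if "u \<in> W" "w \<in> W" for u w
    using that fromv0 by (meson rtrancl_trans symD)
  have tree: "simplicial_tree W F"
    unfolding simplicial_tree_def
  proof (intro conjI)
    show "W \<noteq> {}" using W0[OF one_closed] by blast
    show "\<forall>e \<in> F. e \<subseteq> W \<and> card e = 2" using T by (simp add: simplicial_tree_def F_def)
    show "\<forall>u \<in> W. \<forall>w \<in> W. (u, w) \<in> (edge_rel F)\<^sup>*" using conn by blast
    have "is_cycle E p" if "is_cycle F p" for p using that by (simp add: is_cycle_def F_def)
    then show "\<nexists>p. is_cycle F p" using T by (auto simp: simplicial_tree_def)
  qed
  define d where "d l = \<phi> (l ! 0) (f (l ! 1) (length l - 2))" for l :: "'g list"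
  have "\<exists>l. d l = w" if w: "w \<in> W" for w
  proof -
    obtain h g i where "w = \<phi> h (f g i)" using w unfolding W_def by auto
    then have "d (h # g # replicate i h) = w" unfolding d_def by simp
    then show ?thesis by blast
  qed
  then have "d (SOME l. d l = w) = w" if "w \<in> W" for w
    using that by (intro someI_ex[of "\<lambda>l. d l = w"])
  then have "inj_on (\<lambda>w. SOME l. d l = w) W"
    by (rule inj_on_inverseI)
  moreover have "W \<noteq> {}" using W0[OF one_closed] by blast
  ultimately show ?thesis
    using WV Winv tree unfolding F_def by (intro exI[of _ W] exI[of _ "\<lambda>w. SOME l. d l = w"] conjI) auto
qed

lemma simplicial_tree_image:
  assumes T: "simplicial_tree V E" and c: "inj_on c V"
  shows "simplicial_tree (c ` V) ((`) c ` E)"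
proof -
  have sub: "e \<subseteq> V" "card e = 2" if "e \<in> E" for e
    using T that unfolding simplicial_tree_def by auto
  have edge: "{u, v} \<in> E" if "{c u, c v} \<in> (`) c ` E" "u \<in> V" "v \<in> V" for u v
  proof -
    obtain e where e: "e \<in> E" "c ` {u, v} = c ` e" using \<open>{c u, c v} \<in> _\<close> by auto
    then have "{u, v} = e" using inj_on_image_eq_iff[OF c, of "{u, v}" e] sub that by auto
    with e show ?thesis by simp
  qed
  have conn: "(c u, c v) \<in> (edge_rel ((`) c ` E))\<^sup>*" if "(u, v) \<in> (edge_rel E)\<^sup>*" for u v
    using that
  proof (induction rule: rtrancl_induct)
    case base then show ?case by simp
  next
    case (step y z)
    then have "(c y, c z) \<in> edge_rel ((`) c ` E)"
      unfolding edge_rel_def by (auto intro!: image_eqI[of _ _ "{y, z}"])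
    with step show ?case by simp
  qed
  have acyc: False if p: "is_cycle ((`) c ` E) p" for p
  proof -
    define q where "q = map (inv_into V c) p"
    have pV: "p ! i \<in> c ` V" if "i < length p" for i
    proof -
      have "{p ! i, p ! (Suc i mod length p)} \<in> (`) c ` E" using p that by (auto simp: is_cycle_def)
      then show ?thesis using sub by blast
    qed
    have dq: "distinct q"
      unfolding q_def distinct_map using p pV
      by (auto simp: is_cycle_def in_set_conv_nth intro!: inj_on_subset[OF inj_on_inv_into[of "c ` V"]])
    have "{q ! i, q ! (Suc i mod length q)} \<in> E" if i: "i < length q" for i
    proof -
      have i': "i < length p" "Suc i mod length p < length p"
        using i unfolding q_def by (auto intro: mod_less_divisor)
      have "c (q ! i) = p ! i" "c (q ! (Suc i mod length q)) = p ! (Suc i mod length p)"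
        "q ! i \<in> V" "q ! (Suc i mod length q) \<in> V"
        using i' pV by (auto simp: q_def f_inv_into_f inv_into_into)
      then show ?thesis using edge p i' by (simp add: is_cycle_def)
    qed
    then have "is_cycle E q" using p dq by (simp add: is_cycle_def q_def)
    then show False using T by (auto simp: simplicial_tree_def)
  qed
  have "c ` e \<subseteq> c ` V \<and> card (c ` e) = 2" if "e \<in> E" for e
    using image_mono[OF sub(1)[OF that]] sub(2)[OF that]
      card_image[OF inj_on_subset[OF c sub(1)[OF that]]] by simp
  moreover have "\<nexists>p. is_cycle ((`) c ` E) p" using acyc by blast
  moreover have "c ` V \<noteq> {}" using T by (simp add: simplicial_tree_def)
  moreover have "\<forall>u \<in> c ` V. \<forall>v \<in> c ` V. (u, v) \<in> (edge_rel ((`) c ` E))\<^sup>*"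
    using T conn by (simp add: simplicial_tree_def)
  ultimately show ?thesis unfolding simplicial_tree_def by simp
qed

theorem property_FA_fixes_vertex:
  fixes V :: "'v set" and G :: "('g, 'm) monoid_scheme"
  assumes FA: "property_FA G" and T: "simplicial_tree V E"
    and A: "tree_action G V E \<phi>" and I: "without_inversions G E \<phi>"
  shows "\<exists>v \<in> V. \<forall>g \<in> carrier G. \<phi> g v = v"
proof -
  interpret group_action G V \<phi> using A by (simp add: tree_action_def)
  interpret group G using group_hom group_hom.axioms(1) by auto
  obtain W and c :: "'v \<Rightarrow> 'g list" where W: "W \<subseteq> V" "W \<noteq> {}" and c: "inj_on c W"
    and inv: "\<And>g. g \<in> carrier G \<Longrightarrow> \<phi> g ` W \<subseteq> W" and TW: "simplicial_tree W {e \<in> E. e \<subseteq> W}"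
    using invariant_subtree[OF T A] by metis
  define F where "F = {e \<in> E. e \<subseteq> W}"
  define d where "d = inv_into W c"
  have dc [simp]: "d (c w) = w" if "w \<in> W" for w using that c by (simp add: d_def)
  define \<psi> where "\<psi> g = (\<lambda>l \<in> c ` W. c (\<phi> g (d l)))" for g
  have one: "\<phi> \<one>\<^bsub>G\<^esub> x = x" if "x \<in> V" for x
    using that by (metis id_eq_one restrict_apply')
  have \<psi>c [simp]: "\<psi> g (c w) = c (\<phi> g w)" if "w \<in> W" for g w
    using that by (simp add: \<psi>_def)
  have inW: "\<phi> g w \<in> W" if "g \<in> carrier G" "w \<in> W" for g w using inv that by blast
  have comp: "\<psi> (g \<otimes>\<^bsub>G\<^esub> h) l = \<psi> g (\<psi> h l)" if "g \<in> carrier G" "h \<in> carrier G" "l \<in> c ` W" for g h l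
  proof -
    obtain w where w: "l = c w" "w \<in> W" using \<open>l \<in> c ` W\<close> by auto
    then show ?thesis using that inW composition_rule[of w g h] W by auto
  qed
  have bij: "\<psi> g \<in> Bij (c ` W)" if g: "g \<in> carrier G" for g
  proof -
    have id: "\<psi> \<one>\<^bsub>G\<^esub> l = l" if "l \<in> c ` W" for l using that one W by auto
    have "bij_betw (\<psi> g) (c ` W) (c ` W)"
    proof (rule bij_betw_byWitness[where f' = "\<psi> (inv\<^bsub>G\<^esub> g)"])
      show "\<forall>a\<in>c ` W. \<psi> (inv\<^bsub>G\<^esub> g) (\<psi> g a) = a"
        using g id comp[of "inv\<^bsub>G\<^esub> g" g] by (metis inv_closed l_inv)
      show "\<forall>a\<in>c ` W. \<psi> g (\<psi> (inv\<^bsub>G\<^esub> g) a) = a"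
        using g id comp[of g "inv\<^bsub>G\<^esub> g"] by (metis inv_closed r_inv)
    qed (use g inW in auto)
    then show ?thesis by (simp add: Bij_def \<psi>_def)
  qed
  have "\<psi> (g \<otimes>\<^bsub>G\<^esub> h) = compose (c ` W) (\<psi> g) (\<psi> h)" if "g \<in> carrier G" "h \<in> carrier G" for g h
    using comp that by (intro ext) (auto simp: compose_def \<psi>_def)
  then have "\<psi> \<in> hom G (BijGroup (c ` W))"
    using bij by (auto simp: hom_def BijGroup_def)
  then have "group_action G (c ` W) \<psi>"
    by (simp add: group_action_def group_hom_def group_hom_axioms_def group_BijGroup is_group)
  moreover have sub: "(\<lambda>e. \<psi> g ` e) ` ((`) c ` F) \<subseteq> (`) c ` F" if g: "g \<in> carrier G" for g
  proof
    fix x assume "x \<in> (\<lambda>e. \<psi> g ` e) ` ((`) c ` F)"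
    then obtain e where e: "x = \<psi> g ` c ` e" "e \<in> E" "e \<subseteq> W" by (auto simp: F_def)
    then have "x = c ` \<phi> g ` e" by (auto simp: image_image subset_iff intro!: image_cong)
    moreover have "\<phi> g ` e \<in> E" using A e g unfolding tree_action_def by blast
    then have "\<phi> g ` e \<in> F" using e g inW by (auto simp: F_def)
    ultimately show "x \<in> (`) c ` F" by simp
  qed
  moreover have "(`) c ` F \<subseteq> (\<lambda>e. \<psi> g ` e) ` ((`) c ` F)" if g: "g \<in> carrier G" for g
  proof
    fix x assume x: "x \<in> (`) c ` F"
    then have "\<psi> (inv\<^bsub>G\<^esub> g) ` x \<in> (`) c ` F" using sub[of "inv\<^bsub>G\<^esub> g"] g by blast
    moreover have xs: "x \<subseteq> c ` W" using x by (auto simp: F_def)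
    have "\<psi> g (\<psi> (inv\<^bsub>G\<^esub> g) l) = l" if l: "l \<in> x" for l
    proof -
      obtain w where "l = c w" "w \<in> W" using xs l by auto
      then have "\<psi> \<one>\<^bsub>G\<^esub> l = l" using one W by auto
      then show ?thesis using comp[of g "inv\<^bsub>G\<^esub> g" l] g subsetD[OF xs l] by simp
    qed
    then have "\<psi> g ` \<psi> (inv\<^bsub>G\<^esub> g) ` x = x" by (simp add: image_image)
    ultimately show "x \<in> (\<lambda>e. \<psi> g ` e) ` ((`) c ` F)" by (metis image_eqI)
  qed
  ultimately have act: "tree_action G (c ` W) ((`) c ` F) \<psi>"
    unfolding tree_action_def by (intro conjI ballI equalityI)
  have noinv: "without_inversions G ((`) c ` F) \<psi>"
    unfolding without_inversions_def
  proof (intro notI, elim bexE exE conjE)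
    fix g u v assume g: "g \<in> carrier G" and uv: "{u, v} \<in> (`) c ` F"
      and u: "\<psi> g u = v" and v: "\<psi> g v = u"
    have eq: "\<psi> g (\<psi> g v) = v" using u v by simp
    from uv obtain e where e: "{\<psi> g v, v} = c ` e" "e \<in> E" "e \<subseteq> W"
      using v unfolding F_def by blast
    then have "v \<in> c ` W" by blast
    then obtain w where w: "w \<in> W" "v = c w" by auto
    have "c ` {\<phi> g w, w} = c ` e" using e w by simp
    then have "{\<phi> g w, w} \<in> E"
      using inj_on_image_eq_iff[OF c, of "{\<phi> g w, w}" e] e w inW g by auto
    moreover have "\<phi> g (\<phi> g w) = w"
    proof -
      have "c (\<phi> g (\<phi> g w)) = c w" using eq w inW g by simp
      then show ?thesis using inj_onD[OF c _ inW[OF g inW[OF g w(1)]] w(1)] by blast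
    qed
    ultimately show False using I g unfolding without_inversions_def by blast
  qed
  have "simplicial_tree (c ` W) ((`) c ` F)"
    using simplicial_tree_image[OF TW c] unfolding F_def .
  then have "\<exists>l \<in> c ` W. \<forall>g \<in> carrier G. \<psi> g l = l"
    using FA[unfolded property_FA_def, rule_format, of "c ` W" "(`) c ` F" \<psi>] act noinv by simp
  then obtain l where l: "l \<in> c ` W" "\<forall>g \<in> carrier G. \<psi> g l = l" by (elim bexE)
  then obtain w where w: "w \<in> W" "l = c w" by auto
  have "\<phi> g w = w" if g: "g \<in> carrier G" for g
  proof -
    have "c (\<phi> g w) = c w" using l w g \<psi>c by metis
    then show ?thesis using inj_onD[OF c _ inW[OF g w(1)] w(1)] by blast
  qed
  with w W show ?thesis by blast
qed


section \<open>Permutational wreath products\<close>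

definition semidirect_product ::
    "('n, 'p) monoid_scheme \<Rightarrow> ('h, 'q) monoid_scheme \<Rightarrow> ('h \<Rightarrow> 'n \<Rightarrow> 'n) \<Rightarrow> ('n \<times> 'h) monoid" where
  "semidirect_product N H \<alpha> =
     \<lparr>carrier = carrier N \<times> carrier H,
      monoid.mult = (\<lambda>(n, h) (n', h'). (n \<otimes>\<^bsub>N\<^esub> \<alpha> h n', h \<otimes>\<^bsub>H\<^esub> h')),
      one = (\<one>\<^bsub>N\<^esub>, \<one>\<^bsub>H\<^esub>)\<rparr>"

lemma group_semidirect_product:
  assumes "group N" "group H" "\<alpha> \<in> hom H (AutoGroup N)"
  shows "group (semidirect_product N H \<alpha>)"
proof -
  interpret N: group N by fact
  interpret H: group H by fact
  have auto: "\<alpha> h \<in> auto N" if "h \<in> carrier H" for h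
    using assms(3) that by (auto simp: hom_def AutoGroup_def)
  then have cl: "\<alpha> h n \<in> carrier N" and mu: "\<alpha> h (n \<otimes>\<^bsub>N\<^esub> n') = \<alpha> h n \<otimes>\<^bsub>N\<^esub> \<alpha> h n'"
    if "h \<in> carrier H" "n \<in> carrier N" "n' \<in> carrier N" for h n n'
    using that by (auto simp: auto_def hom_def Pi_iff)
  have Bij: "\<alpha> h \<in> Bij (carrier N)" if "h \<in> carrier H" for h
    using auto that by (auto simp: auto_def)
  have co: "\<alpha> (h \<otimes>\<^bsub>H\<^esub> h') n = \<alpha> h (\<alpha> h' n)"
    if "h \<in> carrier H" "h' \<in> carrier H" "n \<in> carrier N" for h h' n
    using assms(3) that Bij by (auto simp: hom_def AutoGroup_def BijGroup_def compose_def)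
  have one: "\<alpha> \<one>\<^bsub>H\<^esub> n = n" if "n \<in> carrier N" for n
  proof -
    have "\<alpha> \<one>\<^bsub>H\<^esub> (\<alpha> \<one>\<^bsub>H\<^esub> n) = \<alpha> \<one>\<^bsub>H\<^esub> n" using co[of "\<one>\<^bsub>H\<^esub>" "\<one>\<^bsub>H\<^esub>" n] that by simp
    moreover have "inj_on (\<alpha> \<one>\<^bsub>H\<^esub>) (carrier N)"
      using Bij[of "\<one>\<^bsub>H\<^esub>"] by (auto simp: Bij_def bij_betw_def)
    ultimately show ?thesis using cl[of "\<one>\<^bsub>H\<^esub>" n n] that by (auto dest: inj_onD)
  qed
  show ?thesis
  proof (rule groupI)
    fix x assume "x \<in> carrier (semidirect_product N H \<alpha>)"
    then obtain n h where x: "x = (n, h)" "n \<in> carrier N" "h \<in> carrier H"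
      by (auto simp: semidirect_product_def)
    then show "\<one>\<^bsub>semidirect_product N H \<alpha>\<^esub> \<otimes>\<^bsub>semidirect_product N H \<alpha>\<^esub> x = x"
      by (simp add: semidirect_product_def one)
    have "(\<alpha> (inv\<^bsub>H\<^esub> h) (inv\<^bsub>N\<^esub> n), inv\<^bsub>H\<^esub> h) \<otimes>\<^bsub>semidirect_product N H \<alpha>\<^esub> x
            = \<one>\<^bsub>semidirect_product N H \<alpha>\<^esub>"
      using x mu[of "inv\<^bsub>H\<^esub> h" "inv\<^bsub>N\<^esub> n" n] mu[of "inv\<^bsub>H\<^esub> h" "\<one>\<^bsub>N\<^esub>" "\<one>\<^bsub>N\<^esub>"] cl[of "inv\<^bsub>H\<^esub> h" "\<one>\<^bsub>N\<^esub>"]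
      by (simp add: semidirect_product_def)
    then show "\<exists>y \<in> carrier (semidirect_product N H \<alpha>).
        y \<otimes>\<^bsub>semidirect_product N H \<alpha>\<^esub> x = \<one>\<^bsub>semidirect_product N H \<alpha>\<^esub>"
      using x cl by (intro bexI[of _ "(\<alpha> (inv\<^bsub>H\<^esub> h) (inv\<^bsub>N\<^esub> n), inv\<^bsub>H\<^esub> h)"])
        (auto simp: semidirect_product_def)
  qed (auto simp: semidirect_product_def cl mu co N.m_assoc H.m_assoc)
qed

text \<open>
  The automorphism \<open>(b. f) x = f (b\<^sup>-\<^sup>1. x)\<close>, which carries the copy of \<open>A\<close> at \<open>x\<close> to the copy
  at \<open>b. x\<close>.
\<close>

definition permute_copies ::
    "('a, 'p) monoid_scheme \<Rightarrow> 'x set \<Rightarrow> ('b, 'q) monoid_scheme \<Rightarrow> ('b \<Rightarrow> 'x \<Rightarrow> 'x) \<Rightarrow>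
     'b \<Rightarrow> ('x \<Rightarrow> 'a) \<Rightarrow> ('x \<Rightarrow> 'a)" where
  "permute_copies A X B \<phi> b = (\<lambda>f \<in> carrier (sum_group X (\<lambda>_. A)). \<lambda>x \<in> X. f (\<phi> (inv\<^bsub>B\<^esub> b) x))"

definition wreath_product ::
    "('a, 'p) monoid_scheme \<Rightarrow> 'x set \<Rightarrow> ('b, 'q) monoid_scheme \<Rightarrow> ('b \<Rightarrow> 'x \<Rightarrow> 'x) \<Rightarrow>
     (('x \<Rightarrow> 'a) \<times> 'b) monoid" where
  "wreath_product A X B \<phi> = semidirect_product (sum_group X (\<lambda>_. A)) B (permute_copies A X B \<phi>)"

lemma permute_copies_hom:
  assumes "group A" "group_action B X \<phi>"
  shows "permute_copies A X B \<phi> \<in> hom B (AutoGroup (sum_group X (\<lambda>_. A)))"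
proof -
  interpret A: group A by fact
  interpret group_action B X \<phi> by fact
  interpret B: group B using group_hom group_hom.axioms(1) by auto
  let ?S = "carrier (sum_group X (\<lambda>_. A))" and ?p = "permute_copies A X B \<phi>"
  have S: "?S = {f \<in> X \<rightarrow>\<^sub>E carrier A. finite {x \<in> X. f x \<noteq> \<one>\<^bsub>A\<^esub>}}"
    using assms(1) by (simp add: carrier_sum_group)
  have \<phi>X: "\<phi> b x \<in> X" if "b \<in> carrier B" "x \<in> X" for b x using that element_image by blast
  have p: "?p b f = (\<lambda>x \<in> X. f (\<phi> (inv\<^bsub>B\<^esub> b) x))" if "f \<in> ?S" for b f
    using that by (simp add: permute_copies_def)
  have one: "\<phi> \<one>\<^bsub>B\<^esub> x = x" if "x \<in> X" for x
    using that by (metis id_eq_one restrict_apply')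
  have cl: "?p b f \<in> ?S" if b: "b \<in> carrier B" and f: "f \<in> ?S" for b f
  proof -
    have "{x \<in> X. f (\<phi> (inv\<^bsub>B\<^esub> b) x) \<noteq> \<one>\<^bsub>A\<^esub>} \<subseteq> \<phi> b ` {x \<in> X. f x \<noteq> \<one>\<^bsub>A\<^esub>}"
    proof clarify
      fix x assume x: "x \<in> X" "f (\<phi> (inv\<^bsub>B\<^esub> b) x) \<noteq> \<one>\<^bsub>A\<^esub>"
      then have "x = \<phi> b (\<phi> (inv\<^bsub>B\<^esub> b) x)"
        using composition_rule[of x b "inv\<^bsub>B\<^esub> b"] b one by simp
      then show "x \<in> \<phi> b ` {x \<in> X. f x \<noteq> \<one>\<^bsub>A\<^esub>}" using x \<phi>X b by blast
    qed
    then have "finite {x \<in> X. f (\<phi> (inv\<^bsub>B\<^esub> b) x) \<noteq> \<one>\<^bsub>A\<^esub>}"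
      using f S by (auto elim: finite_subset)
    moreover have "{x \<in> X. ?p b f x \<noteq> \<one>\<^bsub>A\<^esub>} = {x \<in> X. f (\<phi> (inv\<^bsub>B\<^esub> b) x) \<noteq> \<one>\<^bsub>A\<^esub>}"
      using p[OF f] by auto
    moreover have "?p b f \<in> X \<rightarrow>\<^sub>E carrier A" using f b \<phi>X p S by auto
    ultimately show ?thesis by (simp add: S)
  qed
  have comp: "?p (b \<otimes>\<^bsub>B\<^esub> b') f = ?p b (?p b' f)"
    if b: "b \<in> carrier B" "b' \<in> carrier B" and f: "f \<in> ?S" for b b' f
  proof -
    have "\<phi> (inv\<^bsub>B\<^esub> (b \<otimes>\<^bsub>B\<^esub> b')) x = \<phi> (inv\<^bsub>B\<^esub> b') (\<phi> (inv\<^bsub>B\<^esub> b) x)" if "x \<in> X" for x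
      using b that composition_rule[of x "inv\<^bsub>B\<^esub> b'" "inv\<^bsub>B\<^esub> b"] by (simp add: B.inv_mult_group)
    then show ?thesis using p f cl b \<phi>X by (auto simp: restrict_def)
  qed
  have id: "?p \<one>\<^bsub>B\<^esub> f = f" if "f \<in> ?S" for f
    using that p[OF that] one S by (auto simp: PiE_iff extensional_def)
  have bij: "bij_betw (?p b) ?S ?S" if b: "b \<in> carrier B" for b
  proof (rule bij_betw_byWitness[where f' = "?p (inv\<^bsub>B\<^esub> b)"])
    show "\<forall>f \<in> ?S. ?p (inv\<^bsub>B\<^esub> b) (?p b f) = f"
      using b id comp[of "inv\<^bsub>B\<^esub> b" b] by (metis B.inv_closed B.l_inv)
    show "\<forall>f \<in> ?S. ?p b (?p (inv\<^bsub>B\<^esub> b) f) = f"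
      using b id comp[of b "inv\<^bsub>B\<^esub> b"] by (metis B.inv_closed B.r_inv)
  qed (use b cl in auto)
  interpret S: group "sum_group X (\<lambda>_. A)" using assms(1) by simp
  have mul: "?p b (f \<otimes>\<^bsub>sum_group X (\<lambda>_. A)\<^esub> g) = ?p b f \<otimes>\<^bsub>sum_group X (\<lambda>_. A)\<^esub> ?p b g"
    if "b \<in> carrier B" "f \<in> ?S" "g \<in> ?S" for b f g
    using p[OF S.m_closed[OF that(2,3)]] p that \<phi>X by (auto simp: restrict_def)
  have auto: "?p b \<in> auto (sum_group X (\<lambda>_. A))" if "b \<in> carrier B" for b
    using that bij cl mul by (auto simp: auto_def hom_def Bij_def permute_copies_def)
  have "?p (b \<otimes>\<^bsub>B\<^esub> b') = compose ?S (?p b) (?p b')" if "b \<in> carrier B" "b' \<in> carrier B" for b b'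
    using that comp by (intro ext) (auto simp: compose_def permute_copies_def)
  then show ?thesis
    using auto by (auto simp: hom_def AutoGroup_def BijGroup_def auto_def)
qed

lemma group_wreath_product:
  assumes "group A" "group_action B X \<phi>"
  shows "group (wreath_product A X B \<phi>)"
proof -
  have "group B" using assms(2) by (simp add: group_action_def group_hom_def)
  then show ?thesis
    unfolding wreath_product_def
    using assms permute_copies_hom by (intro group_semidirect_product) auto
qed


section \<open>Abelianisation and increasing unions of subgroups\<close>

definition abelianisation :: "('a, 'm) monoid_scheme \<Rightarrow> 'a set monoid" where
  "abelianisation A = A Mod derived A (carrier A)"

definition union_of_properly_increasing_subgroups :: "('a, 'm) monoid_scheme \<Rightarrow> bool" where
  "union_of_properly_increasing_subgroups A \<longleftrightarrow>
     (\<exists>S :: nat \<Rightarrow> 'a set. (\<forall>n. subgroup (S n) A) \<and> (\<forall>n. S n \<subset> S (Suc n)) \<and>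
        carrier A = (\<Union>n. S n))"

end

(*
  All that is used of a tree is that its graph distance is an integer metric with geodesics, even
  perimeters of triangles and the four point condition.

  Sufficiency.  If an element a of a copy of A has no fixed vertex, the copy of A at another point
  of the orbit commutes with a and hence moves along the axis of a by a homomorphism to the
  integers, which vanishes; so that copy consists of elliptic elements, although it contains a
  conjugate of a.  Hence all elements of a copy are elliptic, and measuring the distance from a
  base point to the fixed point sets would exhaust A by a properly increasing sequence unless the
  copy has a fixed vertex.  Project a vertex fixed by B to the fixed point sets of the copies:
  there are finitely many distances, and the farthest projection is fixed by everything.

  Necessity.  Both a nonzero homomorphism to the integers and an exhaustion by proper subgroups
  pass from A to the wreath product and give an action on a tree fixing an end but no vertex.  An
  infinite abelian group has one or the other: extend a rational homomorphism from an infinite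
  cyclic subgroup, or the level function of a strictly increasing sequence of finite subgroups.
*)
theory Submission
  imports Defs
begin

section \<open>Exhaustions by subgroups\<close>

text \<open>Neither ends nor axes are constructed as objects. What a fixed end leaves behind is a
  function on the group: an integer homomorphism (the Busemann cocycle) or a length with an
  ultrametric inequality. Unlike sequences of subgroups, functions pull back along the projection to
  the abelianisation without further care, and they pass to the wreath product by a sum or a maximum
  over the coordinates, which the permutation of the copies by \<open>B\<close> leaves unchanged.
  The obstacle in the abelian case is size: an uncountable group is not a countable union of finite
  or finitely generated subgroups, so nothing can be enumerated, and a function found on a small
  subgroup has to be extended to the whole group. Extension into the rationals works because they
  are divisible, but the values may acquire unbounded denominators; in that case the denominators
  themselves provide the length, and otherwise clearing them provides the integer
  homomorphism.\<close>

definition ultrametric_length :: "('g, 'm) monoid_scheme \<Rightarrow> ('g \<Rightarrow> nat) \<Rightarrow> bool" where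
  "ultrametric_length G \<nu> \<longleftrightarrow>
     (\<forall>x \<in> carrier G. \<forall>y \<in> carrier G. \<nu> (x \<otimes>\<^bsub>G\<^esub> inv\<^bsub>G\<^esub> y) \<le> max (\<nu> x) (\<nu> y))"

definition unbounded_length :: "('g, 'm) monoid_scheme \<Rightarrow> ('g \<Rightarrow> nat) \<Rightarrow> bool" where
  "unbounded_length G \<nu> \<longleftrightarrow> (\<forall>n. \<exists>x \<in> carrier G. n < \<nu> x)"

context group
begin

lemma ultrametric_lengthD:
  "ultrametric_length G \<nu> \<Longrightarrow> x \<in> carrier G \<Longrightarrow> y \<in> carrier G \<Longrightarrow> \<nu> (x \<otimes> inv y) \<le> max (\<nu> x) (\<nu> y)"
  unfolding ultrametric_length_def by blast

lemma ultrametric_length_one: "ultrametric_length G \<nu> \<Longrightarrow> x \<in> carrier G \<Longrightarrow> \<nu> \<one> \<le> \<nu> x"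
  using ultrametric_lengthD[of \<nu> x x] by simp

lemma ultrametric_length_inv: "ultrametric_length G \<nu> \<Longrightarrow> x \<in> carrier G \<Longrightarrow> \<nu> (inv x) \<le> \<nu> x"
  using ultrametric_lengthD[of \<nu> \<one> x] ultrametric_length_one[of \<nu> x] by simp

lemma ultrametric_length_mult:
  assumes "ultrametric_length G \<nu>" "x \<in> carrier G" "y \<in> carrier G"
  shows "\<nu> (x \<otimes> y) \<le> max (\<nu> x) (\<nu> y)"
  using ultrametric_lengthD[of \<nu> x "inv y"] ultrametric_length_inv[of \<nu> y] assms by simp

text \<open>The least value \<open>\<nu> \<one>\<close> is not normalised to 0; a ball of smaller
  radius is empty, whence the bound on \<open>n\<close>.\<close>

lemma subgroup_ultrametric_ball:
  assumes "ultrametric_length G \<nu>" "\<nu> \<one> \<le> n"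
  shows "subgroup {x \<in> carrier G. \<nu> x \<le> n} G"
proof (rule subgroupI)
  show "{x \<in> carrier G. \<nu> x \<le> n} \<noteq> {}" using assms by blast
  show "inv x \<in> {x \<in> carrier G. \<nu> x \<le> n}" if "x \<in> {x \<in> carrier G. \<nu> x \<le> n}" for x
    using that ultrametric_length_inv[OF assms(1), of x] by simp
  show "x \<otimes> y \<in> {x \<in> carrier G. \<nu> x \<le> n}"
    if "x \<in> {x \<in> carrier G. \<nu> x \<le> n}" "y \<in> {x \<in> carrier G. \<nu> x \<le> n}" for x y
    using that order_trans[OF ultrametric_length_mult[OF assms(1), of x y], of n] by simp
qed auto

lemma unbounded_length_imp_union:
  assumes ul: "ultrametric_length G \<nu>" and ub: "unbounded_length G \<nu>"
  shows "union_of_properly_increasing_subgroups G"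
proof -
  obtain p where p: "\<And>n. p n \<in> carrier G" "\<And>n. n < \<nu> (p n)"
    using ub unfolding unbounded_length_def by metis
  \<comment> \<open>Consecutive balls may coincide. Each new radius is therefore the length of a
    point outside the current ball, starting from the smallest radius whose ball is a
    subgroup.\<close>
  define m where "m = rec_nat (\<nu> \<one>) (\<lambda>_ k. \<nu> (p k))"
  have m0: "m 0 = \<nu> \<one>" and mS: "m (Suc k) = \<nu> (p (m k))" for k by (simp_all add: m_def)
  have less: "m k < m (Suc k)" for k using p mS by simp
  then have mono: "strict_mono m" by (simp add: strict_mono_Suc_iff)
  define S where "S k = {x \<in> carrier G. \<nu> x \<le> m k}" for k
  have "subgroup (S k) G" for k
    unfolding S_def using ul m0 strict_mono_less_eq[OF mono, of 0 k]
    by (intro subgroup_ultrametric_ball) auto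
  moreover have "S k \<subset> S (Suc k)" for k
  proof
    show "S k \<subseteq> S (Suc k)" unfolding S_def using less[of k] by auto
    have "p (m k) \<in> S (Suc k)" "p (m k) \<notin> S k" unfolding S_def using p mS[of k] by (auto simp: not_le)
    then show "S k \<noteq> S (Suc k)" by blast
  qed
  moreover have "carrier G = (\<Union>k. S k)"
  proof
    show "carrier G \<subseteq> (\<Union>k. S k)"
      using strict_mono_imp_increasing[OF mono] by (auto simp: S_def)
  qed (auto simp: S_def)
  ultimately show ?thesis unfolding union_of_properly_increasing_subgroups_def by blast
qed

lemma union_imp_unbounded_length:
  assumes "union_of_properly_increasing_subgroups G"
  shows "\<exists>\<nu>. ultrametric_length G \<nu> \<and> unbounded_length G \<nu>"
proof -
  obtain S :: "nat \<Rightarrow> 'a set" where S: "\<And>n. subgroup (S n) G" "\<And>n. S n \<subset> S (Suc n)"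
    "carrier G = (\<Union>n. S n)"
    using assms unfolding union_of_properly_increasing_subgroups_def by blast
  have mono: "S n \<subseteq> S m" if "n \<le> m" for n m
    using lift_Suc_mono_le[of S] S(2) that by blast
  define \<nu> where "\<nu> x = (LEAST n. x \<in> S n)" for x
  have in_S: "x \<in> S (\<nu> x)" if "x \<in> carrier G" for x
    unfolding \<nu>_def using that S(3) by (auto intro: LeastI)
  have "\<nu> (x \<otimes> inv y) \<le> max (\<nu> x) (\<nu> y)" if "x \<in> carrier G" "y \<in> carrier G" for x y
  proof -
    have "x \<in> S (max (\<nu> x) (\<nu> y))" "y \<in> S (max (\<nu> x) (\<nu> y))"
      using in_S that mono by (meson max.cobounded1 max.cobounded2 subsetD)+
    then have "x \<otimes> inv y \<in> S (max (\<nu> x) (\<nu> y))"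
      using S(1) by (meson subgroup.m_closed subgroup.m_inv_closed)
    then show ?thesis unfolding \<nu>_def by (rule Least_le)
  qed
  moreover have "\<exists>x \<in> carrier G. n < \<nu> x" for n
  proof -
    obtain x where x: "x \<in> S (Suc n)" "x \<notin> S n" using S(2) by blast
    then have xG: "x \<in> carrier G" using S(3) by blast
    have "n < \<nu> x" using in_S[OF xG] mono x(2) by (meson not_le subsetD)
    with xG show ?thesis by blast
  qed
  ultimately show ?thesis unfolding ultrametric_length_def unbounded_length_def by blast
qed

text \<open>By the pigeonhole principle two different powers of \<open>x\<close> lie in one coset of
  the derived subgroup, which \<open>\<chi>\<close> kills because the integers commute; a
  torsion-free target then leaves only the value 0.\<close>

lemma hom_integer_group_trivial:
  assumes fin: "finite (carrier (abelianisation G))"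
    and \<chi>: "\<chi> \<in> hom G integer_group" and x: "x \<in> carrier G"
  shows "\<chi> x = 0"
proof -
  interpret \<chi>: group_hom G integer_group \<chi>
    using \<chi> by (simp add: group_hom_def group_hom_axioms_def)
  let ?D = "derived G (carrier G)"
  have "derived_set G (carrier G) \<subseteq> kernel G integer_group \<chi>"
    by (auto simp: kernel_def)
  then have D: "?D \<subseteq> kernel G integer_group \<chi>"
    unfolding derived_def by (intro generate_subgroup_incl \<chi>.subgroup_kernel)
  have "?D #> x [^] n \<in> carrier (abelianisation G)" for n :: nat
    using x by (auto simp: abelianisation_def FactGroup_def RCOSETS_def)
  then have "range (\<lambda>n :: nat. ?D #> x [^] n) \<subseteq> carrier (abelianisation G)" by blast
  then have "finite (range (\<lambda>n :: nat. ?D #> x [^] n))" using fin by (rule finite_subset)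
  then have "\<not> inj (\<lambda>n :: nat. ?D #> x [^] n)" using finite_imageD by blast
  then obtain m n :: nat where mn: "?D #> x [^] m = ?D #> x [^] n" "m \<noteq> n"
    by (auto simp: inj_def)
  have "x [^] m \<in> ?D #> x [^] m"
    using subgroup.one_closed[OF derived_is_subgroup[of "carrier G"]] x
    by (force simp: r_coset_def)
  then obtain y where y: "y \<in> ?D" "x [^] m = y \<otimes> x [^] n"
    using mn(1) by (auto simp: r_coset_def)
  have pow: "\<chi> (x [^] k) = int k * \<chi> x" for k :: nat using \<chi>.hom_nat_pow[OF x] by simp
  have "y \<in> carrier G" "\<chi> y = 0" using D y(1) by (auto simp: kernel_def)
  then have "\<chi> (x [^] m) = \<chi> (x [^] n)" using x y(2) by simp
  then show ?thesis using pow mn(2) by simp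
qed

section \<open>Extension of functions from a subgroup by Zorn's lemma\<close>

text \<open>
  A relation \<open>R\<close> between \<open>f x\<close>, \<open>f y\<close> and \<open>f (x y\<^sup>-\<^sup>1)\<close> covers homomorphisms as well as
  ultrametric lengths.
\<close>

definition compatible :: "('r \<Rightarrow> 'r \<Rightarrow> 'r \<Rightarrow> bool) \<Rightarrow> 'a set \<Rightarrow> ('a \<Rightarrow> 'r) \<Rightarrow> bool" where
  "compatible R H f \<longleftrightarrow> subgroup H G \<and> (\<forall>x \<in> H. \<forall>y \<in> H. R (f x) (f y) (f (x \<otimes> inv y)))"

text \<open>Zorn's lemma is applied to graphs, because \<open>f\<close> has arbitrary values off
  \<open>H\<close>: extension becomes inclusion, and the union of a chain of graphs is again a
  graph.\<close>

lemma compatible_extends: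
  fixes f0 :: "'a \<Rightarrow> 'r"
  assumes f0: "compatible R H0 f0"
    and step: "\<And>H f c. compatible R H f \<Longrightarrow> c \<in> carrier G \<Longrightarrow> c \<notin> H \<Longrightarrow>
                 \<exists>H' f'. compatible R H' f' \<and> H \<subset> H' \<and> (\<forall>x \<in> H. f' x = f x)"
  shows "\<exists>f. compatible R (carrier G) f \<and> (\<forall>x \<in> H0. f x = f0 x)"
proof -
  define graph where "graph H f = (\<lambda>x. (x, f x)) ` H" for H and f :: "'a \<Rightarrow> 'r"
  \<comment> \<open>Compatibility in terms of pairs. Single-valuedness and closure speak of two
    elements at a time, and two elements of the union of a chain already lie in a common
    member.\<close>
  define good where "good g \<longleftrightarrow> graph H0 f0 \<subseteq> g \<and> fst ` g \<subseteq> carrier G \<and>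
    (\<forall>x u y v. (x, u) \<in> g \<longrightarrow> (y, v) \<in> g \<longrightarrow>
       (x = y \<longrightarrow> u = v) \<and> (\<exists>w. (x \<otimes> inv y, w) \<in> g \<and> R u v w))" for g
  have good_graph: "good (graph H f)" if "compatible R H f" "graph H0 f0 \<subseteq> graph H f" for H f
  proof -
    have H: "subgroup H G" using that by (simp add: compatible_def)
    have "x \<otimes> inv y \<in> H" if "x \<in> H" "y \<in> H" for x y
      using H that by (simp add: subgroup.m_closed subgroup.m_inv_closed)
    then show ?thesis using that subgroup.subset[OF H]
      by (auto simp: good_def graph_def compatible_def image_iff)
  qed
  have graph_good: "\<exists>H f. compatible R H f \<and> g = graph H f" if g: "good g" for g
  proof -
    define H where "H = fst ` g"
    define f where "f x = (THE u. (x, u) \<in> g)" for x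
    have uniq: "u = v" if "(x, u) \<in> g" "(x, v) \<in> g" for x u v using g that by (auto simp: good_def)
    have f: "f x = u" if "(x, u) \<in> g" for x u
      unfolding f_def using that uniq by (intro the_equality) auto
    have diff: "\<exists>w. (x \<otimes> inv y, w) \<in> g \<and> R u v w" if "(x, u) \<in> g" "(y, v) \<in> g" for x y u v
      using g that unfolding good_def by fast
    have sub: "x \<otimes> inv y \<in> H \<and> R (f x) (f y) (f (x \<otimes> inv y))"
      if xy: "x \<in> H" "y \<in> H" for x y
    proof -
      obtain u v where uv: "(x, u) \<in> g" "(y, v) \<in> g" using xy by (auto simp: H_def)
      then obtain w where w: "(x \<otimes> inv y, w) \<in> g" "R u v w" using diff by blast
      then have "x \<otimes> inv y \<in> H" unfolding H_def by force
      then show ?thesis using f uv w by simp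
    qed
    have "H0 \<subseteq> H" using g by (force simp: good_def graph_def H_def)
    then have one: "\<one> \<in> H" using f0 subgroup.one_closed by (auto simp: compatible_def)
    have HG: "H \<subseteq> carrier G" using g by (simp add: good_def H_def)
    have inv: "inv x \<in> H" if "x \<in> H" for x using sub[OF one that] that HG by auto
    have "subgroup H G"
    proof (rule subgroupI)
      show "x \<otimes> y \<in> H" if "x \<in> H" "y \<in> H" for x y
        using sub[OF that(1) inv[OF that(2)]] that HG by auto
    qed (use HG one inv in auto)
    then have "compatible R H f" using sub by (simp add: compatible_def)
    moreover have "g = graph H f" using f by (force simp: graph_def H_def)
    ultimately show ?thesis by blast
  qed
  have "\<exists>M \<in> {g. good g}. \<forall>X \<in> {g. good g}. M \<subseteq> X \<longrightarrow> X = M"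
  proof (rule subset_Zorn_nonempty)
    show "{g. good g} \<noteq> {}" using good_graph[OF f0] by blast
    fix C assume C: "C \<noteq> {}" "subset.chain {g. good g} C"
    have g: "good g" if "g \<in> C" for g using C that by (auto simp: subset.chain_def)
    have two: "\<exists>g \<in> C. a \<in> g \<and> b \<in> g" if ab: "a \<in> \<Union> C" "b \<in> \<Union> C" for a b
    proof -
      obtain g h where gh: "g \<in> C" "a \<in> g" "h \<in> C" "b \<in> h" using ab by blast
      then have "g \<subseteq> h \<or> h \<subseteq> g" using C unfolding subset_chain_def by blast
      then show ?thesis using gh by blast
    qed
    have "(x = y \<longrightarrow> u = v) \<and> (\<exists>w. (x \<otimes> inv y, w) \<in> \<Union> C \<and> R u v w)"
      if xy: "(x, u) \<in> \<Union> C" "(y, v) \<in> \<Union> C" for x u y v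
    proof -
      obtain h where h: "h \<in> C" "(x, u) \<in> h" "(y, v) \<in> h" using two[OF xy] by blast
      then have "(x = y \<longrightarrow> u = v) \<and> (\<exists>w. (x \<otimes> inv y, w) \<in> h \<and> R u v w)"
        using g[OF h(1)] unfolding good_def by blast
      then show ?thesis using h(1) by blast
    qed
    moreover obtain h where "h \<in> C" "graph H0 f0 \<subseteq> h" using C(1) g unfolding good_def by blast
    moreover have "fst ` h \<subseteq> carrier G" if "h \<in> C" for h using g[OF that] unfolding good_def by blast
    ultimately have "good (\<Union> C)" unfolding good_def by blast
    then show "\<Union> C \<in> {g. good g}" by simp
  qed
  then obtain M where M: "good M" and max: "\<And>X. good X \<Longrightarrow> M \<subseteq> X \<Longrightarrow> X = M" by blast
  obtain H f where Hf: "compatible R H f" "M = graph H f" using graph_good[OF M] by blast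
  have M0: "graph H0 f0 \<subseteq> M" using M by (simp add: good_def)
  have "H = carrier G"
  proof (rule ccontr)
    assume "H \<noteq> carrier G"
    moreover have "H \<subseteq> carrier G" using Hf subgroup.subset by (auto simp: compatible_def)
    ultimately obtain c where c: "c \<in> carrier G" "c \<notin> H" by blast
    obtain H' f' where H': "compatible R H' f'" "H \<subset> H'" "\<forall>x \<in> H. f' x = f x"
      using step[OF Hf(1) c] by (elim exE conjE)
    have le: "M \<subseteq> graph H' f'"
    proof
      fix a assume "a \<in> M"
      then obtain x where x: "x \<in> H" "a = (x, f x)" unfolding Hf(2) graph_def by blast
      then show "a \<in> graph H' f'" using H'(2,3) unfolding graph_def by (intro image_eqI[of _ _ x]) auto
    qed
    have "good (graph H' f')" using good_graph[OF H'(1) subset_trans[OF M0 le]] .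
    from max[OF this le] have "fst ` graph H' f' = fst ` graph H f" using Hf by simp
    then show False using H'(2) by (simp add: graph_def image_image)
  qed
  moreover have "\<forall>x \<in> H0. f x = f0 x"
  proof
    fix x assume "x \<in> H0"
    then have "(x, f0 x) \<in> graph H0 f0" by (simp add: graph_def)
    then have "(x, f0 x) \<in> graph H f" using M0 Hf(2) by blast
    then show "f x = f0 x" by (auto simp: graph_def)
  qed
  ultimately show ?thesis using Hf by blast
qed

end

section \<open>Commutative groups: extension by one element, and the dichotomy for infinite
  groups\<close>

context comm_group
begin

text \<open>For a subgroup \<open>H\<close>, commutativity makes this product the subgroup generated
  by \<open>H\<close> and \<open>c\<close>.\<close>

definition adjoin :: "'a set \<Rightarrow> 'a \<Rightarrow> 'a set" where
  "adjoin H c = H <#> range (\<lambda>j :: int. c [^] j)"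

lemma mem_adjoin: "z \<in> adjoin H c \<longleftrightarrow> (\<exists>h \<in> H. \<exists>j :: int. z = h \<otimes> c [^] j)"
  unfolding adjoin_def set_mult_def by blast

lemma subgroup_int_powers: "c \<in> carrier G \<Longrightarrow> subgroup (range (\<lambda>j :: int. c [^] j)) G"
proof (rule subgroupI)
  assume c: "c \<in> carrier G"
  show "inv a \<in> range (\<lambda>j :: int. c [^] j)" if "a \<in> range (\<lambda>j :: int. c [^] j)" for a
    using that int_pow_neg[OF c, symmetric] by blast
  show "a \<otimes> b \<in> range (\<lambda>j :: int. c [^] j)"
    if "a \<in> range (\<lambda>j :: int. c [^] j)" "b \<in> range (\<lambda>j :: int. c [^] j)" for a b
    using that int_pow_mult[OF c, symmetric] by blast
qed auto

lemma subgroup_adjoin: "subgroup H G \<Longrightarrow> c \<in> carrier G \<Longrightarrow> subgroup (adjoin H c) G"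
  unfolding adjoin_def by (intro mult_subgroups subgroup_int_powers)

lemma adjoin_superset:
  assumes H: "subgroup H G" and c: "c \<in> carrier G"
  shows "H \<subseteq> adjoin H c" "c \<in> adjoin H c"
proof -
  have "h \<in> adjoin H c" if "h \<in> H" for h
    unfolding mem_adjoin using that subgroup.mem_carrier[OF H that]
    by (intro bexI[of _ h] exI[of _ 0]) auto
  then show "H \<subseteq> adjoin H c" by blast
  show "c \<in> adjoin H c"
    unfolding mem_adjoin using c subgroup.one_closed[OF H]
    by (intro bexI[of _ \<one>] exI[of _ 1]) auto
qed

lemma finite_adjoin:
  assumes H: "subgroup H G" "finite H" and c: "c \<in> carrier G" and n: "0 < n" "c [^] (n :: nat) = \<one>"
  shows "finite (adjoin H c)"
proof -
  have red: "c [^] j = c [^] (j mod int n)" for j :: int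
  proof -
    have "c [^] j = c [^] (int n * (j div int n) + j mod int n)" by simp
    also have "\<dots> = (c [^] int n) [^] (j div int n) \<otimes> c [^] (j mod int n)"
      using c by (simp only: int_pow_mult int_pow_pow)
    also have "\<dots> = c [^] (j mod int n)" using c n(2) by (simp add: int_pow_int)
    finally show ?thesis .
  qed
  have "adjoin H c \<subseteq> (\<lambda>(h, j :: int). h \<otimes> c [^] j) ` (H \<times> {0..<int n})"
  proof
    fix z assume "z \<in> adjoin H c"
    then obtain h and j :: int where "h \<in> H" "z = h \<otimes> c [^] (j mod int n)"
      unfolding mem_adjoin using red by metis
    then show "z \<in> (\<lambda>(h, j :: int). h \<otimes> c [^] j) ` (H \<times> {0..<int n})"
      using n(1) by (intro image_eqI[of _ _ "(h, j mod int n)"]) auto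
  qed
  then show ?thesis using H(2) by (elim finite_subset) simp
qed

text \<open>If no positive power of \<open>c\<close> lies in \<open>H\<close>, the modulus is \<open>0\<close>.\<close>

lemma powers_in_subgroup:
  assumes H: "subgroup H G" and c: "c \<in> carrier G"
  shows "\<exists>m :: int. \<forall>j :: int. c [^] j \<in> H \<longleftrightarrow> m dvd j"
proof (cases "\<exists>n :: nat. 0 < n \<and> c [^] int n \<in> H")
  case True
  \<comment> \<open>The exponents \<open>j\<close> with \<open>c [^] j\<close> in \<open>H\<close>
    form a subgroup of the integers, generated by its least positive element through division with
    remainder.\<close>
  define n where "n = (LEAST n :: nat. 0 < n \<and> c [^] int n \<in> H)"
  have n: "0 < n" "c [^] int n \<in> H" unfolding n_def using LeastI_ex[OF True] by auto
  have least: "n \<le> k" if "0 < k" "c [^] int k \<in> H" for k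
    unfolding n_def using that by (intro Least_le) auto
  have mult: "c [^] (int n * i) \<in> H" for i :: int
    using subgroup_int_pow_closed[OF H n(2), of i] int_pow_pow[OF c] by simp
  have "c [^] j \<in> H \<longleftrightarrow> int n dvd j" for j :: int
  proof
    assume j: "c [^] j \<in> H"
    have "c [^] (j mod int n) = c [^] (j - int n * (j div int n))" by (simp add: minus_mult_div_eq_mod)
    also have "\<dots> = c [^] j \<otimes> inv (c [^] (int n * (j div int n)))" using int_pow_diff c by blast
    also have "\<dots> \<in> H" using H j mult by (simp add: subgroup.m_closed subgroup.m_inv_closed)
    finally have "c [^] int (nat (j mod int n)) \<in> H" using n(1) by simp
    moreover have "nat (j mod int n) < n" using n(1) by (simp add: nat_less_iff)
    ultimately have "nat (j mod int n) = 0" using least not_le by blast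
    then have "j mod int n = 0"
      using n(1) pos_mod_sign[of "int n" j] by linarith
    then show "int n dvd j" by (simp add: dvd_eq_mod_eq_0)
  qed (auto simp: mult)
  then show ?thesis by blast
next
  case False
  have "c [^] j \<in> H \<longleftrightarrow> 0 dvd j" for j :: int
  proof
    assume j: "c [^] j \<in> H"
    then have "c [^] (- j) \<in> H" using int_pow_neg[OF c] subgroup.m_inv_closed[OF H] by simp
    then have "c [^] int (nat \<bar>j\<bar>) \<in> H" using j by (cases "0 \<le> j") auto
    then show "0 dvd j" using False by (metis zero_less_nat_eq zero_less_abs_iff dvd_0_left_iff)
  qed (use subgroup.one_closed[OF H] in simp)
  then show ?thesis by blast
qed

lemma adjoin_quotient:
  assumes "subgroup H G" "c \<in> carrier G" "h \<in> H" "h' \<in> H"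
  shows "(h \<otimes> c [^] (i :: int)) \<otimes> inv (h' \<otimes> c [^] (j :: int)) = (h \<otimes> inv h') \<otimes> c [^] (i - j)"
    and "h \<otimes> inv h' \<in> H"
proof -
  have V: "h \<in> carrier G" "h' \<in> carrier G" using assms subgroup.mem_carrier by metis+
  then show "(h \<otimes> c [^] i) \<otimes> inv (h' \<otimes> c [^] j) = (h \<otimes> inv h') \<otimes> c [^] (i - j)"
    using assms(2) by (simp add: int_pow_diff inv_mult m_ac)
  show "h \<otimes> inv h' \<in> H" using assms by (simp add: subgroup.m_closed subgroup.m_inv_closed)
qed

text \<open>This rests on the divisibility of the rationals: if \<open>m\<close> generates the
  exponents of the powers of \<open>c\<close> in \<open>H\<close>, the value at \<open>c\<close> has
  to be an \<open>m\<close>-th part of \<open>f (c [^] m)\<close>.\<close>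

lemma extend_rat_hom:
  fixes f :: "'a \<Rightarrow> rat"
  assumes f: "compatible (\<lambda>u v w. w = u - v) H f" and c: "c \<in> carrier G"
  shows "\<exists>f'. compatible (\<lambda>u v w. w = u - v) (adjoin H c) f' \<and> (\<forall>x \<in> H. f' x = f x)"
proof -
  have H: "subgroup H G" and diff: "\<And>x y. x \<in> H \<Longrightarrow> y \<in> H \<Longrightarrow> f (x \<otimes> inv y) = f x - f y"
    using f by (auto simp: compatible_def)
  note HG = subgroup.mem_carrier[OF H]
  obtain m where m: "\<And>j :: int. c [^] j \<in> H \<longleftrightarrow> m dvd j" using powers_in_subgroup[OF H c] by blast
  have one: "\<one> \<in> H" "f \<one> = 0" using diff[of \<one> \<one>] subgroup.one_closed[OF H] by auto
  have inv: "inv x \<in> H" "f (inv x) = - f x" if "x \<in> H" for x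
    using diff[OF one(1) that] one(2) that HG subgroup.m_inv_closed[OF H] by auto
  have add: "x \<otimes> y \<in> H" "f (x \<otimes> y) = f x + f y" if "x \<in> H" "y \<in> H" for x y
    using diff[OF that(1) inv(1)[OF that(2)]] inv(2) that HG subgroup.m_closed[OF H] by auto
  have pow: "f (x [^] n) = of_nat n * f x \<and> x [^] n \<in> H" if "x \<in> H" for x and n :: nat
    by (induction n) (use that add one in \<open>auto simp: algebra_simps\<close>)
  have ipow: "f (x [^] i) = of_int i * f x" if x: "x \<in> H" for x and i :: int
  proof (cases i rule: int_cases2)
    case (nonneg n)
    then show ?thesis using pow[OF x] by (simp add: int_pow_int)
  next
    case (nonpos n)
    then show ?thesis using pow[OF x, of n] inv(2)[of "x [^] n"] int_pow_neg_int[OF HG[OF x]] by simp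
  qed
  \<comment> \<open>If \<open>m = 0\<close>, division by zero gives \<open>q = 0\<close>. This is
    legitimate: only the zeroth power of \<open>c\<close> then lies in \<open>H\<close>, and the
    value at \<open>c\<close> is free.\<close>
  define q where "q = f (c [^] m) / of_int m"
  have fc: "f (c [^] j) = of_int j * q" if j: "c [^] j \<in> H" for j :: int
  proof -
    obtain i where i: "j = m * i" using j m by blast
    have "f (c [^] j) = of_int i * f (c [^] m)"
      using ipow[of "c [^] m" i] m int_pow_pow[OF c] i by simp
    then show ?thesis using i one(2) by (cases "m = 0") (auto simp: q_def)
  qed
  \<comment> \<open>Two representations \<open>h \<otimes> c [^] j\<close> of one element differ by
    a power of \<open>c\<close> that lies in \<open>H\<close>, where \<open>fc\<close> shows that
    the two values agree.\<close>
  define f' where "f' z = (SOME r. \<exists>h \<in> H. \<exists>j :: int. z = h \<otimes> c [^] j \<and> r = f h + of_int j * q)" for z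
  have f': "f' (h \<otimes> c [^] j) = f h + of_int j * q" if h: "h \<in> H" for h and j :: int
    unfolding f'_def
  proof (rule some_equality)
    fix r assume "\<exists>h' \<in> H. \<exists>j' :: int. h \<otimes> c [^] j = h' \<otimes> c [^] j' \<and> r = f h' + of_int j' * q"
    then obtain h' and j' :: int where h': "h' \<in> H" "h \<otimes> c [^] j = h' \<otimes> c [^] j'" "r = f h' + of_int j' * q"
      by blast
    have "(h \<otimes> inv h') \<otimes> c [^] (j - j') = \<one>"
      using adjoin_quotient(1)[OF H c h h'(1), of j j'] h' c HG by simp
    then have "c [^] (j - j') = inv (h \<otimes> inv h')"
      using c h h' HG inv_equality[of "c [^] (j - j')" "h \<otimes> inv h'"]
      by (simp add: m_comm[of "c [^] (j - j')"])
    also have "\<dots> = h' \<otimes> inv h" using h h' HG by (simp add: inv_mult m_comm)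
    finally have "c [^] (j - j') = h' \<otimes> inv h" .
    moreover have "h' \<otimes> inv h \<in> H" using add(1) inv(1) h h'(1) by blast
    ultimately have "of_int (j - j') * q = f h' - f h" using fc diff[OF h'(1) h] by metis
    then show "r = f h + of_int j * q" using h'(3) by (simp add: algebra_simps)
  qed (use h in blast)
  have "f' (x \<otimes> inv y) = f' x - f' y" if "x \<in> adjoin H c" "y \<in> adjoin H c" for x y
  proof -
    obtain h h' and i j :: int where xy: "h \<in> H" "x = h \<otimes> c [^] i" "h' \<in> H" "y = h' \<otimes> c [^] j"
      using \<open>x \<in> _\<close> \<open>y \<in> _\<close> unfolding mem_adjoin by blast
    then show ?thesis
      using adjoin_quotient(1)[OF H c xy(1,3), of i j] adjoin_quotient(2)[OF H c xy(1,3)] f' diff by (simp add: algebra_simps)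
  qed
  moreover have "f' x = f x" if "x \<in> H" for x using f'[OF that, of 0] HG[OF that] by simp
  ultimately show ?thesis using subgroup_adjoin[OF H c] unfolding compatible_def by blast
qed

lemma extend_ultrametric_length:
  fixes \<nu> :: "'a \<Rightarrow> nat"
  assumes \<nu>: "compatible (\<lambda>u v w. w \<le> max u v) H \<nu>" and c: "c \<in> carrier G"
  shows "\<exists>\<nu>'. compatible (\<lambda>u v w. w \<le> max u v) (adjoin H c) \<nu>' \<and> (\<forall>x \<in> H. \<nu>' x = \<nu> x)"
proof -
  have H: "subgroup H G" and diff: "\<And>x y. x \<in> H \<Longrightarrow> y \<in> H \<Longrightarrow> \<nu> (x \<otimes> inv y) \<le> max (\<nu> x) (\<nu> y)"
    using \<nu> by (auto simp: compatible_def)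
  note HG = subgroup.mem_carrier[OF H]
  obtain m where m: "\<And>j :: int. c [^] j \<in> H \<longleftrightarrow> m dvd j" using powers_in_subgroup[OF H c] by blast
  have one: "\<one> \<in> H" "\<nu> \<one> \<le> \<nu> x" if "x \<in> H" for x
    using diff[OF that that] HG[OF that] subgroup.one_closed[OF H] by auto
  have inv: "inv x \<in> H" "\<nu> (inv x) \<le> \<nu> x" if "x \<in> H" for x
    using diff[OF one(1) that] one that HG[OF that] subgroup.m_inv_closed[OF H] by auto
  have add: "x \<otimes> y \<in> H" "\<nu> (x \<otimes> y) \<le> max (\<nu> x) (\<nu> y)" if "x \<in> H" "y \<in> H" for x y
  proof -
    show "x \<otimes> y \<in> H" using that subgroup.m_closed[OF H] by blast
    have "\<nu> (x \<otimes> inv (inv y)) \<le> max (\<nu> x) (\<nu> (inv y))" using diff that inv(1) by blast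
    then show "\<nu> (x \<otimes> y) \<le> max (\<nu> x) (\<nu> y)" using inv(2)[OF that(2)] HG[OF that(2)] by simp
  qed
  have pow: "\<nu> (x [^] n) \<le> \<nu> x \<and> x [^] n \<in> H" if "x \<in> H" for x and n :: nat
  proof (induction n)
    case (Suc n)
    then show ?case using add[of "x [^] n" x] that by auto
  qed (use that one in auto)
  have ipow: "\<nu> (x [^] i) \<le> \<nu> x" if x: "x \<in> H" for x and i :: int
  proof (cases i rule: int_cases2)
    case (nonneg n)
    then show ?thesis using pow[OF x] by (simp add: int_pow_int)
  next
    case (nonpos n)
    then show ?thesis
      using pow[OF x, of n] inv(2)[of "x [^] n"] int_pow_neg_int[OF HG[OF x]] by simp
  qed
  \<comment> \<open>All powers of \<open>c\<close> in \<open>H\<close> are powers of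
    \<open>c [^] m\<close>, so none of them is longer than \<open>k\<close>. If
    \<open>m = 0\<close>, then \<open>k\<close> is \<open>\<nu> \<one>\<close>.\<close>
  define k where "k = \<nu> (c [^] m)"
  have \<nu>c: "\<nu> (c [^] j) \<le> k" if j: "c [^] j \<in> H" for j :: int
  proof -
    obtain i where "j = m * i" using j m by blast
    then show ?thesis using ipow[of "c [^] m" i] m int_pow_pow[OF c] by (simp add: k_def)
  qed
  \<comment> \<open>\<open>Q z n\<close>: \<open>z\<close> lies in the product of the ball of radius
    \<open>n\<close> in \<open>H\<close> with the powers of \<open>c\<close>, where nontrivial
    exponents are available only from level \<open>k\<close> on.\<close>
  define Q where "Q z n \<longleftrightarrow> (\<exists>h \<in> H. \<exists>j :: int. z = h \<otimes> c [^] j \<and> \<nu> h \<le> n \<and> (j = 0 \<or> k \<le> n))" for z n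
  define \<nu>' where "\<nu>' z = (LEAST n. Q z n)" for z
  have Q: "Q z (\<nu>' z)" if z: "z \<in> adjoin H c" for z
  proof -
    obtain h and j :: int where "h \<in> H" "z = h \<otimes> c [^] j" using z unfolding mem_adjoin by blast
    then have "Q z (max (\<nu> h) k)" unfolding Q_def by auto
    then show ?thesis unfolding \<nu>'_def by (rule LeastI)
  qed
  have "\<nu>' (x \<otimes> inv y) \<le> max (\<nu>' x) (\<nu>' y)" if xy: "x \<in> adjoin H c" "y \<in> adjoin H c" for x y
  proof -
    obtain h and i :: int where x: "h \<in> H" "x = h \<otimes> c [^] i" "\<nu> h \<le> \<nu>' x" "i = 0 \<or> k \<le> \<nu>' x"
      using Q[OF xy(1)] unfolding Q_def by blast
    obtain h' and j :: int where y: "h' \<in> H" "y = h' \<otimes> c [^] j" "\<nu> h' \<le> \<nu>' y" "j = 0 \<or> k \<le> \<nu>' y"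
      using Q[OF xy(2)] unfolding Q_def by blast
    have "\<nu> (h \<otimes> inv h') \<le> max (\<nu>' x) (\<nu>' y)" using diff[OF x(1) y(1)] x(3) y(3) by auto
    moreover have "i - j = 0 \<or> k \<le> max (\<nu>' x) (\<nu>' y)" using x(4) y(4) by auto
    ultimately have "Q (x \<otimes> inv y) (max (\<nu>' x) (\<nu>' y))"
      unfolding Q_def using adjoin_quotient(1)[OF H c x(1) y(1), of i j] adjoin_quotient(2)[OF H c x(1) y(1)]
        x(2) y(2) by blast
    then show ?thesis unfolding \<nu>'_def[of "x \<otimes> inv y"] by (rule Least_le)
  qed
  moreover have "\<nu>' x = \<nu> x" if x: "x \<in> H" for x
    unfolding \<nu>'_def
  proof (rule Least_equality)
    show "Q x (\<nu> x)"
      unfolding Q_def using x HG[OF x] by (intro bexI[of _ x] exI[of _ 0]) auto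
    fix n assume "Q x n"
    then obtain h and j :: int where h: "h \<in> H" "x = h \<otimes> c [^] j" "\<nu> h \<le> n" "j = 0 \<or> k \<le> n"
      unfolding Q_def by blast
    show "\<nu> x \<le> n"
    proof (cases "j = 0")
      case True
      then show ?thesis using h HG[OF h(1)] by simp
    next
      case False
      have "c [^] j = inv h \<otimes> x" using h HG[OF h(1)] c by (simp add: inv_solve_left)
      then have cj: "c [^] j \<in> H" using add(1)[OF inv(1)[OF h(1)] x] by simp
      then show ?thesis using add(2)[OF h(1) cj] \<nu>c[OF cj] h False by auto
    qed
  qed
  ultimately show ?thesis using subgroup_adjoin[OF H c] unfolding compatible_def by blast
qed

lemma extension_step:
  assumes "\<exists>f'. compatible R (adjoin H c) f' \<and> (\<forall>x \<in> H. f' x = f x)"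
    and "compatible R H f" "c \<in> carrier G" "c \<notin> H"
  shows "\<exists>H' f'. compatible R H' f' \<and> H \<subset> H' \<and> (\<forall>x \<in> H. f' x = f x)"
proof -
  have "H \<subset> adjoin H c" using adjoin_superset[of H c] assms(2-4) by (auto simp: compatible_def)
  then show ?thesis using assms(1) by blast
qed

text \<open>Counting exponents on the powers of \<open>c\<close> extends to a homomorphism from
  \<open>G\<close> to the rationals. If one factorial clears all denominators, it becomes an integer
  homomorphism; otherwise the denominators give the unbounded length.\<close>

lemma non_torsion_dichotomy:
  assumes c: "c \<in> carrier G" and inf: "\<And>i :: int. c [^] i = \<one> \<Longrightarrow> i = 0"
  shows "(\<exists>\<chi> \<in> hom G integer_group. \<exists>x \<in> carrier G. \<chi> x \<noteq> 0) \<or>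
         (\<exists>\<nu>. ultrametric_length G \<nu> \<and> unbounded_length G \<nu>)"
proof -
  have "inj (\<lambda>i :: int. c [^] i)"
  proof (rule injI)
    fix i j :: int assume "c [^] i = c [^] j"
    then have "c [^] (i - j) = \<one>" using c by (simp add: int_pow_diff)
    then show "i = j" using inf by fastforce
  qed
  define f0 :: "'a \<Rightarrow> rat" where "f0 x = of_int (the_inv (\<lambda>i :: int. c [^] i) x)" for x
  have f0: "f0 (c [^] i) = of_int i" for i :: int
    unfolding f0_def using the_inv_f_f[OF \<open>inj _\<close>] by simp
  have compat: "compatible (\<lambda>u v w. w = u - v) (range (\<lambda>i :: int. c [^] i)) f0"
    unfolding compatible_def using subgroup_int_powers[OF c] f0
    by (auto simp: int_pow_diff[OF c, symmetric])
  have "\<exists>f. compatible (\<lambda>u v w. w = u - v) (carrier G) f \<and>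
          (\<forall>x \<in> range (\<lambda>i :: int. c [^] i). f x = f0 x)"
    by (rule compatible_extends[OF compat], rule extension_step[OF extend_rat_hom])
  then obtain f where f: "compatible (\<lambda>u v w. w = u - v) (carrier G) f"
    and ext: "\<forall>x \<in> range (\<lambda>i :: int. c [^] i). f x = f0 x" by blast
  have diff: "f (x \<otimes> inv y) = f x - f y" if "x \<in> carrier G" "y \<in> carrier G" for x y
    using f that by (simp add: compatible_def)
  have "f (c [^] (1 :: int)) = f0 (c [^] (1 :: int))" using ext by blast
  then have fc: "f c = 1" using f0[of 1] c by simp
  have one: "f \<one> = 0" using diff[of \<one> \<one>] by simp
  have add: "f (x \<otimes> y) = f x + f y" if "x \<in> carrier G" "y \<in> carrier G" for x y
    using diff[of x "inv y"] diff[of \<one> y] one that by simp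
  \<comment> \<open>Factorials are used because the fractions with denominator dividing
    \<open>fact n\<close> form subgroups that increase with \<open>n\<close> and exhaust the
    rationals.\<close>
  define \<nu> where "\<nu> x = (LEAST n. fact n * f x \<in> \<int>)" for x
  have mono: "fact n * r \<in> \<int>" if "fact m * r \<in> \<int>" "m \<le> n" for m n and r :: rat
  proof -
    have "(fact m :: nat) dvd fact n" using fact_dvd that(2) by blast
    then obtain l :: nat where "fact n = fact m * l" by (elim dvdE)
    then have "(fact n :: rat) = fact m * of_nat l" by (metis of_nat_fact of_nat_mult)
    then have "fact n * r = of_nat l * (fact m * r)" by (simp only: mult.assoc mult.left_commute)
    then show ?thesis using Ints_mult[OF Ints_of_nat that(1)] by metis
  qed
  have "\<exists>n. fact n * r \<in> \<int>" for r :: rat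
  proof -
    obtain a b where ab: "quotient_of r = (a, b)" by (cases "quotient_of r")
    then have b: "0 < b" "r = of_int a / of_int b" using quotient_of_denom_pos quotient_of_div by auto
    have "nat b dvd fact (nat b)" using b by (simp add: dvd_fact)
    then obtain l where "fact (nat b) = nat b * l" by (elim dvdE)
    then have "(fact (nat b) :: rat) = of_nat (nat b) * of_nat l" by (metis of_nat_fact of_nat_mult)
    then have "fact (nat b) * r = of_int (int l * a)" using b by simp
    then show ?thesis by (metis Ints_of_int)
  qed
  then have \<nu>: "fact (\<nu> x) * f x \<in> \<int>" for x unfolding \<nu>_def by (rule LeastI_ex)
  have "\<nu> (x \<otimes> inv y) \<le> max (\<nu> x) (\<nu> y)" if "x \<in> carrier G" "y \<in> carrier G" for x y
  proof -
    let ?n = "max (\<nu> x) (\<nu> y)"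
    have "fact ?n * f x \<in> \<int>" "fact ?n * f y \<in> \<int>" using mono[OF \<nu>] by auto
    then have "fact ?n * f (x \<otimes> inv y) \<in> \<int>" using diff that by (simp add: right_diff_distrib)
    then show ?thesis unfolding \<nu>_def[of "x \<otimes> inv y"] by (rule Least_le)
  qed
  then have ul: "ultrametric_length G \<nu>" unfolding ultrametric_length_def by blast
  show ?thesis
  proof (cases "unbounded_length G \<nu>")
    case False
    then obtain n where n: "\<And>x. x \<in> carrier G \<Longrightarrow> \<nu> x \<le> n"
      unfolding unbounded_length_def by (meson not_le_imp_less)
    have int: "fact n * f x \<in> \<int>" if "x \<in> carrier G" for x using mono[OF \<nu> n[OF that]] .
    define \<chi> where "\<chi> x = \<lfloor>fact n * f x\<rfloor>" for x
    have "\<chi> (x \<otimes> y) = \<chi> x + \<chi> y" if xy: "x \<in> carrier G" "y \<in> carrier G" for x y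
    proof -
      obtain i j where "fact n * f x = of_int i" "fact n * f y = of_int j"
        using int[OF xy(1)] int[OF xy(2)] by (elim Ints_cases)
      then show ?thesis using add xy by (simp add: \<chi>_def distrib_left flip: of_int_add)
    qed
    then have "\<chi> \<in> hom G integer_group" by (auto simp: hom_def)
    moreover have "\<chi> c \<noteq> 0"
    proof -
      have "(fact n :: rat) = of_int (fact n)" by simp
      then have "\<chi> c = fact n" unfolding \<chi>_def fc by (metis floor_of_int mult.right_neutral)
      then show ?thesis by simp
    qed
    ultimately show ?thesis using c by blast
  qed (use ul in blast)
qed

text \<open>In a commutative torsion group a finite subgroup stays finite when an element is
  adjoined, so in an infinite group the chain never stops. Its union \<open>D\<close> is countable
  and may be proper, which is why the level function still has to be extended.\<close>

lemma torsion_unbounded_length: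
  assumes inf: "infinite (carrier G)"
    and tors: "\<And>c. c \<in> carrier G \<Longrightarrow> \<exists>n :: nat. 0 < n \<and> c [^] n = \<one>"
  shows "\<exists>\<nu>. ultrametric_length G \<nu> \<and> unbounded_length G \<nu>"
proof -
  have "\<exists>F :: nat \<Rightarrow> 'a set. \<forall>n. (subgroup (F n) G \<and> finite (F n)) \<and> F n \<subset> F (Suc n)"
  proof (rule dependent_nat_choice)
    show "\<exists>H. subgroup H G \<and> finite H" using triv_subgroup by blast
    fix H and n :: nat assume H: "subgroup H G \<and> finite H"
    then obtain c where c: "c \<in> carrier G" "c \<notin> H" using inf by (meson finite_subset subsetI)
    have "subgroup (adjoin H c) G \<and> finite (adjoin H c)"
      using subgroup_adjoin finite_adjoin tors[OF c(1)] H c by blast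
    moreover have "H \<subset> adjoin H c" using adjoin_superset[of H c] H c by auto
    ultimately show "\<exists>H'. (subgroup H' G \<and> finite H') \<and> H \<subset> H'" by blast
  qed
  then obtain F :: "nat \<Rightarrow> 'a set" where F: "\<And>n. subgroup (F n) G" "\<And>n. F n \<subset> F (Suc n)" by blast
  have mono: "F n \<subseteq> F m" if "n \<le> m" for n m
    using lift_Suc_mono_le[of F] F(2) that by blast
  define D where "D = (\<Union>n. F n)"
  define \<nu> where "\<nu> x = (LEAST n. x \<in> F n)" for x
  have in_F: "x \<in> F (\<nu> x)" if "x \<in> D" for x
    unfolding \<nu>_def using that by (auto simp: D_def intro: LeastI)
  have diff: "x \<otimes> inv y \<in> F (max (\<nu> x) (\<nu> y))" if "x \<in> D" "y \<in> D" for x y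
  proof -
    have "x \<in> F (max (\<nu> x) (\<nu> y))" "y \<in> F (max (\<nu> x) (\<nu> y))"
      using in_F that mono by (meson max.cobounded1 max.cobounded2 subsetD)+
    then show ?thesis using F(1) by (meson subgroup.m_closed subgroup.m_inv_closed)
  qed
  have one: "\<one> \<in> D" using subgroup.one_closed[OF F(1)] by (auto simp: D_def)
  have DG: "x \<in> carrier G" if "x \<in> D" for x
    using that subgroup.mem_carrier[OF F(1)] by (auto simp: D_def)
  have dD: "x \<otimes> inv y \<in> D" if "x \<in> D" "y \<in> D" for x y using diff[OF that] by (auto simp: D_def)
  have inv: "inv x \<in> D" if "x \<in> D" for x using dD[OF one that] DG[OF that] by simp
  have "subgroup D G"
  proof (rule subgroupI)
    show "x \<otimes> y \<in> D" if "x \<in> D" "y \<in> D" for x y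
      using dD[OF that(1) inv[OF that(2)]] DG that by simp
  qed (use DG one inv in auto)
  then have compat: "compatible (\<lambda>u v w. w \<le> max u v) D \<nu>"
    unfolding compatible_def \<nu>_def[of "_ \<otimes> _"] using diff by (auto intro: Least_le)
  have "\<exists>\<nu>'. compatible (\<lambda>u v w. w \<le> max u v) (carrier G) \<nu>' \<and> (\<forall>x \<in> D. \<nu>' x = \<nu> x)"
    by (rule compatible_extends[OF compat], rule extension_step[OF extend_ultrametric_length])
  then obtain \<nu>' where \<nu>': "compatible (\<lambda>u v w. w \<le> max u v) (carrier G) \<nu>'"
    and ext: "\<forall>x \<in> D. \<nu>' x = \<nu> x" by blast
  have "\<exists>x \<in> carrier G. n < \<nu>' x" for n
  proof -
    obtain x where x: "x \<in> F (Suc n)" "x \<notin> F n" using F(2) by blast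
    then have xD: "x \<in> D" by (auto simp: D_def)
    have "n < \<nu> x" using in_F[OF xD] mono x(2) by (meson not_le subsetD)
    then have "n < \<nu>' x" using ext xD by simp
    then show ?thesis using xD DG by blast
  qed
  then show ?thesis using \<nu>' unfolding compatible_def ultrametric_length_def unbounded_length_def by blast
qed

lemma infinite_dichotomy:
  assumes "infinite (carrier G)"
  shows "(\<exists>\<chi> \<in> hom G integer_group. \<exists>x \<in> carrier G. \<chi> x \<noteq> 0) \<or>
         (\<exists>\<nu>. ultrametric_length G \<nu> \<and> unbounded_length G \<nu>)"
proof (cases "\<forall>c \<in> carrier G. \<exists>n :: nat. 0 < n \<and> c [^] n = \<one>")
  case True
  then show ?thesis using torsion_unbounded_length assms by blast
next
  case False
  then obtain c where c: "c \<in> carrier G" "\<And>n :: nat. 0 < n \<Longrightarrow> c [^] n \<noteq> \<one>" by blast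
  have "i = 0" if i: "c [^] i = \<one>" for i :: int
  proof (cases i rule: int_cases2)
    case (nonneg n)
    then show ?thesis using i c(2)[of n] by (auto simp: int_pow_int)
  next
    case (nonpos n)
    then have "c [^] n = \<one>" using i c(1) int_pow_neg_int[OF c(1), of n] by (simp add: inv_eq_1_iff)
    then show ?thesis using nonpos c(2)[of n] by auto
  qed
  then show ?thesis using non_torsion_dichotomy c(1) by blast
qed

end

lemma (in group) infinite_abelianisation:
  assumes inf: "infinite (carrier (abelianisation G))"
  shows "(\<exists>\<chi> \<in> hom G integer_group. \<exists>x \<in> carrier G. \<chi> x \<noteq> 0) \<or>
         (\<exists>\<nu>. ultrametric_length G \<nu> \<and> unbounded_length G \<nu>)"
proof -
  let ?C = "abelianisation G" and ?\<pi> = "\<lambda>a. derived G (carrier G) #> a"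
  interpret C: comm_group ?C unfolding abelianisation_def by (rule derived_quot_is_comm_group)
  have hom: "?\<pi> \<in> hom G ?C"
    unfolding abelianisation_def by (rule normal.r_coset_hom_Mod[OF derived_self_is_normal])
  then interpret \<pi>: group_hom G ?C ?\<pi> by (simp add: group_hom_def group_hom_axioms_def)
  have surj: "\<exists>a \<in> carrier G. x = ?\<pi> a" if "x \<in> carrier ?C" for x
    using that by (auto simp: abelianisation_def FactGroup_def RCOSETS_def)
  consider \<chi> x where "\<chi> \<in> hom ?C integer_group" "x \<in> carrier ?C" "\<chi> x \<noteq> 0"
    | \<nu> where "ultrametric_length ?C \<nu>" "unbounded_length ?C \<nu>"
    using C.infinite_dichotomy[OF inf] by auto
  then show ?thesis
  proof cases
    case 1
    then have "\<chi> \<circ> ?\<pi> \<in> hom G integer_group" using Group.hom_compose[OF hom] by blast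
    moreover obtain a where "a \<in> carrier G" "(\<chi> \<circ> ?\<pi>) a \<noteq> 0" using surj[OF 1(2)] 1(3) by auto
    ultimately show ?thesis by blast
  next
    case 2
    have "ultrametric_length G (\<nu> \<circ> ?\<pi>)"
      unfolding ultrametric_length_def
    proof (intro ballI)
      fix x y assume xy: "x \<in> carrier G" "y \<in> carrier G"
      then have "?\<pi> (x \<otimes> inv y) = ?\<pi> x \<otimes>\<^bsub>?C\<^esub> inv\<^bsub>?C\<^esub> ?\<pi> y" by simp
      then show "(\<nu> \<circ> ?\<pi>) (x \<otimes> inv y) \<le> max ((\<nu> \<circ> ?\<pi>) x) ((\<nu> \<circ> ?\<pi>) y)"
        using C.ultrametric_lengthD[OF 2(1) \<pi>.hom_closed[OF xy(1)] \<pi>.hom_closed[OF xy(2)]] by simp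
    qed
    moreover have "unbounded_length G (\<nu> \<circ> ?\<pi>)"
      unfolding unbounded_length_def
    proof
      fix n
      obtain x where "x \<in> carrier ?C" "n < \<nu> x" using 2(2) unfolding unbounded_length_def by blast
      moreover from surj[OF this(1)] obtain a where "a \<in> carrier G" "x = ?\<pi> a" by blast
      ultimately show "\<exists>a \<in> carrier G. n < (\<nu> \<circ> ?\<pi>) a" by auto
    qed
    ultimately show ?thesis by blast
  qed
qed

section \<open>The metric of a tree\<close>

text \<open>A shortest walk that joins the ends of an edge without using it repeats no vertex, so
  that the edge closes it to a cycle.\<close>

lemma tree_edge_bridge:
  assumes T: "simplicial_tree V E" and e: "{w, w'} \<in> E"
  shows "(w, w') \<notin> (edge_rel (E - {{w, w'}}))\<^sup>*"
proof
  let ?R = "edge_rel (E - {{w, w'}})"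
  assume "(w, w') \<in> ?R\<^sup>*"
  then have ex: "\<exists>n. (w, w') \<in> ?R ^^ n" using rtrancl_imp_relpow by blast
  define n where "n = (LEAST n. (w, w') \<in> ?R ^^ n)"
  have "(w, w') \<in> ?R ^^ n" unfolding n_def by (rule LeastI_ex[OF ex])
  moreover have least: "n \<le> m" if "(w, w') \<in> ?R ^^ m" for m unfolding n_def using that by (rule Least_le)
  ultimately obtain f where f: "f 0 = w" "f n = w'" "\<And>i. i < n \<Longrightarrow> (f i, f (Suc i)) \<in> ?R"
    unfolding relpow_fun_conv by blast
  have sub: "(f i, f (i + k)) \<in> ?R ^^ k" if "i + k \<le> n" for i k
    unfolding relpow_fun_conv using that f(3) by (intro exI[of _ "\<lambda>l. f (i + l)"]) auto
  \<comment> \<open>Cutting out the loop between \<open>i\<close> and \<open>j\<close> would shorten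
    the walk.\<close>
  have neq: "f i \<noteq> f j" if ij: "i < j" "j \<le> n" for i j
  proof
    assume "f i = f j"
    then have "(w, w') \<in> ?R ^^ (i + (n - j))"
      using sub[of 0 i] sub[of j "n - j"] ij f(1,2) by (auto simp: relpow_add simp del: Nat.add_diff_assoc)
    then show False using least ij by fastforce
  qed
  have "card {w, w'} = 2" using T e unfolding simplicial_tree_def by blast
  then have ww: "w \<noteq> w'" by auto
  have "n \<noteq> 0" using f ww by (cases n) auto
  moreover have "n \<noteq> 1"
  proof
    assume "n = 1"
    then have "(w, w') \<in> ?R" using f(1,2) f(3)[of 0] by simp
    then show False by (simp add: edge_rel_def)
  qed
  ultimately have n2: "2 \<le> n" by simp
  define p where "p = map f [0..<Suc n]"
  have len: "length p = Suc n" by (simp add: p_def)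
  have nth: "p ! i = f i" if "i \<le> n" for i
    unfolding p_def using that by (metis add_0 diff_zero le_imp_less_Suc length_upt nth_map nth_upt)
  have "distinct p"
    unfolding p_def distinct_map inj_on_def using neq
    by (auto simp del: upt_Suc) (metis less_Suc_eq_le linorder_neqE_nat)
  moreover have "{p ! i, p ! (Suc i mod length p)} \<in> E" if "i < length p" for i
  proof (cases "i = n")
    case True
    then show ?thesis using len nth f e by (simp add: insert_commute)
  next
    case False
    then have "i < n" using that len by simp
    then show ?thesis using len nth f(3)[of i] by (simp add: edge_rel_def)
  qed
  ultimately have "is_cycle E p" using len n2 by (simp add: is_cycle_def)
  then show False using T by (auto simp: simplicial_tree_def)
qed

section \<open>Graph distance and the metric axioms of a tree\<close>

definition graph_dist :: "'v set set \<Rightarrow> 'v \<Rightarrow> 'v \<Rightarrow> int" where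
  "graph_dist E u v = int (LEAST n. (u, v) \<in> edge_rel E ^^ n)"

lemma graph_dist_le: "(u, v) \<in> edge_rel E ^^ n \<Longrightarrow> graph_dist E u v \<le> int n"
  unfolding graph_dist_def by (simp add: Least_le)

lemma sym_edge_rel: "sym (edge_rel E)"
  unfolding sym_def edge_rel_def by (simp add: insert_commute)

lemma graph_dist_commute: "graph_dist E u v = graph_dist E v u"
proof -
  have "(v, u) \<in> edge_rel E ^^ n" if "(u, v) \<in> edge_rel E ^^ n" for u v and n :: nat
    using that
  proof (induction n arbitrary: u)
    case (Suc n)
    then obtain w where "(u, w) \<in> edge_rel E" "(w, v) \<in> edge_rel E ^^ n"
      by (meson relpow_Suc_D2)
    then show ?case using Suc.IH sym_edge_rel by (metis relpow_Suc_I symD)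
  qed simp
  then have "(u, v) \<in> edge_rel E ^^ n \<longleftrightarrow> (v, u) \<in> edge_rel E ^^ n" for n by blast
  then show ?thesis unfolding graph_dist_def by presburger
qed

text \<open>Axioms of a 0-hyperbolic integral metric. Parity expresses that the graph is bipartite
  and makes Gromov products integers; the four point condition contains the triangle inequality as
  the case \<open>z = w\<close>.\<close>

locale tree_metric =
  fixes V :: "'v set" and d :: "'v \<Rightarrow> 'v \<Rightarrow> int"
  assumes nonempty: "V \<noteq> {}"
    and dist_self: "x \<in> V \<Longrightarrow> d x x = 0"
    and dist_eq_0: "x \<in> V \<Longrightarrow> y \<in> V \<Longrightarrow> d x y = 0 \<Longrightarrow> x = y"
    and dist_commute: "d x y = d y x"
    and geodesic: "x \<in> V \<Longrightarrow> y \<in> V \<Longrightarrow> 0 \<le> k \<Longrightarrow> k \<le> d x y \<Longrightarrow>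
                     \<exists>z \<in> V. d x z = k \<and> d z y = d x y - k"
    and parity: "x \<in> V \<Longrightarrow> y \<in> V \<Longrightarrow> z \<in> V \<Longrightarrow> even (d x y + d y z + d x z)"
    and four_point: "x \<in> V \<Longrightarrow> y \<in> V \<Longrightarrow> z \<in> V \<Longrightarrow> w \<in> V \<Longrightarrow>
                     d x y + d z w \<le> max (d x z + d y w) (d x w + d y z)"

context
  fixes V :: "'v set" and E
  assumes T: "simplicial_tree V E"
begin

lemma relpow_graph_dist:
  assumes "u \<in> V" "v \<in> V"
  shows "(u, v) \<in> edge_rel E ^^ nat (graph_dist E u v)"
proof -
  have "(u, v) \<in> (edge_rel E)\<^sup>*" using T assms unfolding simplicial_tree_def by blast
  then have "\<exists>n. (u, v) \<in> edge_rel E ^^ n" using rtrancl_imp_relpow by blast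
  from LeastI_ex[OF this] show ?thesis unfolding graph_dist_def by simp
qed

lemma graph_dist_triangle:
  assumes "u \<in> V" "v \<in> V" "w \<in> V"
  shows "graph_dist E u w \<le> graph_dist E u v + graph_dist E v w"
proof -
  have "(u, w) \<in> edge_rel E ^^ (nat (graph_dist E u v) + nat (graph_dist E v w))"
    using relpow_graph_dist assms unfolding relpow_add by blast
  from graph_dist_le[OF this] show ?thesis by (simp add: graph_dist_def)
qed

lemma graph_dist_edge:
  assumes "{u, v} \<in> E"
  shows "graph_dist E u v = 1" "u \<in> V" "v \<in> V"
proof -
  have "{u, v} \<subseteq> V \<and> card {u, v} = 2" using T assms unfolding simplicial_tree_def by blast
  then have uv: "u \<in> V" "v \<in> V" "u \<noteq> v" by auto
  then show "u \<in> V" "v \<in> V" by auto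
  have "(u, v) \<in> edge_rel E ^^ 1" using assms by (simp add: edge_rel_def)
  from graph_dist_le[OF this] have "graph_dist E u v \<le> 1" by simp
  moreover have "graph_dist E u v \<noteq> 0" using relpow_graph_dist[OF uv(1,2)] uv(3) by auto
  ultimately show "graph_dist E u v = 1" by (simp add: graph_dist_def)
qed

lemma graph_dist_Suc:
  assumes "u \<in> V" "v \<in> V" "graph_dist E u v \<noteq> 0"
  shows "\<exists>w. {w, v} \<in> E \<and> graph_dist E u w = graph_dist E u v - 1"
proof -
  obtain n where n: "nat (graph_dist E u v) = Suc n"
    using assms(3) unfolding graph_dist_def by (metis nat_int not0_implies_Suc of_nat_0)
  then obtain w where w: "(u, w) \<in> edge_rel E ^^ n" "(w, v) \<in> edge_rel E"
    using relpow_graph_dist[OF assms(1,2)] by auto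
  then have e: "{w, v} \<in> E" by (simp add: edge_rel_def)
  have "graph_dist E u w \<le> int n" using graph_dist_le w(1) .
  moreover have "graph_dist E u v \<le> graph_dist E u w + 1"
    using graph_dist_triangle[of u w v] graph_dist_edge[OF e] assms by simp
  ultimately show ?thesis using e n by auto
qed

text \<open>
  Removing the edge \<open>{w, w'}\<close> separates the tree: a walk leaving the side of \<open>w\<close> crosses it.
\<close>

lemma edge_sides:
  assumes e: "{w, w'} \<in> E"
  shows "\<exists>S. w \<in> S \<and> w' \<notin> S \<and> (\<forall>x \<in> V \<inter> S. \<forall>y \<in> V - S.
           graph_dist E x y = graph_dist E x w + 1 + graph_dist E w' y)"
proof -
  define S where "S = {x. (w, x) \<in> (edge_rel (E - {{w, w'}}))\<^sup>*}"
  have wS: "w \<in> S" "w' \<notin> S" unfolding S_def using tree_edge_bridge[OF T e] by auto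
  have wV: "w \<in> V" "w' \<in> V" and ww1: "graph_dist E w w' = 1" using graph_dist_edge[OF e] by auto
  have cross: "x = w \<and> y = w'" if "x \<in> S" "y \<notin> S" "(x, y) \<in> edge_rel E" for x y
  proof -
    have "{x, y} = {w, w'}"
    proof (rule ccontr)
      assume "{x, y} \<noteq> {w, w'}"
      then have "(x, y) \<in> edge_rel (E - {{w, w'}})" using that(3) by (simp add: edge_rel_def)
      then have "y \<in> S" using \<open>x \<in> S\<close> unfolding S_def by (simp add: rtrancl.rtrancl_into_rtrancl)
      then show False using that by simp
    qed
    then show ?thesis using that wS by (auto simp: doubleton_eq_iff)
  qed
  \<comment> \<open>Induction along the walk: as long as it stays in \<open>S\<close> the triangle
    inequality suffices, and the step that leaves \<open>S\<close> must be the one from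
    \<open>w\<close> to \<open>w'\<close>.\<close>
  have ge: "graph_dist E x w + 1 + graph_dist E w' y \<le> int n"
    if "(x, y) \<in> edge_rel E ^^ n" "x \<in> V \<inter> S" "y \<notin> S" for x y and n :: nat
    using that
  proof (induction n arbitrary: x)
    case 0
    then show ?case by simp
  next
    case (Suc n)
    then obtain z where z: "(x, z) \<in> edge_rel E" "(z, y) \<in> edge_rel E ^^ n"
      by (meson relpow_Suc_D2)
    then have zV: "z \<in> V" and xz: "graph_dist E x z = 1"
      using graph_dist_edge[of x z] by (auto simp: edge_rel_def)
    show ?case
    proof (cases "z \<in> S")
      case True
      then have "graph_dist E z w + 1 + graph_dist E w' y \<le> int n" using Suc z zV by blast
      moreover have "graph_dist E x w \<le> 1 + graph_dist E z w"
        using graph_dist_triangle[of x z w] xz zV wV Suc.prems by simp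
      ultimately show ?thesis by simp
    next
      case False
      then have "x = w" "z = w'" using cross Suc.prems z by auto
      moreover have "graph_dist E w w = 0" using graph_dist_le[of w w 0 E] by (simp add: graph_dist_def)
      ultimately show ?thesis using graph_dist_le[OF z(2)] by simp
    qed
  qed
  have "graph_dist E x y = graph_dist E x w + 1 + graph_dist E w' y" if "x \<in> V \<inter> S" "y \<in> V - S" for x y
  proof (rule antisym)
    show "graph_dist E x y \<le> graph_dist E x w + 1 + graph_dist E w' y"
      using graph_dist_triangle[of x w y] graph_dist_triangle[of w w' y] that wV ww1 by force
    show "graph_dist E x w + 1 + graph_dist E w' y \<le> graph_dist E x y"
      using ge[OF relpow_graph_dist[of x y]] that by (simp add: graph_dist_def)
  qed
  then show ?thesis using wS by blast
qed

lemma graph_dist_self: "graph_dist E u u = 0"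
  using graph_dist_le[of u u 0 E] by (simp add: graph_dist_def)

lemma graph_dist_edge_cases:
  assumes "{w, w'} \<in> E" "u \<in> V"
  shows "graph_dist E u w' = graph_dist E u w + 1 \<or> graph_dist E u w' = graph_dist E u w - 1"
proof -
  obtain S where S: "w \<in> S" "w' \<notin> S" and eq: "\<And>x y. x \<in> V \<Longrightarrow> x \<in> S \<Longrightarrow> y \<in> V \<Longrightarrow> y \<notin> S \<Longrightarrow>
           graph_dist E x y = graph_dist E x w + 1 + graph_dist E w' y"
    using edge_sides[OF assms(1)] by blast
  show ?thesis
  proof (cases "u \<in> S")
    case True
    then show ?thesis using eq[of u w'] S assms graph_dist_edge[OF assms(1)]
      by (simp add: graph_dist_self)
  next
    case False
    then show ?thesis using eq[of w u] S assms graph_dist_edge[OF assms(1)]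
      by (simp add: graph_dist_self graph_dist_commute[of E u])
  qed
qed

text \<open>Moving \<open>z\<close> along an edge towards \<open>y\<close> changes its distances to
  \<open>x\<close> and to \<open>y\<close> by exactly one each, so the parity is that of the
  degenerate triangle \<open>z = y\<close>.\<close>

lemma graph_dist_parity:
  assumes V: "x \<in> V" "y \<in> V" "z \<in> V"
  shows "even (graph_dist E x y + graph_dist E y z + graph_dist E x z)"
proof -
  have "even (graph_dist E x y + graph_dist E y z + graph_dist E x z)"
    if "nat (graph_dist E y z) = n" "z \<in> V" for n
    using that
  proof (induction n arbitrary: z)
    case 0
    then have "y = z" using relpow_graph_dist[OF V(2), of z] by simp
    then show ?case by (simp add: graph_dist_self)
  next
    case (Suc n)
    then obtain w where w: "{w, z} \<in> E" "graph_dist E y w = graph_dist E y z - 1"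
      using graph_dist_Suc[OF V(2), of z] by fastforce
    then have "even (graph_dist E x y + graph_dist E y w + graph_dist E x w)"
      using Suc.IH[of w] Suc.prems graph_dist_edge[OF w(1)] by simp
    then show ?case using w graph_dist_edge_cases[OF w(1) V(1)] by auto
  qed
  then show ?thesis using V by blast
qed

text \<open>Induction on the distance from \<open>z\<close> to \<open>w\<close>: the last edge on
  the way to \<open>w\<close> cuts the tree, and it remains to see on which sides \<open>x\<close>
  and \<open>y\<close> lie.\<close>

lemma graph_dist_four_point:
  assumes V: "x \<in> V" "y \<in> V" "z \<in> V" "w \<in> V"
  shows "graph_dist E x y + graph_dist E z w
           \<le> max (graph_dist E x z + graph_dist E y w) (graph_dist E x w + graph_dist E y z)"
proof -
  have "graph_dist E x y + graph_dist E z w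
           \<le> max (graph_dist E x z + graph_dist E y w) (graph_dist E x w + graph_dist E y z)"
    if "nat (graph_dist E z w) = n" "w \<in> V" for n
    using that
  proof (induction n arbitrary: w)
    case 0
    then have "z = w" using relpow_graph_dist[OF V(3), of w] by simp
    then show ?case using graph_dist_triangle[of x z y] V
      by (simp add: graph_dist_self graph_dist_commute[of E y])
  next
    case (Suc n)
    then obtain w' where w: "{w', w} \<in> E" "graph_dist E z w' = graph_dist E z w - 1"
      using graph_dist_Suc[OF V(3), of w] by fastforce
    have w'V: "w' \<in> V" and ww: "graph_dist E w' w = 1" using graph_dist_edge[OF w(1)] by auto
    have IH: "graph_dist E x y + graph_dist E z w' \<le>
        max (graph_dist E x z + graph_dist E y w') (graph_dist E x w' + graph_dist E y z)"
      using Suc.IH[of w'] Suc.prems w w'V by simp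
    obtain S where S: "w' \<in> S" "w \<notin> S" and eq: "\<And>x y. x \<in> V \<Longrightarrow> x \<in> S \<Longrightarrow> y \<in> V \<Longrightarrow> y \<notin> S \<Longrightarrow>
           graph_dist E x y = graph_dist E x w' + 1 + graph_dist E w y"
      using edge_sides[OF w(1)] by blast
    have zS: "z \<in> S"
    proof (rule ccontr)
      assume "z \<notin> S"
      then show False using eq[of w' z] S V w'V w
        by (simp add: graph_dist_self graph_dist_commute[of E z])
    qed
    note c = graph_dist_commute
    have zu: "graph_dist E z u = graph_dist E z w + graph_dist E w u" if "u \<in> V" "u \<notin> S" for u
      using eq[of z u] that zS V w by simp
    have u: "graph_dist E u w = graph_dist E u w' + 1" if "u \<in> V" "u \<in> S" for u
      using eq[of u w] that Suc.prems S by (simp add: graph_dist_self)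
    have tr: "graph_dist E x y \<le> graph_dist E x w + graph_dist E w y"
      using graph_dist_triangle V Suc.prems by blast
    \<comment> \<open>With \<open>x\<close> and \<open>y\<close> both on the side of
      \<open>w'\<close>, their distances to \<open>w\<close> and that of \<open>z\<close> are one
      more than to \<open>w'\<close>, and the induction hypothesis is merely shifted. If
      \<open>x\<close> or \<open>y\<close> lies beyond the edge, its geodesic to \<open>z\<close>
      passes through \<open>w\<close>, and the estimate follows from the distance formulas.\<close>
    consider "x \<in> S" "y \<in> S" | "x \<notin> S" "y \<notin> S" | "x \<in> S" "y \<notin> S" | "x \<notin> S" "y \<in> S" by blast
    then show ?case
    proof cases
      case 1
      then show ?thesis using IH u[of x] u[of y] V w by linarith
    next
      case 2
      then show ?thesis using zu[of x] tr V c[of E x z] c[of E y w] c[of E x w] by linarith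
    next
      case 3
      then show ?thesis using zu[of y] eq[of x y] u[of x] V c[of E y z] by linarith
    next
      case 4
      then show ?thesis using zu[of x] eq[of y x] u[of y] V c[of E x z] c[of E x y] c[of E w x] by linarith
    qed
  qed
  then show ?thesis using V by blast
qed

lemma tree_metric_graph_dist: "tree_metric V (graph_dist E)"
proof
  show "V \<noteq> {}" using T by (simp add: simplicial_tree_def)
  show "x = y" if "x \<in> V" "y \<in> V" "graph_dist E x y = 0" for x y
    using relpow_graph_dist[of x y] that by simp
  show "\<exists>z \<in> V. graph_dist E x z = k \<and> graph_dist E z y = graph_dist E x y - k"
    if xy: "x \<in> V" "y \<in> V" and "0 \<le> k" "k \<le> graph_dist E x y" for x y k
  proof -
    define n m where "n = nat k" and "m = nat (graph_dist E x y - k)"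
    have "nat (graph_dist E x y) = n + m" using that by (simp add: n_def m_def)
    then have "(x, y) \<in> edge_rel E ^^ n O edge_rel E ^^ m"
      using relpow_graph_dist[OF xy] by (simp add: relpow_add)
    then obtain z where z: "(x, z) \<in> edge_rel E ^^ n" "(z, y) \<in> edge_rel E ^^ m" by blast
    have zV: "z \<in> V"
    proof (cases n)
      case (Suc i)
      then show ?thesis using z(1) graph_dist_edge(3)[of _ z] by (auto simp: edge_rel_def)
    qed (use z xy in auto)
    have "graph_dist E x y \<le> graph_dist E x z + graph_dist E z y"
      using graph_dist_triangle xy zV by blast
    moreover have "graph_dist E x z \<le> k" "graph_dist E z y \<le> graph_dist E x y - k"
      using graph_dist_le[OF z(1)] graph_dist_le[OF z(2)] that by (auto simp: n_def m_def)
    ultimately have "graph_dist E x z = k \<and> graph_dist E z y = graph_dist E x y - k" by linarith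
    then show ?thesis using zV by blast
  qed
qed (simp add: graph_dist_self, rule graph_dist_commute, rule graph_dist_parity, assumption+,
    rule graph_dist_four_point)

end

section \<open>Betweenness, convex sets and projections\<close>

context tree_metric
begin

lemma dist_triangle: "x \<in> V \<Longrightarrow> y \<in> V \<Longrightarrow> z \<in> V \<Longrightarrow> d x z \<le> d x y + d y z"
  using four_point[of x z y y] dist_self dist_commute[of z y] by auto

lemma dist_nonneg: "x \<in> V \<Longrightarrow> y \<in> V \<Longrightarrow> 0 \<le> d x y"
  using dist_triangle[of x y x] dist_self dist_commute[of y x] by auto

text \<open>The four point condition for \<open>y\<close>, \<open>z\<close>, \<open>s\<close>,
  \<open>t\<close> bounds \<open>d y z + d s t\<close> by \<open>d s t\<close>.\<close>

lemma between_unique: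
  assumes "y \<in> V" "z \<in> V" "s \<in> V" "t \<in> V"
    and "d s y = d s z" "d y t = d z t" "d s y + d y t = d s t"
  shows "y = z"
proof -
  have "d y z \<le> 0"
    using four_point[of y z s t] assms dist_commute[of s y] dist_commute[of s z] by auto
  then show ?thesis using dist_nonneg[of y z] dist_eq_0[of y z] assms by auto
qed

text \<open>Meant for the projections \<open>a\<close> and \<open>b\<close> of \<open>p\<close> to
  two convex sets that share the point \<open>r\<close>: the farther projection lies between the
  nearer one and \<open>r\<close>, hence by convexity in both sets.\<close>

lemma between_order:
  assumes V: "p \<in> V" "a \<in> V" "b \<in> V" "r \<in> V"
    and a: "d p r = d p a + d a r" and b: "d p r = d p b + d b r" and le: "d p a \<le> d p b"
  shows "d a b + d b r = d a r"
proof -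
  have "d a b + d p r \<le> max (d a p + d b r) (d a r + d b p)" using four_point V by blast
  then have "d a b \<le> d a r - d b r"
    using a b le dist_commute[of a p] dist_commute[of b p] by auto
  then show ?thesis using dist_triangle[of a b r] V by linarith
qed

definition convex :: "'v set \<Rightarrow> bool" where
  "convex F \<longleftrightarrow> F \<subseteq> V \<and> (\<forall>x \<in> F. \<forall>y \<in> F. \<forall>z \<in> V. d x z + d z y = d x y \<longrightarrow> z \<in> F)"

lemma convexD:
  "convex F \<Longrightarrow> x \<in> F \<Longrightarrow> y \<in> F \<Longrightarrow> z \<in> V \<Longrightarrow> d x z + d z y = d x y \<Longrightarrow> z \<in> F"
  unfolding convex_def by blast

text \<open>A nearest point works. If the path from \<open>p\<close> to \<open>r\<close> did not
  pass through it, the branch point of the tripod \<open>p\<close>, \<open>q\<close>,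
  \<open>r\<close> would lie in \<open>F\<close> and be nearer.\<close>

lemma convex_projection:
  assumes F: "convex F" "F \<noteq> {}" and p: "p \<in> V"
  shows "\<exists>q \<in> F. \<forall>r \<in> F. d p r = d p q + d q r"
proof -
  obtain q where q: "q \<in> F" and min: "\<And>r. r \<in> F \<Longrightarrow> nat (d p q) \<le> nat (d p r)"
    using ex_has_least_nat[of "\<lambda>r. r \<in> F" _ "\<lambda>r. nat (d p r)"] F(2) by blast
  have FV: "F \<subseteq> V" using F by (simp add: convex_def)
  have "d p r = d p q + d q r" if r: "r \<in> F" for r
  proof -
    have V: "q \<in> V" "r \<in> V" using q r FV by auto
    \<comment> \<open>\<open>i\<close> is the Gromov product of \<open>p\<close> and
      \<open>r\<close> seen from \<open>q\<close>, that is, the distance from \<open>q\<close> to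
      the branch point \<open>m\<close>; parity makes it an integer.\<close>
    have "even (d p q + d q r - d p r)" using parity[OF p V] by simp
    then obtain i where i: "d p q + d q r - d p r = 2 * i" by (elim evenE)
    have "0 \<le> i" using i dist_triangle[OF p V] by simp
    moreover have "i \<le> d q r"
      using i dist_triangle[of p r q] p V dist_commute[of q r] by simp
    ultimately obtain m where m: "m \<in> V" "d q m = i" "d m r = d q r - i"
      using geodesic[OF V] by blast
    then have mF: "m \<in> F" using convexD[OF F(1) q r m(1)] by simp
    have "d p m + d q r \<le> max (d p q + d m r) (d p r + d m q)"
      using four_point p V m by blast
    then have "d p m \<le> d p q - i" using m i dist_commute[of m q] by auto
    moreover have "d p q \<le> d p m" using min[OF mF] dist_nonneg[OF p m(1)] by simp
    ultimately show ?thesis using i \<open>0 \<le> i\<close> by simp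
  qed
  then show ?thesis using q by blast
qed

end

lemma antimono_int_eventually_const:
  fixes f :: "nat \<Rightarrow> int"
  assumes dec: "\<And>n. f (Suc n) \<le> f n" and bound: "\<And>n. b \<le> f n"
  shows "\<exists>c N. \<forall>n\<ge>N. f n = c"
proof -
  obtain N where N: "\<And>n. nat (f N - b) \<le> nat (f n - b)"
    using ex_has_least_nat[of "\<lambda>_. True" _ "\<lambda>n. nat (f n - b)"] by blast
  have "f n = f N" if "N \<le> n" for n
  proof (rule antisym)
    show "f n \<le> f N" using lift_Suc_antimono_le[of f, OF dec that] .
    show "f N \<le> f n" using N[of n] bound[of n] bound[of N] by simp
  qed
  then show ?thesis by blast
qed

section \<open>Fixed points of tree isometries\<close>

locale tree_isometries = tree_metric V d + group G
  for V :: "'v set" and d and G :: "('g, 'm) monoid_scheme" (structure) +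
  fixes \<phi> :: "'g \<Rightarrow> 'v \<Rightarrow> 'v"
  assumes act_closed: "g \<in> carrier G \<Longrightarrow> x \<in> V \<Longrightarrow> \<phi> g x \<in> V"
    and act_one: "x \<in> V \<Longrightarrow> \<phi> \<one> x = x"
    and act_mult: "g \<in> carrier G \<Longrightarrow> h \<in> carrier G \<Longrightarrow> x \<in> V \<Longrightarrow> \<phi> (g \<otimes> h) x = \<phi> g (\<phi> h x)"
    and isometry: "g \<in> carrier G \<Longrightarrow> x \<in> V \<Longrightarrow> y \<in> V \<Longrightarrow> d (\<phi> g x) (\<phi> g y) = d x y"
    and no_inversion: "g \<in> carrier G \<Longrightarrow> x \<in> V \<Longrightarrow> d x (\<phi> g x) = 1 \<Longrightarrow> \<phi> g (\<phi> g x) \<noteq> x"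
begin

definition Fix :: "'g set \<Rightarrow> 'v set" where
  "Fix S = {v \<in> V. \<forall>g \<in> S. \<phi> g v = v}"

lemma Fix_in: "v \<in> Fix S \<Longrightarrow> v \<in> V" "v \<in> Fix S \<Longrightarrow> g \<in> S \<Longrightarrow> \<phi> g v = v"
  by (auto simp: Fix_def)

lemma act_inv: "g \<in> carrier G \<Longrightarrow> x \<in> V \<Longrightarrow> \<phi> (inv g) (\<phi> g x) = x"
  and act_inv': "g \<in> carrier G \<Longrightarrow> x \<in> V \<Longrightarrow> \<phi> g (\<phi> (inv g) x) = x"
  by (metis act_mult act_one inv_closed l_inv, metis act_mult act_one inv_closed r_inv)

text \<open>A point of a segment is determined by its distances to the two ends, and an isometry
  fixing the ends preserves these.\<close>

lemma convex_Fix: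
  assumes S: "S \<subseteq> carrier G"
  shows "convex (Fix S)"
proof -
  have "z \<in> Fix S"
    if xy: "x \<in> Fix S" "y \<in> Fix S" and z: "z \<in> V" "d x z + d z y = d x y" for x y z
  proof -
    have "\<phi> g z = z" if g: "g \<in> S" for g
    proof -
      have V: "x \<in> V" "y \<in> V" using xy Fix_in by auto
      have gxy: "\<phi> g x = x" "\<phi> g y = y" using xy g Fix_in by auto
      have gG: "g \<in> carrier G" using g S by blast
      have "d x (\<phi> g z) = d x z" "d (\<phi> g z) y = d z y"
        using isometry[OF gG V(1) z(1)] isometry[OF gG z(1) V(2)] gxy by auto
      then show ?thesis
        using between_unique[OF act_closed[OF gG z(1)] z(1) V] z(2) by simp
    qed
    then show ?thesis using z(1) by (simp add: Fix_def)
  qed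
  moreover have "Fix S \<subseteq> V" using Fix_in by blast
  ultimately show ?thesis unfolding convex_def by blast
qed

section \<open>Elliptic elements\<close>

text \<open>
  \<open>P\<close> approximates a fixed point of \<open>g\<close> at infinity: it is moved by little compared with its
  distance to \<open>x\<close>.
\<close>

lemma midpoint_fixed:
  assumes g: "g \<in> carrier G" and V: "x \<in> V" "m \<in> V" "P \<in> V"
    and m: "d x m = k" "d m (\<phi> g x) = k" "d x (\<phi> g x) = 2 * k"
    and P: "d (\<phi> g x) P = d x P" "k + d P (\<phi> g P) \<le> d x P"
  shows "\<phi> g m = m"
proof -
  have gV: "\<phi> g x \<in> V" "\<phi> g m \<in> V" "\<phi> g P \<in> V" using act_closed g V by auto
  have D: "0 \<le> d P (\<phi> g P)" using dist_nonneg V gV by blast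
  have iso: "d (\<phi> g m) (\<phi> g P) = d m P" "d (\<phi> g x) (\<phi> g P) = d x P" "d (\<phi> g m) (\<phi> g x) = k"
    using isometry g V m dist_commute[of m x] by auto
  \<comment> \<open>Since \<open>x\<close> and \<open>\<phi> g x\<close> are equally far from
    \<open>P\<close>, a path from \<open>P\<close> meets the segment between them at its midpoint:
    starting from \<open>m\<close> instead of \<open>x\<close> saves \<open>k\<close>.\<close>
  have "d m P + d x (\<phi> g x) \<le> max (d m x + d P (\<phi> g x)) (d m (\<phi> g x) + d P x)"
    using four_point V gV by blast
  then have mP: "d m P \<le> d x P - k"
    using m P dist_commute[of m x] dist_commute[of P x] dist_commute[of P "\<phi> g x"] by auto
  \<comment> \<open>The bound on the displacement of \<open>P\<close> makes the first entry of the
    maximum harmless, so \<open>\<phi> g m\<close> satisfies the same estimate as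
    \<open>m\<close>.\<close>
  have "d (\<phi> g m) P + d (\<phi> g x) (\<phi> g P)
      \<le> max (d (\<phi> g m) (\<phi> g x) + d P (\<phi> g P)) (d (\<phi> g m) (\<phi> g P) + d P (\<phi> g x))"
    using four_point V gV by blast
  then have gmP: "d (\<phi> g m) P \<le> d x P - k"
    using iso mP P D dist_commute[of P "\<phi> g x"] by auto
  have "d m (\<phi> g m) + d (\<phi> g x) P \<le> max (d m (\<phi> g x) + d (\<phi> g m) P) (d m P + d (\<phi> g m) (\<phi> g x))"
    using four_point V gV by blast
  then have "d m (\<phi> g m) \<le> 0" using m mP gmP iso P by auto
  then show ?thesis using dist_nonneg[of m "\<phi> g m"] dist_eq_0[of m "\<phi> g m"] V gV by auto
qed

text \<open>A fixed point has displacement 0 and can serve as \<open>P\<close>; its distance to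
  \<open>x\<close> is large enough by the triangle inequality through \<open>p\<close>.\<close>

lemma elliptic_midpoint:
  assumes g: "g \<in> carrier G" and p: "p \<in> Fix {g}" and V: "x \<in> V" "m \<in> V"
    and m: "d x m = k" "d m (\<phi> g x) = k" "d x (\<phi> g x) = 2 * k"
  shows "\<phi> g m = m"
proof -
  have pV: "p \<in> V" "\<phi> g p = p" using p Fix_in by auto
  have eq: "d (\<phi> g x) p = d x p" using isometry[OF g V(1) pV(1)] pV by simp
  have "2 * k \<le> d x p + d p (\<phi> g x)" using dist_triangle[of x p "\<phi> g x"] V pV act_closed g m by simp
  then have "k + d p (\<phi> g p) \<le> d x p" using eq dist_commute[of p "\<phi> g x"] pV dist_self by simp
  then show ?thesis using midpoint_fixed[OF g V pV(1) m eq] by blast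
qed

text \<open>Serre's lemma. If \<open>r\<close> is fixed by the product, \<open>h\<close> carries
  \<open>r\<close> to \<open>s\<close> and \<open>g\<close> carries \<open>s\<close> back to
  \<open>r\<close>, so both fix the midpoint of the segment. A midpoint exists because a fixed point
  of \<open>g\<close> is equally far from \<open>r\<close> and \<open>s\<close>.\<close>

lemma common_fixed_point:
  assumes gh: "g \<in> carrier G" "h \<in> carrier G"
    and ne: "Fix {g} \<noteq> {}" "Fix {h} \<noteq> {}" "Fix {g \<otimes> h} \<noteq> {}"
  shows "Fix {g, h} \<noteq> {}"
proof -
  obtain p q r where p: "p \<in> Fix {g}" and q: "q \<in> Fix {h}" and r: "r \<in> Fix {g \<otimes> h}" using ne by blast
  define s where "s = \<phi> h r"
  have rV: "r \<in> V" and pV: "p \<in> V" "\<phi> g p = p" using p r Fix_in by auto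
  have sV: "s \<in> V" unfolding s_def using act_closed rV gh by blast
  have gs: "\<phi> g s = r" using Fix_in(2)[OF r, of "g \<otimes> h"] act_mult gh rV by (simp add: s_def)
  have "d s p = d r p" using isometry[OF gh(1) sV pV(1)] gs pV by simp
  then have "even (d s r)" using parity[OF sV rV pV(1)] by simp
  then obtain k where k: "d s r = 2 * k" by (elim evenE)
  obtain m where m: "m \<in> V" "d s m = k" "d m r = k"
    using geodesic[OF sV rV, of k] k dist_nonneg[OF sV rV] by auto
  have "\<phi> g m = m" using elliptic_midpoint[OF gh(1) p sV m(1)] gs k m by simp
  moreover have "\<phi> h m = m"
    using elliptic_midpoint[OF gh(2) q rV m(1), of k] k m dist_commute[of r m] dist_commute[of r s]
      dist_commute[of m s]
    by (simp add: s_def)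
  ultimately have "m \<in> Fix {g, h}" using m(1) by (simp add: Fix_def)
  then show ?thesis by blast
qed

text \<open>The length of \<open>g\<close> is the distance from \<open>p\<close> to
  \<open>Fix {g}\<close>. Of two projections the farther is fixed by both elements, hence by their
  quotient: this is the ultrametric inequality. If the lengths were bounded, the farthest projection
  of all would be fixed by the whole group.\<close>

lemma elliptic_without_fixed_point:
  assumes ell: "\<And>g. g \<in> carrier G \<Longrightarrow> Fix {g} \<noteq> {}" and none: "Fix (carrier G) = {}"
  shows "\<exists>\<nu>. ultrametric_length G \<nu> \<and> unbounded_length G \<nu>"
proof -
  obtain p where p: "p \<in> V" using nonempty by blast
  have "\<exists>q \<in> Fix {g}. \<forall>r \<in> Fix {g}. d p r = d p q + d q r" if "g \<in> carrier G" for g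
    by (rule convex_projection[OF convex_Fix ell[OF that] p]) (use that in blast)
  then have "\<forall>g \<in> carrier G. \<exists>q. q \<in> Fix {g} \<and> (\<forall>r \<in> Fix {g}. d p r = d p q + d q r)" by blast
  from bchoice[OF this] obtain q where q: "\<And>g. g \<in> carrier G \<Longrightarrow> q g \<in> Fix {g}"
    and qr: "\<And>g r. g \<in> carrier G \<Longrightarrow> r \<in> Fix {g} \<Longrightarrow> d p r = d p (q g) + d (q g) r"
    by blast
  have qV: "q g \<in> V" if "g \<in> carrier G" for g using q[OF that] Fix_in by blast
  have farther: "q h \<in> Fix {g}" if g: "g \<in> carrier G" and h: "h \<in> carrier G" and le: "d p (q g) \<le> d p (q h)" for g h
  proof -
    obtain r where r: "r \<in> Fix {g, h}" using common_fixed_point[OF g h] ell g h m_closed by blast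
    then have r': "r \<in> V" "r \<in> Fix {g}" "r \<in> Fix {h}" by (auto simp: Fix_def)
    have "d (q g) (q h) + d (q h) r = d (q g) r"
      using between_order[OF p qV[OF g] qV[OF h] r'(1) qr[OF g r'(2)] qr[OF h r'(3)] le] .
    then show ?thesis using convexD[OF convex_Fix q[OF g] r'(2) qV[OF h]] g by blast
  qed
  define \<nu> where "\<nu> g = nat (d p (q g))" for g
  have "\<nu> (g \<otimes> inv h) \<le> max (\<nu> g) (\<nu> h)" if g: "g \<in> carrier G" and h: "h \<in> carrier G" for g h
  proof -
    have "\<exists>c \<in> {g, h}. q c \<in> Fix {g} \<and> q c \<in> Fix {h}"
    proof (cases "d p (q g) \<le> d p (q h)")
      case True
      then show ?thesis using farther[OF g h] q[OF h] by blast
    next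
      case False
      then show ?thesis using farther[OF h g] q[OF g] by auto
    qed
    then obtain c where c: "c \<in> {g, h}" "q c \<in> Fix {g}" "q c \<in> Fix {h}" by blast
    have "\<phi> (inv h) (q c) = q c" using act_inv[OF h Fix_in(1)[OF c(3)]] Fix_in(2)[OF c(3)] by simp
    then have "q c \<in> Fix {g \<otimes> inv h}"
      using c act_mult[OF g inv_closed[OF h]] by (auto simp: Fix_def)
    then have "d p (q (g \<otimes> inv h)) \<le> d p (q c)"
      using qr[of "g \<otimes> inv h" "q c"] dist_nonneg[of "q (g \<otimes> inv h)" "q c"] qV c g h by auto
    then show ?thesis using c(1) unfolding \<nu>_def by auto
  qed
  then have "ultrametric_length G \<nu>" unfolding ultrametric_length_def by blast
  moreover have "unbounded_length G \<nu>"
  proof (rule ccontr)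
    assume "\<not> unbounded_length G \<nu>"
    then obtain n where n: "\<And>g. g \<in> carrier G \<Longrightarrow> \<nu> g \<le> n"
      unfolding unbounded_length_def by (meson not_le_imp_less)
    have "\<forall>g. g \<in> carrier G \<longrightarrow> \<nu> g < Suc n" using n by (simp add: less_Suc_eq_le)
    from ex_has_greatest_nat[OF one_closed this]
    obtain h where h: "h \<in> carrier G" "\<And>g. g \<in> carrier G \<Longrightarrow> \<nu> g \<le> \<nu> h" by blast
    have "q h \<in> Fix {g}" if g: "g \<in> carrier G" for g
      using farther[OF g h(1)] h(2)[OF g] dist_nonneg[OF p qV[OF g]] dist_nonneg[OF p qV[OF h(1)]]
      by (simp add: \<nu>_def)
    then have "q h \<in> Fix (carrier G)" using qV[OF h(1)] by (auto simp: Fix_def)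
    then show False using none by blast
  qed
  ultimately show ?thesis by blast
qed

section \<open>Isometries commuting with a hyperbolic one\<close>

text \<open>
  The Busemann function of the end towards which \<open>T\<close> translates is \<open>G\<close>-equivariant up to
  a constant; \<open>\<chi>\<close> is this constant.
\<close>

lemma centralizer_hyperbolic:
  assumes TV: "\<And>x. x \<in> V \<Longrightarrow> T x \<in> V"
    and Tiso: "\<And>x y. x \<in> V \<Longrightarrow> y \<in> V \<Longrightarrow> d (T x) (T y) = d x y"
    and Tcomm: "\<And>g x. g \<in> carrier G \<Longrightarrow> x \<in> V \<Longrightarrow> T (\<phi> g x) = \<phi> g (T x)"
    and Tfree: "\<And>x. x \<in> V \<Longrightarrow> T x \<noteq> x"
    and Tinv: "\<And>x. x \<in> V \<Longrightarrow> d x (T x) = 1 \<Longrightarrow> T (T x) \<noteq> x"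
  shows "\<exists>\<chi> \<in> hom G integer_group. \<forall>g \<in> carrier G. \<chi> g = 0 \<longrightarrow> Fix {g} \<noteq> {}"
proof -
  \<comment> \<open>Displacements are natural numbers, so a vertex of least displacement exists.
    Such vertices form the axis of \<open>T\<close>, called \<open>L\<close> below.\<close>
  obtain v where v: "v \<in> V" and vmin: "\<And>x. x \<in> V \<Longrightarrow> nat (d v (T v)) \<le> nat (d x (T x))"
    using ex_has_least_nat[of "\<lambda>x. x \<in> V" _ "\<lambda>x. nat (d x (T x))"] nonempty by blast
  define l where "l = d v (T v)"
  have lmin: "l \<le> d x (T x)" if "x \<in> V" for x
    using vmin[OF that] dist_nonneg[OF that TV[OF that]] dist_nonneg[OF v TV[OF v]] by (simp add: l_def)
  have lpos: "0 < l" using dist_nonneg[OF v TV[OF v]] dist_eq_0[OF v TV[OF v]] Tfree[OF v]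
    unfolding l_def by fastforce
  define T' where "T' n = (T ^^ n)" for n :: nat
  have T'V: "T' n x \<in> V" if "x \<in> V" for n x using that TV by (induction n) (auto simp: T'_def)
  have T'0 [simp]: "T' 0 x = x" and T'S: "T' (Suc n) x = T (T' n x)" for n x by (auto simp: T'_def)
  have T'iso: "d (T' n x) (T' n y) = d x y" if "x \<in> V" "y \<in> V" for n x y
    using that Tiso T'V by (induction n) (auto simp: T'S)
  have T'T: "T (T' n x) = T' n (T x)" for n x by (simp add: T'_def funpow_swap1)
  have T'comm: "T' n (\<phi> g x) = \<phi> g (T' n x)" if "g \<in> carrier G" "x \<in> V" for n g x
    using that Tcomm T'V by (induction n) (auto simp: T'S)
  \<comment> \<open>No backtracking at a vertex of least displacement: otherwise the neighbour
    \<open>u\<close> of \<open>w\<close> towards \<open>T w\<close> would be moved less or, when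
    \<open>l = 1\<close>, \<open>T\<close> would exchange two adjacent vertices.\<close>
  have two: "d w (T (T w)) = 2 * l" if w: "w \<in> V" and wl: "d w (T w) = l" for w
  proof (rule ccontr)
    assume neq: "d w (T (T w)) \<noteq> 2 * l"
    let ?a = "T w" and ?b = "T (T w)"
    have V: "?a \<in> V" "?b \<in> V" using w TV by auto
    have ab: "d ?a ?b = l" using Tiso w V wl by simp
    have "d w ?b \<le> 2 * l" using dist_triangle[OF w V] ab wl by simp
    moreover have "even (d w ?b)" using parity[OF w V] ab wl by simp
    ultimately have wb: "d w ?b \<le> 2 * l - 2" using neq by (auto elim!: evenE)
    show False
    proof (cases "l = 1")
      case True
      then have "d w ?b = 0" using wb dist_nonneg[OF w V(2)] by simp
      then show False using Tinv[OF w] dist_eq_0[OF w V(2)] wl True by simp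
    next
      case False
      then have l2: "2 \<le> l" using lpos by simp
      obtain u where u: "u \<in> V" "d w u = 1" "d u ?a = l - 1"
        using geodesic[OF w V(1), of 1] wl l2 by auto
      have Tu: "T u \<in> V" "d ?a (T u) = 1" "d (T u) ?b = l - 1" using u TV Tiso w V by auto
      have "d w (T u) + d ?a ?b \<le> max (d w ?a + d (T u) ?b) (d w ?b + d (T u) ?a)"
        using four_point w V Tu by blast
      then have "d w (T u) \<le> l - 1" using ab wl Tu wb dist_commute[of "T u" ?a] by auto
      moreover have "d u (T u) + d w ?a \<le> max (d u w + d (T u) ?a) (d u ?a + d (T u) w)"
        using four_point w V Tu u by blast
      ultimately have "d u (T u) < l"
        using u Tu wl l2 dist_commute[of u w] dist_commute[of "T u" ?a] dist_commute[of "T u" w]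
        by auto
      then show False using lmin[OF u(1)] by simp
    qed
  qed
  \<comment> \<open>From local to global: consecutive segments of length \<open>l\<close> that join
    to a geodesic in pairs form a geodesic altogether, by the four point condition.\<close>
  have pow: "d w (T' n w) = int n * l" if w: "w \<in> V" and wl: "d w (T w) = l" for w n
  proof (induction n rule: less_induct)
    case (less n)
    consider "n = 0" | "n = 1" | k where "n = Suc (Suc k)" by (metis One_nat_def not0_implies_Suc)
    then show ?case
    proof cases
      case 3
      let ?y = "T' k w" and ?z = "T (T' k w)" and ?u = "T (T (T' k w))"
      have V: "?y \<in> V" "?z \<in> V" "?u \<in> V" using T'V TV w by auto
      have yz: "d ?y ?z = l" using T'T T'iso w TV wl by simp
      then have zu: "d ?z ?u = l" using Tiso V by simp
      have "d w ?y = int k * l" "d w ?z = int (Suc k) * l"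
        using less[of k] less[of "Suc k"] 3 by (auto simp: T'S)
      moreover have "d w ?z + d ?y ?u \<le> max (d w ?y + d ?z ?u) (d w ?u + d ?z ?y)"
        using four_point w V by blast
      moreover have "d ?y ?u = 2 * l" using two[OF V(1) yz] .
      ultimately have "int (Suc (Suc k)) * l \<le> d w ?u"
        using yz zu lpos dist_commute[of ?z ?y] by (auto simp: algebra_simps)
      moreover have "d w ?u \<le> d w ?z + d ?z ?u" using dist_triangle w V by blast
      ultimately show ?thesis using zu \<open>d w ?z = int (Suc k) * l\<close> 3 by (simp add: T'S algebra_simps)
    qed (use w wl dist_self in \<open>auto simp: T'_def\<close>)
  qed
  define L where "L = {w \<in> V. d w (T w) = l}"
  have LV: "w \<in> V" if "w \<in> L" for w using that by (simp add: L_def)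
  have vL: "v \<in> L" using v by (simp add: L_def l_def)
  have actL: "\<phi> g w \<in> L" if "g \<in> carrier G" "w \<in> L" for g w
    using that Tcomm isometry TV act_closed by (simp add: L_def)
  \<comment> \<open>The Busemann function of the end reached by the iterates of \<open>T\<close> on
    \<open>w\<close>. Its defining sequence is nonincreasing and bounded below, so over the integers
    it is eventually constant and no limit has to be taken.\<close>
  define bus where "bus w u = (SOME c. \<exists>N. \<forall>n\<ge>N. d u (T' n w) - int n * l = c)" for w u
  have bus: "\<exists>N. \<forall>n\<ge>N. d u (T' n w) - int n * l = bus w u" if w: "w \<in> L" and u: "u \<in> V" for w u
  proof -
    have wV: "w \<in> V" "d w (T w) = l" using w by (auto simp: L_def)
    have "\<exists>c N. \<forall>n\<ge>N. d u (T' n w) - int n * l = c"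
    proof (rule antimono_int_eventually_const)
      show "d u (T' (Suc n) w) - int (Suc n) * l \<le> d u (T' n w) - int n * l" for n
      proof -
        have "d (T' n w) (T' (Suc n) w) = l" using T'iso[OF wV(1) TV[OF wV(1)]] wV T'T by (simp add: T'S)
        then show ?thesis
          using dist_triangle[OF u T'V[OF wV(1), of n] T'V[OF wV(1), of "Suc n"]] by (simp add: algebra_simps)
      qed
      show "- d u w \<le> d u (T' n w) - int n * l" for n
        using dist_triangle[OF wV(1) u T'V[OF wV(1), of n]] pow[OF wV] dist_commute[of w u] by simp
    qed
    then show ?thesis unfolding bus_def by (rule someI_ex)
  qed
  define N where "N w u = (SOME N. \<forall>n\<ge>N. d u (T' n w) - int n * l = bus w u)" for w u
  have N: "d u (T' n w) = bus w u + int n * l" if "w \<in> L" "u \<in> V" "N w u \<le> n" for w u n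
    using someI_ex[OF bus[OF that(1,2)]] that(3) unfolding N_def by (simp add: diff_eq_eq)
  have large: "\<exists>n. K \<le> n \<and> C \<le> int n * l" for K C
  proof (intro exI conjI)
    show "K \<le> max K (nat C)" by simp
    have "C \<le> int (max K (nat C)) * 1" by simp
    also have "\<dots> \<le> int (max K (nat C)) * l" using lpos by (intro mult_left_mono) auto
    finally show "C \<le> int (max K (nat C)) * l" .
  qed
  \<comment> \<open>All base points on the axis lead to the same end, so their Busemann functions
    differ by a constant. For large \<open>n\<close> the entry \<open>d u u' + d w w'\<close> is too
    small to attain the maximum, and two instances of the four point condition give both
    inequalities.\<close>
  have cocycle: "bus w u + bus w' u' = bus w u' + bus w' u"
    if L: "w \<in> L" "w' \<in> L" and V: "u \<in> V" "u' \<in> V" for w w' u u'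
  proof -
    define C where "C = d u u' + d w w'"
    obtain n where n: "Max {N w u, N w u', N w' u, N w' u'} \<le> n"
      "\<bar>C\<bar> + \<bar>bus w u + bus w' u'\<bar> + \<bar>bus w u' + bus w' u\<bar> + 1 \<le> int n * l"
      using large by blast
    have e: "d u (T' n w) = bus w u + int n * l" "d u' (T' n w) = bus w u' + int n * l"
      "d u (T' n w') = bus w' u + int n * l" "d u' (T' n w') = bus w' u' + int n * l"
      using n(1) N L V by auto
    have TT: "T' n w \<in> V" "T' n w' \<in> V" "d (T' n w) (T' n w') = d w w'"
      using T'V T'iso LV L by auto
    have "d u (T' n w) + d u' (T' n w') \<le> max (d u u' + d (T' n w) (T' n w')) (d u (T' n w') + d (T' n w) u')"
      using four_point V TT by blast
    moreover have "d u (T' n w') + d u' (T' n w) \<le> max (d u u' + d (T' n w') (T' n w)) (d u (T' n w) + d (T' n w') u')"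
      using four_point V TT by blast
    ultimately show ?thesis
      using e n(2) TT(3) dist_commute[of "T' n w" u'] dist_commute[of "T' n w'" u']
        dist_commute[of "T' n w'" "T' n w"] unfolding C_def by linarith
  qed
  have equivariant: "bus v (\<phi> g u) = bus (\<phi> (inv g) v) u" if g: "g \<in> carrier G" and u: "u \<in> V" for g u
  proof -
    have "d (\<phi> g u) (T' n v) = d u (T' n (\<phi> (inv g) v))" for n
    proof -
      have "T' n v = \<phi> g (T' n (\<phi> (inv g) v))"
        using T'comm[OF g act_closed[OF inv_closed[OF g] v]] act_inv'[OF g v] by simp
      then show ?thesis using isometry[OF g u T'V[OF act_closed[OF inv_closed[OF g] v]]] by simp
    qed
    then show ?thesis unfolding bus_def by simp
  qed
  define \<chi> where "\<chi> g = bus v (\<phi> g v) - bus v v" for g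
  have "\<chi> (g \<otimes> h) = \<chi> g + \<chi> h" if g: "g \<in> carrier G" and h: "h \<in> carrier G" for g h
  proof -
    have hv: "\<phi> h v \<in> V" using act_closed h v by blast
    have "bus v (\<phi> g (\<phi> h v)) + bus v v = bus v (\<phi> g v) + bus v (\<phi> h v)"
      using cocycle[OF actL[OF inv_closed[OF g] vL] vL hv v] equivariant[OF g hv] equivariant[OF g v]
      by simp
    then show ?thesis unfolding \<chi>_def using act_mult[OF g h v] by simp
  qed
  then have "\<chi> \<in> hom G integer_group" by (auto simp: hom_def)
  moreover have "Fix {g} \<noteq> {}" if g: "g \<in> carrier G" and 0: "\<chi> g = 0" for g
  proof -
    let ?D = "d v (\<phi> g v)"
    have gv: "\<phi> g v \<in> V" using act_closed g v by blast
    \<comment> \<open>\<open>n\<close> lies beyond both stabilisation indices and is so large that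
      \<open>midpoint_fixed\<close> applies to \<open>T' n v\<close>: as \<open>T\<close> commutes
      with \<open>g\<close>, this point is moved exactly as far as \<open>v\<close>.\<close>
    obtain n where n: "max (N v v) (N v (\<phi> g v)) \<le> n" "2 * ?D \<le> int n * l" using large by blast
    let ?P = "T' n v"
    have P: "?P \<in> V" "d v ?P = int n * l" using T'V v pow[OF v] by (auto simp: l_def)
    have eq: "d (\<phi> g v) ?P = d v ?P"
      using N[OF vL v, of n] N[OF vL gv, of n] n 0 by (simp add: \<chi>_def)
    have "even ?D" using parity[OF v gv P(1)] eq by simp
    then obtain k where k: "?D = 2 * k" by (elim evenE)
    then have k0: "0 \<le> k" using dist_nonneg[OF v gv] by simp
    obtain m where m: "m \<in> V" "d v m = k" "d m (\<phi> g v) = k"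
      using geodesic[OF v gv, of k] k k0 by auto
    have "d ?P (\<phi> g ?P) = ?D" using T'comm[OF g v] T'iso[OF v gv] by simp
    then have "k + d ?P (\<phi> g ?P) \<le> d v ?P" using n(2) P k k0 by simp
    then have "\<phi> g m = m" using midpoint_fixed[OF g v m(1) P(1) m(2,3) k eq] by blast
    then show ?thesis using m(1) by (auto simp: Fix_def)
  qed
  ultimately show ?thesis by blast
qed

text \<open>Commutation makes \<open>Fix S'\<close> invariant under \<open>S\<close>. The projection
  of a point fixed by \<open>S\<close> is the only nearest point of \<open>Fix S'\<close>, so
  \<open>S\<close> fixes it as well.\<close>

lemma commuting_fixed_point:
  assumes S: "S \<subseteq> carrier G" and S': "S' \<subseteq> carrier G"
    and ne: "Fix S \<noteq> {}" "Fix S' \<noteq> {}"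
    and comm: "\<And>g h. g \<in> S \<Longrightarrow> h \<in> S' \<Longrightarrow> g \<otimes> h = h \<otimes> g"
  shows "Fix (S \<union> S') \<noteq> {}"
proof -
  obtain p where p: "p \<in> Fix S" using ne by blast
  then have pV: "p \<in> V" using Fix_in by blast
  obtain q where q: "q \<in> Fix S'" and qr: "\<And>r. r \<in> Fix S' \<Longrightarrow> d p r = d p q + d q r"
    using convex_projection[OF convex_Fix[OF S'] ne(2) pV] by blast
  have qV: "q \<in> V" using q Fix_in by blast
  have "\<phi> g q = q" if g: "g \<in> S" for g
  proof -
    have gG: "g \<in> carrier G" using g S by blast
    have "\<phi> h (\<phi> g q) = \<phi> g q" if h: "h \<in> S'" for h
      using act_mult[of g h q] act_mult[of h g q] comm[OF g h] Fix_in(2)[OF q h] S' h gG qV by auto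
    then have gq: "\<phi> g q \<in> Fix S'" using act_closed[OF gG qV] by (simp add: Fix_def)
    have "d p (\<phi> g q) = d p q" using isometry[OF gG pV qV] Fix_in(2)[OF p g] by simp
    then show ?thesis using qr[OF gq] dist_eq_0[OF qV act_closed[OF gG qV]] by simp
  qed
  then have "q \<in> Fix (S \<union> S')" using q by (auto simp: Fix_def)
  then show ?thesis by blast
qed

text \<open>
  Projecting a point fixed by \<open>K\<close> to the sets \<open>Fix (H x)\<close>, the farthest projection lies in
  all of them.
\<close>

lemma permuted_family_fixed_point:
  fixes \<psi> :: "'g \<Rightarrow> 'x \<Rightarrow> 'x"
  assumes H: "\<And>x. x \<in> X \<Longrightarrow> H x \<subseteq> carrier G" and ne: "\<And>x. x \<in> X \<Longrightarrow> Fix (H x) \<noteq> {}"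
    and comm: "\<And>x y g h. x \<in> X \<Longrightarrow> y \<in> X \<Longrightarrow> x \<noteq> y \<Longrightarrow> g \<in> H x \<Longrightarrow> h \<in> H y \<Longrightarrow> g \<otimes> h = h \<otimes> g"
    and K: "K \<subseteq> carrier G" "Fix K \<noteq> {}"
    and perm: "\<And>k. k \<in> K \<Longrightarrow> \<psi> k ` X = X"
    and move: "\<And>k x v. k \<in> K \<Longrightarrow> x \<in> X \<Longrightarrow> v \<in> Fix (H x) \<Longrightarrow> \<phi> k v \<in> Fix (H (\<psi> k x))"
    and R: "finite R" "R \<subseteq> X" "\<And>x. x \<in> X \<Longrightarrow> \<exists>r \<in> R. \<exists>k \<in> K. x = \<psi> k r" and X: "X \<noteq> {}"
  shows "\<exists>v. v \<in> Fix K \<and> (\<forall>x \<in> X. v \<in> Fix (H x))"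
proof -
  obtain p where p: "p \<in> Fix K" using K by blast
  then have pV: "p \<in> V" using Fix_in by blast
  have "\<exists>q \<in> Fix (H x). \<forall>r \<in> Fix (H x). d p r = d p q + d q r" if "x \<in> X" for x
    using convex_projection[OF convex_Fix[OF H]] that ne pV by blast
  then have "\<forall>x \<in> X. \<exists>q. q \<in> Fix (H x) \<and> (\<forall>r \<in> Fix (H x). d p r = d p q + d q r)" by blast
  from bchoice[OF this] obtain q where q: "\<And>x. x \<in> X \<Longrightarrow> q x \<in> Fix (H x)"
    and qr: "\<And>x r. x \<in> X \<Longrightarrow> r \<in> Fix (H x) \<Longrightarrow> d p r = d p (q x) + d (q x) r"
    by blast
  have qV: "q x \<in> V" if "x \<in> X" for x using q[OF that] Fix_in by blast
  have farther: "q y \<in> Fix (H x)" if x: "x \<in> X" and y: "y \<in> X" and le: "d p (q x) \<le> d p (q y)" for x y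
  proof (cases "x = y")
    case False
    obtain r where r: "r \<in> Fix (H x \<union> H y)"
      using commuting_fixed_point[OF H[OF x] H[OF y] ne[OF x] ne[OF y]] comm[OF x y False] by blast
    then have r': "r \<in> V" "r \<in> Fix (H x)" "r \<in> Fix (H y)" by (auto simp: Fix_def)
    have "d (q x) (q y) + d (q y) r = d (q x) r"
      using between_order[OF pV qV[OF x] qV[OF y] r'(1) qr[OF x r'(2)] qr[OF y r'(3)] le] .
    then show ?thesis using convexD[OF convex_Fix[OF H[OF x]] q[OF x] r'(2) qV[OF y]] by blast
  qed (use q y in blast)
  \<comment> \<open>\<open>k\<close> fixes \<open>p\<close> and carries one fixed point set into the
    other, so the distance cannot grow along an orbit; finitely many representatives then bound all
    distances.\<close>
  have orbit: "d p (q (\<psi> k x)) \<le> d p (q x)" if k: "k \<in> K" and x: "x \<in> X" for k x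
  proof -
    have kG: "k \<in> carrier G" using k K by blast
    have kx: "\<psi> k x \<in> X" using perm[OF k] x by blast
    have "d p (\<phi> k (q x)) = d p (q x)" using isometry[OF kG pV qV[OF x]] Fix_in(2)[OF p k] by simp
    then show ?thesis
      using qr[OF kx move[OF k x q[OF x]]] dist_nonneg[OF qV[OF kx] act_closed[OF kG qV[OF x]]] by simp
  qed
  define M where "M = Max ((\<lambda>r. nat (d p (q r))) ` R)"
  have "nat (d p (q x)) \<le> M" if x: "x \<in> X" for x
  proof -
    obtain r k where r: "r \<in> R" "k \<in> K" "x = \<psi> k r" using R(3)[OF x] by blast
    have "nat (d p (q x)) \<le> nat (d p (q r))" using orbit[of k r] r R(2) by auto
    also have "\<dots> \<le> M" unfolding M_def using r R(1) by (intro Max_ge) auto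
    finally show ?thesis .
  qed
  then have "\<forall>x. x \<in> X \<longrightarrow> nat (d p (q x)) < Suc M" by (simp add: less_Suc_eq_le)
  then obtain x where x: "x \<in> X" and max: "\<And>y. y \<in> X \<Longrightarrow> nat (d p (q y)) \<le> nat (d p (q x))"
    using ex_has_greatest_nat[of "\<lambda>x. x \<in> X" _ "\<lambda>x. nat (d p (q x))" "Suc M"] X by blast
  have all: "q x \<in> Fix (H y)" if y: "y \<in> X" for y
    using farther[OF y x] max[OF y] dist_nonneg[OF pV qV[OF y]] dist_nonneg[OF pV qV[OF x]] by simp
  \<comment> \<open>Since \<open>q x\<close> lies in every set of the family, its image under
    \<open>k\<close> lies in \<open>Fix (H x)\<close> again, at the same distance from
    \<open>p\<close>; the nearest point is unique.\<close>
  have "\<phi> k (q x) = q x" if k: "k \<in> K" for k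
  proof -
    have kG: "k \<in> carrier G" using k K by blast
    obtain y where y: "y \<in> X" "x = \<psi> k y" using perm[OF k] x by blast
    have "\<phi> k (q x) \<in> Fix (H x)" using move[OF k y(1) all[OF y(1)]] y(2) by simp
    moreover have "d p (\<phi> k (q x)) = d p (q x)" using isometry[OF kG pV qV[OF x]] Fix_in(2)[OF p k] by simp
    ultimately show ?thesis using qr[OF x] dist_eq_0[OF qV[OF x] act_closed[OF kG qV[OF x]]] by simp
  qed
  then have "q x \<in> Fix K" using qV[OF x] by (simp add: Fix_def)
  then show ?thesis using all by blast
qed

end

section \<open>Actions without fixed vertices\<close>

text \<open>\<open>BijGroup V\<close> consists of extensional maps, hence the
  \<open>restrict\<close>.\<close>

lemma group_actionI:
  assumes G: "group G"
    and closed: "\<And>g x. g \<in> carrier G \<Longrightarrow> x \<in> V \<Longrightarrow> \<phi> g x \<in> V"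
    and one: "\<And>x. x \<in> V \<Longrightarrow> \<phi> \<one>\<^bsub>G\<^esub> x = x"
    and mult: "\<And>g h x. g \<in> carrier G \<Longrightarrow> h \<in> carrier G \<Longrightarrow> x \<in> V \<Longrightarrow>
                 \<phi> (g \<otimes>\<^bsub>G\<^esub> h) x = \<phi> g (\<phi> h x)"
  shows "group_action G V (\<lambda>g. restrict (\<phi> g) V)"
proof -
  interpret group G by fact
  have Bij: "restrict (\<phi> g) V \<in> Bij V" if g: "g \<in> carrier G" for g
  proof -
    have "bij_betw (\<phi> g) V V"
    proof (rule bij_betw_byWitness[where f' = "\<phi> (inv\<^bsub>G\<^esub> g)"])
      show "\<forall>x \<in> V. \<phi> (inv\<^bsub>G\<^esub> g) (\<phi> g x) = x" using mult[of "inv\<^bsub>G\<^esub> g" g] one g by simp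
      show "\<forall>x \<in> V. \<phi> g (\<phi> (inv\<^bsub>G\<^esub> g) x) = x" using mult[of g "inv\<^bsub>G\<^esub> g"] one g by simp
    qed (use closed g in auto)
    then show ?thesis by (simp add: Bij_def bij_betw_restrict_eq)
  qed
  moreover have "restrict (\<phi> (g \<otimes>\<^bsub>G\<^esub> h)) V = compose V (restrict (\<phi> g) V) (restrict (\<phi> h) V)"
    if "g \<in> carrier G" "h \<in> carrier G" for g h
    using mult closed that by (auto simp: compose_def restrict_def)
  ultimately have "(\<lambda>g. restrict (\<phi> g) V) \<in> hom G (BijGroup V)"
    by (auto simp: hom_def BijGroup_def)
  then show ?thesis
    by (simp add: group_action_def group_hom_def group_hom_axioms_def group_BijGroup G)
qed

text \<open>A tree seen from one of its ends: \<open>\<pi>\<close> moves one step towards the end,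
  and \<open>lev\<close> is a Busemann function up to sign. In a cycle both neighbours of a vertex
  of least level would be its parent.\<close>

lemma parent_tree:
  fixes \<pi> :: "'v \<Rightarrow> 'v" and lev :: "'v \<Rightarrow> int"
  assumes V: "V \<noteq> {}" "\<And>v. v \<in> V \<Longrightarrow> \<pi> v \<in> V"
    and lev: "\<And>v. v \<in> V \<Longrightarrow> lev (\<pi> v) = lev v + 1"
    and merge: "\<And>u v. u \<in> V \<Longrightarrow> v \<in> V \<Longrightarrow> \<exists>i j. (\<pi> ^^ i) u = (\<pi> ^^ j) v"
  shows "simplicial_tree V ((\<lambda>v. {v, \<pi> v}) ` V)"
proof -
  let ?E = "(\<lambda>v. {v, \<pi> v}) ` V"
  have "{v, \<pi> v} \<subseteq> V \<and> card {v, \<pi> v} = 2" if "v \<in> V" for v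
  proof -
    have "v \<noteq> \<pi> v" using lev[OF that] by auto
    then show ?thesis using V(2) that by simp
  qed
  then have edge: "\<forall>e \<in> ?E. e \<subseteq> V \<and> card e = 2" by blast
  have pow: "(v, (\<pi> ^^ i) v) \<in> (edge_rel ?E)\<^sup>* \<and> (\<pi> ^^ i) v \<in> V" if v: "v \<in> V" for v i
  proof (induction i)
    case (Suc i)
    then have "((\<pi> ^^ i) v, (\<pi> ^^ Suc i) v) \<in> edge_rel ?E" by (auto simp: edge_rel_def)
    then show ?case using Suc V(2) by (auto intro: rtrancl_into_rtrancl)
  qed (use v in simp)
  have sym: "sym ((edge_rel ?E)\<^sup>*)" by (rule sym_rtrancl[OF sym_edge_rel])
  have conn: "(u, v) \<in> (edge_rel ?E)\<^sup>*" if uv: "u \<in> V" "v \<in> V" for u v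
  proof -
    obtain i j where "(\<pi> ^^ i) u = (\<pi> ^^ j) v" using merge[OF uv] by blast
    then have "(u, (\<pi> ^^ j) v) \<in> (edge_rel ?E)\<^sup>*" using pow[OF uv(1), of i] by simp
    moreover have "((\<pi> ^^ j) v, v) \<in> (edge_rel ?E)\<^sup>*" using pow[OF uv(2), of j] sym by (meson symD)
    ultimately show ?thesis by (rule rtrancl_trans)
  qed
  have up: "b = \<pi> a" if ab: "{a, b} \<in> ?E" "lev a \<le> lev b" for a b
  proof -
    obtain v where v: "v \<in> V" "{a, b} = {v, \<pi> v}" using ab(1) by blast
    then have "a = v \<and> b = \<pi> v \<or> a = \<pi> v \<and> b = v" by (simp add: doubleton_eq_iff)
    then show ?thesis using ab(2) lev[OF v(1)] by auto
  qed
  have False if p: "is_cycle ?E p" for p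
  proof -
    let ?n = "length p"
    have n: "3 \<le> ?n" and dist: "distinct p"
      and e: "\<And>i. i < ?n \<Longrightarrow> {p ! i, p ! (Suc i mod ?n)} \<in> ?E"
      using p by (auto simp: is_cycle_def)
    have n0: "0 < ?n" using n by linarith
    then have "0 \<in> {..<?n}" by (simp only: lessThan_iff)
    then have "finite ((\<lambda>i. lev (p ! i)) ` {..<?n})" "(\<lambda>i. lev (p ! i)) ` {..<?n} \<noteq> {}" by blast+
    from Min_in[OF this] obtain i where i: "i < ?n" "lev (p ! i) = Min ((\<lambda>i. lev (p ! i)) ` {..<?n})"
      by auto
    have min: "lev (p ! i) \<le> lev (p ! j)" if "j < ?n" for j
      unfolding i(2) using that by (intro Min_le) auto
    \<comment> \<open>The index cyclically preceding \<open>i\<close>. In a cycle of length at least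
      3 it differs from the succeeding one.\<close>
    define k where "k = (if i = 0 then ?n - 1 else i - 1)"
    have k: "k < ?n" "Suc k mod ?n = i" using n i(1) by (auto simp: k_def)
    have j: "Suc i mod ?n < ?n" using n0 by (rule mod_less_divisor)
    have "p ! (Suc i mod ?n) = \<pi> (p ! i)" using up[OF e[OF i(1)] min[OF j]] .
    moreover have "p ! k = \<pi> (p ! i)"
      using up[of "p ! i" "p ! k"] e[OF k(1)] min[OF k(1)] k(2) by (simp add: insert_commute)
    ultimately have "Suc i mod ?n = k" using dist j k(1) nth_eq_iff_index_eq by metis
    then show False using n i(1) by (cases "Suc i = ?n") (auto simp: k_def split: if_splits)
  qed
  then show ?thesis unfolding simplicial_tree_def using V(1) edge conn by blast
qed

text \<open>The action preserves the parent map but may shift the levels. An inversion of the edge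
  from \<open>a\<close> to \<open>\<pi> a\<close> would give \<open>\<pi> (\<pi> a) = a\<close>,
  although the level has risen by two.\<close>

lemma parent_tree_not_FA:
  fixes \<pi> :: "'v \<Rightarrow> 'v" and lev :: "'v \<Rightarrow> int"
  assumes act: "group_action G V \<phi>"
    and V: "V \<noteq> {}" "\<And>v. v \<in> V \<Longrightarrow> \<pi> v \<in> V"
    and lev: "\<And>v. v \<in> V \<Longrightarrow> lev (\<pi> v) = lev v + 1"
    and merge: "\<And>u v. u \<in> V \<Longrightarrow> v \<in> V \<Longrightarrow> \<exists>i j. (\<pi> ^^ i) u = (\<pi> ^^ j) v"
    and comm: "\<And>g v. g \<in> carrier G \<Longrightarrow> v \<in> V \<Longrightarrow> \<phi> g (\<pi> v) = \<pi> (\<phi> g v)"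
    and free: "\<And>v. v \<in> V \<Longrightarrow> \<exists>g \<in> carrier G. \<phi> g v \<noteq> v"
  shows "\<not> property_FA G"
proof
  assume FA: "property_FA G"
  interpret group_action G V \<phi> by fact
  let ?E = "(\<lambda>v. {v, \<pi> v}) ` V"
  have im: "\<phi> g ` {v, \<pi> v} = {\<phi> g v, \<pi> (\<phi> g v)}" if "g \<in> carrier G" "v \<in> V" for g v
    using comm that by simp
  have "(\<lambda>e. \<phi> g ` e) ` ?E = ?E" if g: "g \<in> carrier G" for g
  proof -
    have "(\<lambda>e. \<phi> g ` e) ` ?E = (\<lambda>v. {\<phi> g v, \<pi> (\<phi> g v)}) ` V"
      using im[OF g] by (simp add: image_image)
    also have "\<dots> = (\<lambda>v. {v, \<pi> v}) ` \<phi> g ` V" by (simp add: image_image)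
    finally show ?thesis using surj_prop[OF g] by simp
  qed
  then have ta: "tree_action G V ?E \<phi>" using act by (simp add: tree_action_def)
  have "without_inversions G ?E \<phi>"
    unfolding without_inversions_def
  proof (intro notI, elim bexE exE conjE)
    fix g u v assume g: "g \<in> carrier G" and e: "{u, v} \<in> ?E" and uv: "\<phi> g u = v" "\<phi> g v = u"
    have contr: False if "a \<in> V" "b = \<pi> a" "\<phi> g a = b" "\<phi> g b = a" for a b
      using comm[OF g that(1)] that lev[OF that(1)] lev[OF V(2)[OF that(1)]] by auto
    obtain w where w: "w \<in> V" "{u, v} = {w, \<pi> w}" using e by blast
    then have "u = w \<and> v = \<pi> w \<or> u = \<pi> w \<and> v = w" by (simp add: doubleton_eq_iff)
    then show False
    proof
      assume "u = w \<and> v = \<pi> w"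
      then show False using contr[of u v] w(1) uv by simp
    next
      assume "u = \<pi> w \<and> v = w"
      then show False using contr[of v u] w(1) uv by simp
    qed
  qed
  moreover have "simplicial_tree V ?E" using V lev merge by (rule parent_tree)
  ultimately obtain v where "v \<in> V" "\<forall>g \<in> carrier G. \<phi> g v = v"
    using property_FA_fixes_vertex[OF FA _ ta] by blast
  then show False using free by blast
qed

lemma integer_hom_not_FA:
  assumes G: "group G" and \<chi>: "\<chi> \<in> hom G integer_group" and x: "x \<in> carrier G" "\<chi> x \<noteq> 0"
  shows "\<not> property_FA G"
proof -
  interpret \<chi>: group_hom G integer_group \<chi>
    using G \<chi> by (simp add: group_hom_def group_hom_axioms_def)
  have act: "group_action G UNIV (\<lambda>g. restrict (\<lambda>n. n + \<chi> g) UNIV)"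
    using \<chi>.hom_one \<chi>.hom_mult by (intro group_actionI G) auto
  have pow: "((\<lambda>n :: int. n + 1) ^^ k) n = n + int k" for k and n :: int by (induction k) auto
  show ?thesis
  proof (rule parent_tree_not_FA[OF act, where \<pi> = "\<lambda>n. n + 1" and lev = "\<lambda>n. n"])
    show "\<exists>i j. ((\<lambda>n. n + 1) ^^ i) u = ((\<lambda>n. n + 1) ^^ j) v" for u v :: int
      unfolding pow by (intro exI[of _ "nat (v - u)"] exI[of _ "nat (u - v)"]) simp
    show "\<exists>g \<in> carrier G. restrict (\<lambda>n. n + \<chi> g) UNIV v \<noteq> v" for v using x by auto
  qed auto
qed

text \<open>The tree of an exhaustion: vertices are the left cosets of the balls, and the parent is
  the coset of the next ball. Two vertices merge because the quotient of their representatives lies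
  in some ball; none is fixed because every ball is a proper subgroup.\<close>

lemma unbounded_length_not_FA:
  assumes G: "group G" and ul: "ultrametric_length G \<nu>" and ub: "unbounded_length G \<nu>"
  shows "\<not> property_FA G"
proof -
  interpret group G by fact
  \<comment> \<open>The shift by the length of the identity makes already \<open>S 0\<close> a
    subgroup.\<close>
  define S where "S n = {x \<in> carrier G. \<nu> x \<le> \<nu> \<one>\<^bsub>G\<^esub> + n}" for n
  have S: "subgroup (S n) G" for n unfolding S_def using subgroup_ultrametric_ball[OF ul] by simp
  note SG = subgroup.subset[OF S]
  have SS: "S n <#>\<^bsub>G\<^esub> S (Suc n) = S (Suc n)" for n
  proof
    have "S n \<subseteq> S (Suc n)" by (auto simp: S_def)
    then show "S n <#>\<^bsub>G\<^esub> S (Suc n) \<subseteq> S (Suc n)"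
      using subgroup.m_closed[OF S] by (auto simp: set_mult_def)
    show "S (Suc n) \<subseteq> S n <#>\<^bsub>G\<^esub> S (Suc n)"
    proof
      fix x assume x: "x \<in> S (Suc n)"
      then have "x = \<one>\<^bsub>G\<^esub> \<otimes>\<^bsub>G\<^esub> x" using subgroup.mem_carrier[OF S] by simp
      then show "x \<in> S n <#>\<^bsub>G\<^esub> S (Suc n)"
        unfolding set_mult_def using x subgroup.one_closed[OF S] by blast
    qed
  qed
  \<comment> \<open>The index is kept in the vertex because \<open>S n\<close> and
    \<open>S (Suc n)\<close> may coincide.\<close>
  define V where "V = {(n, g <#\<^bsub>G\<^esub> S n) | n g. g \<in> carrier G}"
  have VI: "(n, g <#\<^bsub>G\<^esub> S n) \<in> V" if "g \<in> carrier G" for n g unfolding V_def using that by blast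
  define \<phi> where "\<phi> h v = (fst v, h <#\<^bsub>G\<^esub> snd v)" for h and v :: "nat \<times> 'a set"
  \<comment> \<open>Written as a product of sets, the parent involves no choice of a
    representative.\<close>
  define \<pi> where "\<pi> v = (Suc (fst v), snd v <#>\<^bsub>G\<^esub> S (Suc (fst v)))" for v
  have assoc: "h <#\<^bsub>G\<^esub> (g <#\<^bsub>G\<^esub> S n) = (h \<otimes>\<^bsub>G\<^esub> g) <#\<^bsub>G\<^esub> S n"
    if "g \<in> carrier G" "h \<in> carrier G" for g h n
    using lcos_m_assoc[OF SG that(2,1)] .
  have \<phi>: "\<phi> h (n, g <#\<^bsub>G\<^esub> S n) = (n, (h \<otimes>\<^bsub>G\<^esub> g) <#\<^bsub>G\<^esub> S n)"
    if "g \<in> carrier G" "h \<in> carrier G" for g h n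
    using assoc[OF that] by (simp add: \<phi>_def)
  have \<pi>: "\<pi> (n, g <#\<^bsub>G\<^esub> S n) = (Suc n, g <#\<^bsub>G\<^esub> S (Suc n))" if "g \<in> carrier G" for g n
    using setmult_lcos_assoc[OF SG SG that] SS by (simp add: \<pi>_def)
  have V: "\<exists>n g. v = (n, g <#\<^bsub>G\<^esub> S n) \<and> g \<in> carrier G" if "v \<in> V" for v
    using that unfolding V_def by blast
  have "group_action G V (\<lambda>g. restrict (\<phi> g) V)"
  proof (rule group_actionI[OF G])
    fix v assume "v \<in> V"
    then obtain n g where v: "v = (n, g <#\<^bsub>G\<^esub> S n)" "g \<in> carrier G" using V by blast
    show "\<phi> h v \<in> V" if h: "h \<in> carrier G" for h using \<phi> v h VI by simp
    show "\<phi> \<one>\<^bsub>G\<^esub> v = v" using \<phi> v by simp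
    show "\<phi> (h \<otimes>\<^bsub>G\<^esub> k) v = \<phi> h (\<phi> k v)" if "h \<in> carrier G" "k \<in> carrier G" for h k
      using \<phi> v that by (simp add: m_assoc)
  qed
  then show ?thesis
  proof (rule parent_tree_not_FA[where \<pi> = \<pi> and lev = "\<lambda>v. int (fst v)"])
    show "V \<noteq> {}" using VI[OF one_closed] by blast
    show \<pi>V: "\<pi> v \<in> V" if v: "v \<in> V" for v
    proof -
      obtain n g where "v = (n, g <#\<^bsub>G\<^esub> S n)" "g \<in> carrier G" using V[OF v] by blast
      then show ?thesis using \<pi> VI by simp
    qed
    show "int (fst (\<pi> v)) = int (fst v) + 1" for v by (simp add: \<pi>_def)
    show "\<exists>i j. (\<pi> ^^ i) u = (\<pi> ^^ j) v" if uv: "u \<in> V" "v \<in> V" for u v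
    proof -
      have pow: "(\<pi> ^^ i) (n, g <#\<^bsub>G\<^esub> S n) = (n + i, g <#\<^bsub>G\<^esub> S (n + i))" if "g \<in> carrier G" for g n i
        by (induction i) (use \<pi> that in auto)
      obtain n g m h where u: "u = (n, g <#\<^bsub>G\<^esub> S n)" "g \<in> carrier G"
        and v: "v = (m, h <#\<^bsub>G\<^esub> S m)" "h \<in> carrier G" using V[OF uv(1)] V[OF uv(2)] by blast
      define x where "x = inv\<^bsub>G\<^esub> g \<otimes>\<^bsub>G\<^esub> h"
      define M where "M = n + m + \<nu> x"
      have x: "x \<in> carrier G" "x \<in> S M" "g \<otimes>\<^bsub>G\<^esub> x = h"
        using u v by (auto simp: x_def M_def S_def m_assoc[symmetric])
      have "h <#\<^bsub>G\<^esub> S M = g <#\<^bsub>G\<^esub> (x <#\<^bsub>G\<^esub> S M)" using assoc[OF x(1) u(2)] x(3) by simp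
      also have "\<dots> = g <#\<^bsub>G\<^esub> S M" using coset_join3[OF x(1) S x(2)] by simp
      finally have "(\<pi> ^^ (m + \<nu> x)) u = (\<pi> ^^ (n + \<nu> x)) v"
        using pow[OF u(2)] pow[OF v(2)] u v by (simp add: M_def ac_simps)
      then show ?thesis by blast
    qed
    show "restrict (\<phi> g) V (\<pi> v) = \<pi> (restrict (\<phi> g) V v)" if g: "g \<in> carrier G" and v: "v \<in> V" for g v
    proof -
      obtain n h where "v = (n, h <#\<^bsub>G\<^esub> S n)" "h \<in> carrier G" using V[OF v] by blast
      then show ?thesis using \<pi> \<phi> \<pi>V[OF v] g v by simp
    qed
    show "\<exists>g \<in> carrier G. restrict (\<phi> g) V v \<noteq> v" if vV: "v \<in> V" for v
    proof -
      obtain n g where v: "v = (n, g <#\<^bsub>G\<^esub> S n)" "g \<in> carrier G" using V[OF vV] by blast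
      obtain x where x: "x \<in> carrier G" "\<nu> \<one>\<^bsub>G\<^esub> + n < \<nu> x" using ub unfolding unbounded_length_def by blast
      define h where "h = g \<otimes>\<^bsub>G\<^esub> x \<otimes>\<^bsub>G\<^esub> inv\<^bsub>G\<^esub> g"
      have h: "h \<in> carrier G" "h \<otimes>\<^bsub>G\<^esub> g = g \<otimes>\<^bsub>G\<^esub> x" using v x by (auto simp: h_def m_assoc)
      have "\<phi> h v \<noteq> v"
      proof
        assume "\<phi> h v = v"
        then have "(g \<otimes>\<^bsub>G\<^esub> x) <#\<^bsub>G\<^esub> S n = g <#\<^bsub>G\<^esub> S n" using \<phi> v h by simp
        moreover have "g \<otimes>\<^bsub>G\<^esub> x \<in> (g \<otimes>\<^bsub>G\<^esub> x) <#\<^bsub>G\<^esub> S n"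
          unfolding l_coset_def using subgroup.one_closed[OF S] v x by force
        ultimately obtain y where y: "y \<in> S n" "g \<otimes>\<^bsub>G\<^esub> x = g \<otimes>\<^bsub>G\<^esub> y" unfolding l_coset_def by blast
        then have "y \<in> carrier G" using SG by blast
        then have "x = y" using y(2) v(2) x(1) by simp
        then show False using y(1) x(2) by (simp add: S_def)
      qed
      then show ?thesis using h(1) vV by auto
    qed
  qed
qed

section \<open>Actions and Property (FA) along homomorphisms\<close>

lemma tree_action_hom:
  assumes ta: "tree_action G V E \<phi>" and h: "h \<in> hom K G" and K: "group K"
  shows "tree_action K V E (\<phi> \<circ> h)"
proof -
  interpret group_action G V \<phi> using ta by (simp add: tree_action_def)
  have "\<phi> \<in> hom G (BijGroup V)" using group_hom by (simp add: group_hom_def group_hom_axioms_def)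
  then have "\<phi> \<circ> h \<in> hom K (BijGroup V)" using h by (intro Group.hom_compose)
  then have "group_action K V (\<phi> \<circ> h)"
    by (simp add: group_action_def group_hom_def group_hom_axioms_def group_BijGroup K)
  then show ?thesis using ta hom_in_carrier[OF h] by (simp add: tree_action_def)
qed

lemma without_inversions_hom:
  "without_inversions G E \<phi> \<Longrightarrow> h \<in> hom K G \<Longrightarrow> without_inversions K E (\<phi> \<circ> h)"
  unfolding without_inversions_def by (auto dest: hom_in_carrier)

text \<open>The trees that define Property (FA) for \<open>H\<close> live on lists over the type of
  \<open>H\<close>; \<open>property_FA_fixes_vertex\<close> makes them available to the action of
  \<open>G\<close> that is pulled back along \<open>h\<close>.\<close>

lemma property_FA_image:
  assumes FA: "property_FA G" and G: "group G" and h: "h \<in> hom G H" and surj: "h ` carrier G = carrier H"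
  shows "property_FA H"
  unfolding property_FA_def
proof (intro allI impI, elim conjE)
  fix V :: "'c list set" and E \<phi>
  assume T: "simplicial_tree V E" and A: "tree_action H V E \<phi>" and I: "without_inversions H E \<phi>"
  obtain v where "v \<in> V" "\<forall>g \<in> carrier G. (\<phi> \<circ> h) g v = v"
    using property_FA_fixes_vertex[OF FA T tree_action_hom[OF A h G] without_inversions_hom[OF I h]] by blast
  then show "\<exists>v \<in> V. \<forall>g \<in> carrier H. \<phi> g v = v" unfolding surj[symmetric] by auto
qed

section \<open>The permutational wreath product\<close>

lemma tree_action_isometries:
  assumes T: "simplicial_tree V E" and A: "tree_action G V E \<phi>" and I: "without_inversions G E \<phi>"
  shows "tree_isometries V (graph_dist E) G \<phi>"
proof -
  interpret group_action G V \<phi> using A by (simp add: tree_action_def)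
  interpret group G using group_hom group_hom.axioms(1) by auto
  interpret tree_metric V "graph_dist E" by (rule tree_metric_graph_dist[OF T])
  have E: "\<phi> g ` e \<in> E" if "g \<in> carrier G" "e \<in> E" for g e
    using A that unfolding tree_action_def by blast
  have closed: "\<phi> g x \<in> V" if "g \<in> carrier G" "x \<in> V" for g x using that element_image by blast
  have one: "\<phi> \<one>\<^bsub>G\<^esub> x = x" if "x \<in> V" for x
    using that by (metis id_eq_one restrict_apply')
  have walk: "(\<phi> g x, \<phi> g y) \<in> edge_rel E ^^ n"
    if g: "g \<in> carrier G" and xy: "(x, y) \<in> edge_rel E ^^ n" for g x y and n :: nat
    using xy
  proof (induction n arbitrary: y)
    case (Suc n)
    then obtain z where z: "(x, z) \<in> edge_rel E ^^ n" "{z, y} \<in> E" by (auto simp: edge_rel_def)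
    then have "{\<phi> g z, \<phi> g y} \<in> E" using E[OF g z(2)] by simp
    then show ?case using Suc.IH[OF z(1)] by (auto simp: edge_rel_def)
  qed simp
  have le: "graph_dist E (\<phi> g x) (\<phi> g y) \<le> graph_dist E x y"
    if "g \<in> carrier G" "x \<in> V" "y \<in> V" for g x y
    using graph_dist_le[OF walk[OF that(1) relpow_graph_dist[OF T that(2,3)]]]
    by (simp add: graph_dist_def)
  show ?thesis
  proof
    fix g x y assume g: "g \<in> carrier G" and V: "x \<in> V" "y \<in> V"
    have "\<phi> (inv\<^bsub>G\<^esub> g) (\<phi> g z) = z" if "z \<in> V" for z
      using composition_rule[of z "inv\<^bsub>G\<^esub> g" g] g one that by simp
    then show "graph_dist E (\<phi> g x) (\<phi> g y) = graph_dist E x y"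
      using le[OF g V] le[OF inv_closed[OF g] closed[OF g V(1)] closed[OF g V(2)]] V by simp
  next
    fix g x assume g: "g \<in> carrier G" and x: "x \<in> V" and 1: "graph_dist E x (\<phi> g x) = 1"
    have "(x, \<phi> g x) \<in> edge_rel E" using relpow_graph_dist[OF T x closed[OF g x]] 1 by simp
    then show "\<phi> g (\<phi> g x) \<noteq> x" using I g unfolding without_inversions_def edge_rel_def by blast
  qed (use closed one composition_rule in auto)
qed

lemma (in tree_isometries) tree_isometries_hom:
  assumes K: "group K" and h: "h \<in> hom K G"
  shows "tree_isometries V d K (\<phi> \<circ> h)"
proof -
  interpret h: group_hom K G h using K h is_group by (simp add: group_hom_def group_hom_axioms_def)
  show ?thesis
    by unfold_locales (auto simp: act_closed act_one act_mult isometry no_inversion)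
qed

section \<open>Coordinates and generators of the wreath product\<close>

locale permutational_wreath = A: group A + group_action B X \<phi>
  for A :: "('a, 'p) monoid_scheme" and B :: "('b, 'q) monoid_scheme" and X :: "'x set" and \<phi>
begin

abbreviation "W \<equiv> wreath_product A X B \<phi>"

lemma group_B: "group B"
  using group_hom group_hom.axioms(1) by auto

sublocale B: group B by (rule group_B)

sublocale W: group W
  by (rule group_wreath_product[OF A.is_group]) (rule group_action_axioms)

lemma act_one: "x \<in> X \<Longrightarrow> \<phi> \<one>\<^bsub>B\<^esub> x = x"
  by (metis id_eq_one restrict_apply')

lemma act_closed: "b \<in> carrier B \<Longrightarrow> x \<in> X \<Longrightarrow> \<phi> b x \<in> X"
  using element_image by blast

lemma act_inv: "b \<in> carrier B \<Longrightarrow> x \<in> X \<Longrightarrow> \<phi> (inv\<^bsub>B\<^esub> b) (\<phi> b x) = x"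
  using composition_rule[of x "inv\<^bsub>B\<^esub> b" b] act_one by simp

lemma act_inv': "b \<in> carrier B \<Longrightarrow> x \<in> X \<Longrightarrow> \<phi> b (\<phi> (inv\<^bsub>B\<^esub> b) x) = x"
  using composition_rule[of x b "inv\<^bsub>B\<^esub> b"] act_one by simp

lemma mem_wreath: "(f, b) \<in> carrier W \<longleftrightarrow>
    f \<in> X \<rightarrow>\<^sub>E carrier A \<and> finite {x \<in> X. f x \<noteq> \<one>\<^bsub>A\<^esub>} \<and> b \<in> carrier B"
  by (auto simp: wreath_product_def semidirect_product_def carrier_sum_group A.is_group)

lemma mult_wreath: "(f', b') \<in> carrier W \<Longrightarrow>
    (f, b) \<otimes>\<^bsub>W\<^esub> (f', b') = ((\<lambda>x \<in> X. f x \<otimes>\<^bsub>A\<^esub> f' (\<phi> (inv\<^bsub>B\<^esub> b) x)), b \<otimes>\<^bsub>B\<^esub> b')"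
  by (auto simp: wreath_product_def semidirect_product_def permute_copies_def)

lemma one_wreath: "\<one>\<^bsub>W\<^esub> = ((\<lambda>x \<in> X. \<one>\<^bsub>A\<^esub>), \<one>\<^bsub>B\<^esub>)"
  by (simp add: wreath_product_def semidirect_product_def)

definition copy :: "'x \<Rightarrow> 'a \<Rightarrow> ('x \<Rightarrow> 'a) \<times> 'b" where
  "copy x a = ((\<lambda>y \<in> X. if y = x then a else \<one>\<^bsub>A\<^esub>), \<one>\<^bsub>B\<^esub>)"

definition acting :: "'b \<Rightarrow> ('x \<Rightarrow> 'a) \<times> 'b" where
  "acting b = ((\<lambda>x \<in> X. \<one>\<^bsub>A\<^esub>), b)"

lemma copy_closed: "a \<in> carrier A \<Longrightarrow> copy x a \<in> carrier W"
proof -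
  assume a: "a \<in> carrier A"
  have "{y \<in> X. (\<lambda>y \<in> X. if y = x then a else \<one>\<^bsub>A\<^esub>) y \<noteq> \<one>\<^bsub>A\<^esub>} \<subseteq> {x}" by auto
  then have "finite {y \<in> X. (\<lambda>y \<in> X. if y = x then a else \<one>\<^bsub>A\<^esub>) y \<noteq> \<one>\<^bsub>A\<^esub>}"
    by (rule finite_subset) simp
  then show ?thesis using a by (auto simp: copy_def mem_wreath)
qed

lemma acting_closed: "b \<in> carrier B \<Longrightarrow> acting b \<in> carrier W"
  by (auto simp: acting_def mem_wreath cong: conj_cong)

lemma copy_hom: "copy x \<in> hom A W"
proof -
  have "copy x (a \<otimes>\<^bsub>A\<^esub> a') = copy x a \<otimes>\<^bsub>W\<^esub> copy x a'" if "a \<in> carrier A" "a' \<in> carrier A" for a a'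
    using mult_wreath[OF copy_closed[OF that(2), unfolded copy_def]] that act_one
    by (auto simp: copy_def restrict_def)
  then show ?thesis using copy_closed by (auto simp: hom_def)
qed

lemma acting_hom: "acting \<in> hom B W"
proof -
  have "acting (b \<otimes>\<^bsub>B\<^esub> b') = acting b \<otimes>\<^bsub>W\<^esub> acting b'" if "b \<in> carrier B" "b' \<in> carrier B" for b b'
    using mult_wreath[OF acting_closed[OF that(2), unfolded acting_def]] that act_closed
    by (auto simp: acting_def restrict_def)
  then show ?thesis using acting_closed by (auto simp: hom_def)
qed

lemma copy_commute:
  assumes "x \<noteq> y" "a \<in> carrier A" "a' \<in> carrier A"
  shows "copy x a \<otimes>\<^bsub>W\<^esub> copy y a' = copy y a' \<otimes>\<^bsub>W\<^esub> copy x a"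
  using mult_wreath[OF copy_closed[OF assms(2), unfolded copy_def]]
    mult_wreath[OF copy_closed[OF assms(3), unfolded copy_def]] assms act_one
  by (auto simp: copy_def restrict_def)

lemma acting_copy:
  assumes b: "b \<in> carrier B" and x: "x \<in> X" and a: "a \<in> carrier A"
  shows "acting b \<otimes>\<^bsub>W\<^esub> copy x a = copy (\<phi> b x) a \<otimes>\<^bsub>W\<^esub> acting b"
proof -
  have "\<phi> (inv\<^bsub>B\<^esub> b) y = x \<longleftrightarrow> y = \<phi> b x" if "y \<in> X" for y
    using act_inv[OF b x] act_inv'[OF b that] by auto
  then show ?thesis
    using mult_wreath[OF copy_closed[OF a, unfolded copy_def]]
      mult_wreath[OF acting_closed[OF b, unfolded acting_def]] a b act_one act_closed
    by (auto simp: copy_def acting_def restrict_def)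
qed

text \<open>Induction on the support: splitting off the copy at one point leaves an element of
  smaller support.\<close>

lemma wreath_generated:
  assumes S: "subgroup S W" and copy: "\<And>x a. x \<in> X \<Longrightarrow> a \<in> carrier A \<Longrightarrow> copy x a \<in> S"
    and acting: "\<And>b. b \<in> carrier B \<Longrightarrow> acting b \<in> S"
  shows "carrier W \<subseteq> S"
proof
  have base: "(f, \<one>\<^bsub>B\<^esub>) \<in> S"
    if "finite F" "f \<in> X \<rightarrow>\<^sub>E carrier A" "{x \<in> X. f x \<noteq> \<one>\<^bsub>A\<^esub>} = F" for F f
    using that
  proof (induction F arbitrary: f rule: finite_induct)
    case empty
    then have "f = (\<lambda>x \<in> X. \<one>\<^bsub>A\<^esub>)" by (intro ext) (auto simp: PiE_iff extensional_def)
    then show ?case using subgroup.one_closed[OF S] unfolding one_wreath by (simp only:)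
  next
    case (insert x F)
    define g where "g = f(x := \<one>\<^bsub>A\<^esub>)"
    have x: "x \<in> X" "f x \<in> carrier A" using insert.prems by auto
    have g: "g \<in> X \<rightarrow>\<^sub>E carrier A" "{x \<in> X. g x \<noteq> \<one>\<^bsub>A\<^esub>} = F"
      using insert.prems insert.hyps x by (auto simp: g_def PiE_iff extensional_def)
    then have "(g, \<one>\<^bsub>B\<^esub>) \<in> carrier W" using insert.hyps by (simp add: mem_wreath)
    then have "copy x (f x) \<otimes>\<^bsub>W\<^esub> (g, \<one>\<^bsub>B\<^esub>) = (f, \<one>\<^bsub>B\<^esub>)"
      using insert.prems x act_one
      by (auto simp: copy_def mult_wreath g_def restrict_def PiE_iff extensional_def fun_eq_iff)
    moreover have "(g, \<one>\<^bsub>B\<^esub>) \<in> S" using insert.IH g by blast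
    ultimately show ?case using copy[OF x] subgroup.m_closed[OF S] by metis
  qed
  fix w assume "w \<in> carrier W"
  then obtain f b where w: "w = (f, b)" "(f, b) \<in> carrier W" by (cases w) auto
  then have fb: "f \<in> X \<rightarrow>\<^sub>E carrier A" "finite {x \<in> X. f x \<noteq> \<one>\<^bsub>A\<^esub>}" "b \<in> carrier B"
    by (auto simp: mem_wreath)
  have "(f, \<one>\<^bsub>B\<^esub>) \<otimes>\<^bsub>W\<^esub> acting b = (f, b)"
    using mult_wreath[OF acting_closed[OF fb(3), unfolded acting_def]] fb act_closed
    by (auto simp: acting_def PiE_iff extensional_def fun_eq_iff)
  then show "w \<in> S" using base[OF fb(2,1) refl] acting[OF fb(3)] subgroup.m_closed[OF S] w by metis
qed

section \<open>Necessity: from the wreath product to its factors\<close>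

lemma FA_acting:
  assumes "property_FA W"
  shows "property_FA B"
proof (rule property_FA_image[OF assms W.is_group])
  show "snd \<in> hom W B"
    by (auto simp: hom_def wreath_product_def semidirect_product_def)
  show "snd ` carrier W = carrier B"
  proof
    show "snd ` carrier W \<subseteq> carrier B" by (auto simp: mem_wreath)
    show "carrier B \<subseteq> snd ` carrier W"
      using acting_closed by (force simp: acting_def)
  qed
qed

text \<open>The sum of \<open>\<chi>\<close> over the coordinates does not change when
  \<open>B\<close> permutes them, so it is a homomorphism on the wreath product.\<close>

lemma integer_hom_wreath:
  assumes \<chi>: "\<chi> \<in> hom A integer_group" and a: "a \<in> carrier A" "\<chi> a \<noteq> 0" and X: "X \<noteq> {}"
  shows "\<not> property_FA W"
proof -
  interpret \<chi>: group_hom A integer_group \<chi>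
    using \<chi> by (simp add: group_hom_def group_hom_axioms_def)
  define supp where "supp f = {x \<in> X. f x \<noteq> \<one>\<^bsub>A\<^esub>}" for f
  define s where "s w = (\<Sum>x \<in> supp (fst w). \<chi> (fst w x))" for w :: "('x \<Rightarrow> 'a) \<times> 'b"
  have s: "s (f, b) = (\<Sum>x \<in> F. \<chi> (f x))" if "supp f \<subseteq> F" "F \<subseteq> X" "finite F" for f b F
    unfolding s_def fst_conv using that \<chi>.hom_one
    by (intro sum.mono_neutral_left) (auto simp: supp_def)
  have "s (w \<otimes>\<^bsub>W\<^esub> w') = s w + s w'" if "w \<in> carrier W" "w' \<in> carrier W" for w w'
  proof -
    obtain f b f' b' where w: "w = (f, b)" "w' = (f', b')" by (cases w, cases w')
    have W: "(f, b) \<in> carrier W" "(f', b') \<in> carrier W" using that w by auto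
    then have fb: "f \<in> X \<rightarrow>\<^sub>E carrier A" "finite (supp f)" "b \<in> carrier B"
      "f' \<in> X \<rightarrow>\<^sub>E carrier A" "finite (supp f')" by (auto simp: mem_wreath supp_def)
    \<comment> \<open>A finite set containing the support of \<open>f\<close> and that of the
      translate of \<open>f'\<close>, hence that of the product; all three sums can be taken over
      it.\<close>
    define F where "F = supp f \<union> \<phi> b ` supp f'"
    have F: "finite F" "F \<subseteq> X" "supp f \<subseteq> F" using fb act_closed by (auto simp: F_def supp_def)
    define g where "g = (\<lambda>x \<in> X. f x \<otimes>\<^bsub>A\<^esub> f' (\<phi> (inv\<^bsub>B\<^esub> b) x))"
    have "supp g \<subseteq> F"
    proof
      fix x assume "x \<in> supp g"
      then have x: "x \<in> X" "f x \<otimes>\<^bsub>A\<^esub> f' (\<phi> (inv\<^bsub>B\<^esub> b) x) \<noteq> \<one>\<^bsub>A\<^esub>" by (auto simp: supp_def g_def)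
      show "x \<in> F"
      proof (cases "f' (\<phi> (inv\<^bsub>B\<^esub> b) x) = \<one>\<^bsub>A\<^esub>")
        case True
        then show ?thesis using x fb(1) by (auto simp: F_def supp_def)
      next
        case False
        then have "\<phi> (inv\<^bsub>B\<^esub> b) x \<in> supp f'" using act_closed fb(3) x(1) by (simp add: supp_def)
        then show ?thesis unfolding F_def using act_inv'[OF fb(3) x(1)] by (metis UnI2 image_eqI)
      qed
    qed
    then have "s (g, b \<otimes>\<^bsub>B\<^esub> b') = (\<Sum>x \<in> F. \<chi> (g x))" using s F by blast
    also have "\<dots> = (\<Sum>x \<in> F. \<chi> (f x) + \<chi> (f' (\<phi> (inv\<^bsub>B\<^esub> b) x)))"
    proof (rule sum.cong)
      fix x assume "x \<in> F"
      then have "x \<in> X" using F by blast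
      then show "\<chi> (g x) = \<chi> (f x) + \<chi> (f' (\<phi> (inv\<^bsub>B\<^esub> b) x))"
        using fb act_closed[OF B.inv_closed[OF fb(3)]] by (auto simp: g_def PiE_iff)
    qed simp
    also have "\<dots> = (\<Sum>x \<in> F. \<chi> (f x)) + (\<Sum>x \<in> F. \<chi> (f' (\<phi> (inv\<^bsub>B\<^esub> b) x)))"
      by (rule sum.distrib)
    also have "(\<Sum>x \<in> F. \<chi> (f' (\<phi> (inv\<^bsub>B\<^esub> b) x))) = (\<Sum>y \<in> \<phi> (inv\<^bsub>B\<^esub> b) ` F. \<chi> (f' y))"
      using inj_on_subset[OF inj_prop[OF B.inv_closed[OF fb(3)]] F(2)] by (simp add: sum.reindex)
    also have "\<dots> = s (f', b')"
    proof (rule s[symmetric])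
      show "supp f' \<subseteq> \<phi> (inv\<^bsub>B\<^esub> b) ` F"
      proof
        fix y assume y: "y \<in> supp f'"
        then have "\<phi> (inv\<^bsub>B\<^esub> b) (\<phi> b y) = y" using act_inv fb(3) by (simp add: supp_def)
        then show "y \<in> \<phi> (inv\<^bsub>B\<^esub> b) ` F" using y unfolding F_def by (metis UnI2 image_eqI)
      qed
      show "\<phi> (inv\<^bsub>B\<^esub> b) ` F \<subseteq> X" using F(2) act_closed[OF B.inv_closed[OF fb(3)]] by blast
      show "finite (\<phi> (inv\<^bsub>B\<^esub> b) ` F)" using F(1) by simp
    qed
    also have "(\<Sum>x \<in> F. \<chi> (f x)) = s (f, b)" using s[OF F(3,2,1)] by simp
    finally show ?thesis using w mult_wreath[OF W(2), of f b] unfolding g_def by (simp only:)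
  qed
  then have "s \<in> hom W integer_group" by (auto simp: hom_def)
  moreover obtain x where x: "x \<in> X" using X by blast
  have "s (copy x a) = \<chi> a"
  proof -
    have "s (copy x a) = (\<Sum>y \<in> {x}. \<chi> ((\<lambda>y \<in> X. if y = x then a else \<one>\<^bsub>A\<^esub>) y))"
      unfolding copy_def using x by (intro s) (auto simp: supp_def split: if_splits)
    then show ?thesis using x by simp
  qed
  ultimately show ?thesis
    using integer_hom_not_FA[OF W.is_group _ copy_closed[OF a(1)], of s x] a(2) by simp
qed

text \<open>The largest length of a coordinate is insensitive to permutations of the coordinates, so
  it inherits the ultrametric inequality.\<close>

lemma unbounded_length_wreath:
  assumes ul: "ultrametric_length A \<nu>" and ub: "unbounded_length A \<nu>" and X: "X \<noteq> {}"
  shows "\<not> property_FA W"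
proof -
  define \<mu> where "\<mu> w = Max ((\<lambda>x. \<nu> (fst w x)) ` X)" for w :: "('x \<Rightarrow> 'a) \<times> 'b"
  \<comment> \<open>\<open>X\<close> may be infinite, but all points outside the support contribute
    the same value, the length of the identity, so the maximum is over a finite set.\<close>
  have fin: "finite ((\<lambda>x. \<nu> (f x)) ` X)" if "(f, b) \<in> carrier W" for f b
  proof -
    have "finite {x \<in> X. f x \<noteq> \<one>\<^bsub>A\<^esub>}" using that by (simp add: mem_wreath)
    then have "finite (insert (\<nu> \<one>\<^bsub>A\<^esub>) ((\<lambda>x. \<nu> (f x)) ` {x \<in> X. f x \<noteq> \<one>\<^bsub>A\<^esub>}))" by simp
    then show ?thesis by (rule finite_subset[rotated]) auto
  qed
  have ge: "\<nu> (f x) \<le> \<mu> (f, b)" if "(f, b) \<in> carrier W" "x \<in> X" for f b x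
    unfolding \<mu>_def using fin[OF that(1)] that(2) by (intro Max_ge) auto
  have "\<mu> (p \<otimes>\<^bsub>W\<^esub> inv\<^bsub>W\<^esub> q) \<le> max (\<mu> p) (\<mu> q)" if pq: "p \<in> carrier W" "q \<in> carrier W" for p q
  proof -
    obtain f b f' b' h c where e: "p = (f, b)" "q = (f', b')" "p \<otimes>\<^bsub>W\<^esub> inv\<^bsub>W\<^esub> q = (h, c)"
      by (metis surj_pair)
    have W: "(f, b) \<in> carrier W" "(f', b') \<in> carrier W" using pq e by auto
    have hc: "(h, c) \<in> carrier W" using W.m_closed[OF pq(1) W.inv_closed[OF pq(2)]] unfolding e(3) .
    from W hc have fh: "f \<in> X \<rightarrow>\<^sub>E carrier A" "f' \<in> X \<rightarrow>\<^sub>E carrier A" "h \<in> X \<rightarrow>\<^sub>E carrier A" "c \<in> carrier B"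
      by (auto simp: mem_wreath)
    \<comment> \<open>Comparing coordinates after multiplying the quotient by \<open>q\<close>
      avoids a formula for the inverse in the wreath product.\<close>
    have "(h, c) \<otimes>\<^bsub>W\<^esub> (f', b') = (f, b)"
      using W.m_assoc[OF pq(1) W.inv_closed[OF pq(2)] pq(2)] pq e by simp
    then have f: "f = (\<lambda>x \<in> X. h x \<otimes>\<^bsub>A\<^esub> f' (\<phi> (inv\<^bsub>B\<^esub> c) x))" using mult_wreath[OF W(2)] by simp
    have "\<nu> (h x) \<le> max (\<mu> p) (\<mu> q)" if x: "x \<in> X" for x
    proof -
      let ?y = "\<phi> (inv\<^bsub>B\<^esub> c) x"
      have y: "?y \<in> X" using act_closed[OF B.inv_closed[OF fh(4)] x] .
      have "f x = h x \<otimes>\<^bsub>A\<^esub> f' ?y" using f x by simp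
      then have "h x = f x \<otimes>\<^bsub>A\<^esub> inv\<^bsub>A\<^esub> f' ?y"
        using fh x y by (metis A.inv_solve_right PiE_mem)
      then have "\<nu> (h x) \<le> max (\<nu> (f x)) (\<nu> (f' ?y))"
        using A.ultrametric_lengthD[OF ul, of "f x" "f' ?y"] fh x y by auto
      also have "\<dots> \<le> max (\<mu> p) (\<mu> q)" using ge[OF W(1) x] ge[OF W(2) y] e by auto
      finally show ?thesis .
    qed
    then show ?thesis
      unfolding e(3) \<mu>_def[of "(h, c)"] using fin[OF hc] X by simp
  qed
  then have "ultrametric_length W \<mu>" unfolding ultrametric_length_def by blast
  moreover have "unbounded_length W \<mu>"
    unfolding unbounded_length_def
  proof
    fix n
    obtain a where a: "a \<in> carrier A" "n < \<nu> a" using ub unfolding unbounded_length_def by blast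
    obtain x where x: "x \<in> X" using X by blast
    have "\<nu> a \<le> \<mu> (copy x a)" using ge[OF copy_closed[OF a(1), unfolded copy_def] x, of x] x
      by (simp add: copy_def)
    then show "\<exists>w \<in> carrier W. n < \<mu> w" using a copy_closed by (intro bexI[of _ "copy x a"]) auto
  qed
  ultimately show ?thesis by (rule unbounded_length_not_FA[OF W.is_group])
qed

section \<open>Sufficiency: fixed vertices of the copies and of the wreath product\<close>

lemma conjugate_elliptic:
  assumes I: "tree_isometries V d W \<psi>" and b: "b \<in> carrier B" and x: "x \<in> X" and a: "a \<in> carrier A"
    and v: "v \<in> V" "\<psi> (copy (\<phi> b x) a) v = v"
  shows "\<exists>u \<in> V. \<psi> (copy x a) u = u"
proof -
  interpret I: tree_isometries V d W \<psi> by fact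
  let ?t = "acting b" and ?u = "\<psi> (inv\<^bsub>W\<^esub> acting b) v"
  have t: "?t \<in> carrier W" "inv\<^bsub>W\<^esub> ?t \<in> carrier W" using acting_closed[OF b] by auto
  have u: "?u \<in> V" using I.act_closed[OF t(2) v(1)] .
  have "\<psi> ?t (\<psi> (copy x a) ?u) = \<psi> (copy (\<phi> b x) a) (\<psi> ?t ?u)"
    using I.act_mult[OF t(1) copy_closed[OF a, of x] u]
      I.act_mult[OF copy_closed[OF a, of "\<phi> b x"] t(1) u] acting_copy[OF b x a] by simp
  also have "\<dots> = v" using I.act_inv'[OF t(1) v(1)] v(2) by simp
  finally have "\<psi> (inv\<^bsub>W\<^esub> ?t) (\<psi> ?t (\<psi> (copy x a) ?u)) = ?u" by simp
  then have "\<psi> (copy x a) ?u = ?u"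
    using I.act_inv[OF t(1) I.act_closed[OF copy_closed[OF a] u]] by simp
  then show ?thesis using u by blast
qed

text \<open>Here \<open>A\<close> acts through the copy at \<open>\<phi> b x\<close>, and
  \<open>\<psi> (copy x a)\<close> is an outside map commuting with that action; this is why
  \<open>centralizer_hyperbolic\<close> takes \<open>T\<close> as a map and not as a group element.
  Its conclusion is applied to \<open>a\<close> itself, whose two copies are conjugate.\<close>

lemma copy_elliptic:
  assumes I: "tree_isometries V d W \<psi>" and fin: "finite (carrier (abelianisation A))"
    and b: "b \<in> carrier B" and x: "x \<in> X" "\<phi> b x \<noteq> x" and a: "a \<in> carrier A"
  shows "\<exists>v \<in> V. \<psi> (copy x a) v = v"
proof (rule ccontr)
  assume none: "\<not> (\<exists>v \<in> V. \<psi> (copy x a) v = v)"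
  interpret I: tree_isometries V d W \<psi> by fact
  let ?y = "\<phi> b x"
  have y: "?y \<in> X" using act_closed[OF b x(1)] .
  interpret Y: tree_isometries V d A "\<psi> \<circ> copy ?y"
    using I.tree_isometries_hom[OF A.is_group copy_hom] .
  have xa: "copy x a \<in> carrier W" using copy_closed[OF a] .
  have comm: "\<psi> (copy x a) ((\<psi> \<circ> copy ?y) g v) = (\<psi> \<circ> copy ?y) g (\<psi> (copy x a) v)"
    if g: "g \<in> carrier A" and v: "v \<in> V" for g v
    using I.act_mult[OF xa copy_closed[OF g, of ?y] v] I.act_mult[OF copy_closed[OF g, of ?y] xa v]
      copy_commute[OF x(2) g a] by simp
  obtain \<chi> where \<chi>: "\<chi> \<in> hom A integer_group" "\<forall>g \<in> carrier A. \<chi> g = 0 \<longrightarrow> Y.Fix {g} \<noteq> {}"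
    using Y.centralizer_hyperbolic[of "\<psi> (copy x a)", OF I.act_closed[OF xa] I.isometry[OF xa] comm _
        I.no_inversion[OF xa]] none by blast
  then have "Y.Fix {a} \<noteq> {}" using A.hom_integer_group_trivial[OF fin \<chi>(1) a] a by blast
  then obtain v where "v \<in> V" "\<psi> (copy ?y a) v = v" unfolding Y.Fix_def by auto
  then show False using conjugate_elliptic[OF I b x(1) a] none by blast
qed

lemma FA_wreath:
  assumes FA: "property_FA B" and fin: "finite (carrier (abelianisation A))"
    and nu: "\<not> union_of_properly_increasing_subgroups A"
    and X: "X \<noteq> {}" and orb: "finite (orbits B X \<phi>)"
    and nontriv: "\<forall>Y \<in> orbits B X \<phi>. \<exists>x \<in> Y. \<exists>y \<in> Y. x \<noteq> y"
  shows "property_FA W"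
  unfolding property_FA_def
proof (intro allI impI, elim conjE)
  fix V :: "(('x \<Rightarrow> 'a) \<times> 'b) list set" and E \<psi>
  assume T: "simplicial_tree V E" and ta: "tree_action W V E \<psi>" and inv: "without_inversions W E \<psi>"
  have I: "tree_isometries V (graph_dist E) W \<psi>" using tree_action_isometries[OF T ta inv] .
  interpret I: tree_isometries V "graph_dist E" W \<psi> by (rule I)
  have move: "\<exists>b \<in> carrier B. \<phi> b x \<noteq> x" if x: "x \<in> X" for x
  proof -
    have "orbit B \<phi> x \<in> orbits B X \<phi>" using x unfolding orbits_def by blast
    then obtain y z where "y \<in> orbit B \<phi> x" "z \<in> orbit B \<phi> x" "y \<noteq> z" using nontriv by blast
    then show ?thesis unfolding orbit_def by auto metis
  qed
  have copy_fix: "I.Fix (copy x ` carrier A) \<noteq> {}" if x: "x \<in> X" for x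
  proof
    assume none: "I.Fix (copy x ` carrier A) = {}"
    interpret Y: tree_isometries V "graph_dist E" A "\<psi> \<circ> copy x"
      using I.tree_isometries_hom[OF A.is_group copy_hom] .
    obtain b where b: "b \<in> carrier B" "\<phi> b x \<noteq> x" using move[OF x] by blast
    have "Y.Fix {a} \<noteq> {}" if "a \<in> carrier A" for a
      using copy_elliptic[OF I fin b(1) x b(2) that] unfolding Y.Fix_def by auto
    moreover have "Y.Fix (carrier A) = {}" using none unfolding Y.Fix_def I.Fix_def by auto
    ultimately obtain \<nu> where "ultrametric_length A \<nu>" "unbounded_length A \<nu>"
      using Y.elliptic_without_fixed_point by blast
    then show False using A.unbounded_length_imp_union nu by blast
  qed
  obtain p where "p \<in> V" "\<forall>b \<in> carrier B. (\<psi> \<circ> acting) b p = p"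
    using property_FA_fixes_vertex[OF FA T tree_action_hom[OF ta acting_hom group_B]
        without_inversions_hom[OF inv acting_hom]] by blast
  then have "p \<in> I.Fix (acting ` carrier B)" by (simp add: I.Fix_def)
  then have acting_fix: "I.Fix (acting ` carrier B) \<noteq> {}" by blast
  \<comment> \<open>One point from each orbit; this finite set bounds the distances in
    \<open>permuted_family_fixed_point\<close>.\<close>
  define R where "R = (\<lambda>Y. SOME x. x \<in> Y) ` orbits B X \<phi>"
  have R: "(SOME x. x \<in> Y) \<in> Y" if "Y \<in> orbits B X \<phi>" for Y
    using nontriv that by (metis someI)
  have "\<exists>v. v \<in> I.Fix (acting ` carrier B) \<and> (\<forall>x \<in> X. v \<in> I.Fix (copy x ` carrier A))"
  \<comment> \<open>The family is permuted by the elements \<open>acting b\<close>; the permutation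
    of the indices is read off from the second component.\<close>
  proof (rule I.permuted_family_fixed_point[where \<psi> = "\<lambda>k. \<phi> (snd k)" and R = R])
    show "copy x ` carrier A \<subseteq> carrier W" for x using copy_closed by blast
    show "I.Fix (copy x ` carrier A) \<noteq> {}" if "x \<in> X" for x using copy_fix[OF that] .
    show "g \<otimes>\<^bsub>W\<^esub> h = h \<otimes>\<^bsub>W\<^esub> g"
      if "x \<noteq> y" "g \<in> copy x ` carrier A" "h \<in> copy y ` carrier A" for x y g h
      using that copy_commute by auto
    show "acting ` carrier B \<subseteq> carrier W" using acting_closed by blast
    show "I.Fix (acting ` carrier B) \<noteq> {}" by (rule acting_fix)
    show "\<phi> (snd k) ` X = X" if "k \<in> acting ` carrier B" for k
      using that surj_prop unfolding acting_def by force
    show "\<psi> k v \<in> I.Fix (copy (\<phi> (snd k) x) ` carrier A)"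
      if k: "k \<in> acting ` carrier B" and x: "x \<in> X" and v: "v \<in> I.Fix (copy x ` carrier A)" for k x v
    proof -
      obtain b where b: "k = acting b" "b \<in> carrier B" using k by blast
      have vV: "v \<in> V" using v I.Fix_in(1) by blast
      have "\<psi> (copy (\<phi> b x) a) (\<psi> (acting b) v) = \<psi> (acting b) v" if a: "a \<in> carrier A" for a
        using I.act_mult[OF copy_closed[OF a, of "\<phi> b x"] acting_closed[OF b(2)] vV]
          I.act_mult[OF acting_closed[OF b(2)] copy_closed[OF a, of x] vV]
          acting_copy[OF b(2) x a] I.Fix_in(2)[OF v imageI[OF a]] by simp
      then show ?thesis
        using b I.act_closed[OF acting_closed[OF b(2)] vV] by (auto simp: I.Fix_def acting_def)
    qed
    show "finite R" using orb by (simp add: R_def)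
    show "R \<subseteq> X"
      unfolding R_def using R orbits_coverture by blast
    show "\<exists>r \<in> R. \<exists>k \<in> acting ` carrier B. x = \<phi> (snd k) r" if x: "x \<in> X" for x
    proof -
      let ?Y = "orbit B \<phi> x"
      have Y: "?Y \<in> orbits B X \<phi>" using x unfolding orbits_def by blast
      let ?r = "SOME r. r \<in> ?Y"
      have r: "?r \<in> ?Y" "?r \<in> R" using R[OF Y] Y unfolding R_def by blast+
      then have "?r \<in> X" using Y orbits_coverture by blast
      then have "x \<in> orbit B \<phi> ?r" using orbit_sym[OF x _ r(1)] by blast
      then obtain b where b: "b \<in> carrier B" "x = \<phi> b ?r" unfolding orbit_def by blast
      then have "x = \<phi> (snd (acting b)) ?r" by (simp add: acting_def)
      then show ?thesis using r(2) b(1) by blast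
    qed
    show "X \<noteq> {}" by (rule X)
  qed
  then obtain v where v: "v \<in> I.Fix (acting ` carrier B)" "\<And>x. x \<in> X \<Longrightarrow> v \<in> I.Fix (copy x ` carrier A)"
    by blast
  interpret WA: group_action W V \<psi> using ta by (simp add: tree_action_def)
  have vV: "v \<in> V" using v(1) I.Fix_in(1) by blast
  have "carrier W \<subseteq> stabilizer W \<psi> v"
  proof (rule wreath_generated)
    show "subgroup (stabilizer W \<psi> v) W" using WA.stabilizer_subgroup[OF vV] .
    show "copy x a \<in> stabilizer W \<psi> v" if "x \<in> X" "a \<in> carrier A" for x a
      using I.Fix_in(2)[OF v(2)[OF that(1)]] that(2) copy_closed by (auto simp: stabilizer_def)
    show "acting b \<in> stabilizer W \<psi> v" if "b \<in> carrier B" for b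
      using I.Fix_in(2)[OF v(1)] that acting_closed by (auto simp: stabilizer_def)
  qed
  then show "\<exists>v \<in> V. \<forall>g \<in> carrier W. \<psi> g v = v" using vV unfolding stabilizer_def by blast
qed

end

theorem theorem1p1:
  fixes A :: "('a, 'p) monoid_scheme"
    and B :: "('b, 'q) monoid_scheme"
    and X :: "'x set"
    and \<phi> :: "'b \<Rightarrow> 'x \<Rightarrow> 'x"
  assumes "group A"
    and "group B"
    and "group_action B X \<phi>"
    and "carrier A \<noteq> {\<one>\<^bsub>A\<^esub>}"
    and "X \<noteq> {}"
    and "finite (orbits B X \<phi>)"
    and "\<forall>Y \<in> orbits B X \<phi>. \<exists>x \<in> Y. \<exists>y \<in> Y. x \<noteq> y"
  shows "property_FA (wreath_product A X B \<phi>) \<longleftrightarrow>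
         property_FA B \<and> finite (carrier (abelianisation A)) \<and>
         \<not> union_of_properly_increasing_subgroups A"
proof -
  interpret permutational_wreath A B X \<phi> using assms(1,3) by (rule permutational_wreath.intro)
  show ?thesis
  proof (intro iffI conjI)
    assume FA: "property_FA W"
    show "property_FA B" using FA_acting[OF FA] .
    show "finite (carrier (abelianisation A))"
    proof (rule ccontr)
      assume "infinite (carrier (abelianisation A))"
      from A.infinite_abelianisation[OF this] show False
        using integer_hom_wreath unbounded_length_wreath assms(5) FA by blast
    qed
    show "\<not> union_of_properly_increasing_subgroups A"
      using A.union_imp_unbounded_length unbounded_length_wreath assms(5) FA by blast
  next
    assume "property_FA B \<and> finite (carrier (abelianisation A)) \<and>
      \<not> union_of_properly_increasing_subgroups A"
    then show "property_FA W" using FA_wreath assms(5-7) by blast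
  qed
qed

end
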